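(* For every $n\geq 0$, every partition $\lambda\vdash n$ and every $\mathsf{e}\in\mathbb{E}_n$, one has the identity of rational functions of $q$ $$q^{|\mathsf{e}|-|\mathsf{e}_{\lambda}|}\frac{c_{\lambda}(\mathsf{e};q)}{\prod_{i}[\lambda_i]_q!}=\sum_{T\in\mathrm{SYT}(\lambda)}p_{T}(\mathsf{e};q).$$ In particular $c_{\lambda}(\mathsf{e};1)\geq 0$ for all $\lambda\vdash n$ and $\mathsf{e}\in\mathbb{E}_n$ (i.e., the Stanley–Stembridge conjecture holds).
   Context: $q$-integers: $[n]_q=\frac{1-q^n}{1-q}$, $[n]_q!=\prod_{i=1}^n[i]_q$. $\mathbb{E}_n$ is the set of sequences $\mathsf{e}=(\mathsf{e}(1),\ldots,\mathsf{e}(n))$ of integers with $0\leq\mathsf{e}(i)<i$ and $\mathsf{e}(i)\leq\mathsf{e}(i+1)$; $|\mathsf{e}|=\sum_i\mathsf{e}(i)$. For a partition $\lambda=(\lambda_1,\ldots,\lambda_l)$ put $|\mathsf{e}_\lambda|=\sum_{i<j}\lambda_i\lambda_j$. To $\mathsf{e}\in\mathbb{E}_n$ associate the Hessenberg function $\mathsf{h}(i)=n-\mathsf{e}(n+1-i)$ and the oriented graph $\Gamma_{\mathsf{e}}$ on vertex set $\{1,\ldots,n\}$ with edges $i\to j$ for $i<j\leq\mathsf{h}(i)$ (a unit interval graph). Its chromatic quasisymmetric function is $\mathcal{X}(\mathsf{e};q)=\sum_{\kappa}q^{\mathrm{asc}(\kappa)}\prod_{v}x_{\kappa(v)}$, summed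 over proper colorings $\kappa:\{1,\ldots,n\}\to\mathbb{Z}_{>0}$ (adjacent vertices get different colors), where $\mathrm{asc}(\kappa)$ is the number of edges $u\to v$ with $\kappa(u)<\kappa(v)$. It is a symmetric function (Shareshian–Wachs), and $c_\lambda(\mathsf{e};q)$ are defined by $\mathcal{X}(\mathsf{e};q)=\sum_{\lambda\vdash n}c_\lambda(\mathsf{e};q)e_\lambda$ with $e_\lambda$ the elementary symmetric functions. Young diagrams in French convention: $\lambda$ is identified with $\{(i,j):1\leq j\leq l,1\leq i\leq\lambda_j\}$, box $(i,j)$ being in column $i$ and row $j$, $(1,1)$ at bottom left. A standard Young tableau (SYT) of shape $\lambda\vdash n$ is a bijection $T:\lambda\to\{1,\ldots,n\}$ increasing along rows and up columns; $\mathrm{SYT}(\lambda)$ is their set and $\mathrm{SYT}_n=\bigcup_{\lambda\vdash n}\mathrm{SYT}(\lambda)$. Color sequence: for $T\in\mathrm{SYT}_n$ and $0\leq r\leq n$, let $\boldsymbol\delta^{(r)}(T)=(\delta_1,\ldots,\delta_{n+1})$ with $\delta_i=1$ if the $i$-th column of $T$ is nonempty and its top box has label $>r$, and $\delta_i=0$ otherwise. Write uniquely $\boldsymbol\delta^{(r)}(T)=(1^{b_0},0^{a_1},1^{b_1},\ldots,0^{a_l},1^{b_l},0^{a_{l+1}})$ with $b_0\geq0$, $a_i,b_i>0$ for $1\leq i\leq l$ (here $1^b$ means $b$ consecutive $1$'s), and set $l^{(r)}(T)=l$. For $0\leq k\leq l$ let $c_k^{(r)}(T)=\sum_{i=1}^k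 a_i+\sum_{i=0}^k b_i+1$, let $f_k^{(r)}(T)\in\mathrm{SYT}_{n+1}$ be obtained by adding a box labeled $n+1$ on top of column $c_k^{(r)}(T)$ of $T$, and let $$\varphi_k^{(r)}(T;q)=q^{\sum_{i=1}^k a_i}\prod_{i=1}^{k}\frac{\left[\sum_{j=i+1}^{k}a_j+\sum_{j=i}^{k}b_j\right]_q}{\left[\sum_{j=i}^{k}a_j+\sum_{j=i}^{k}b_j\right]_q}\prod_{i=k+1}^{l}\frac{\left[\sum_{j=k+1}^{i}a_j+\sum_{j=k+1}^{i-1}b_j\right]_q}{\left[\sum_{j=k+1}^{i}a_j+\sum_{j=k+1}^{i}b_j\right]_q}.$$ Define $p_T(\mathsf{e};q)$ for $T\in\mathrm{SYT}_n$, $\mathsf{e}\in\mathbb{E}_n$: letting $T_i$ be $T$ with all boxes of label $>i$ removed, $p_T(\mathsf{e};q)=\prod_{i=1}^n\varphi_{k_i}^{(\mathsf{e}(i))}(T_{i-1};q)$ if for every $i$ there is $k_i$ with $T_i=f_{k_i}^{(\mathsf{e}(i))}(T_{i-1})$, and $p_T(\mathsf{e};q)=0$ otherwise. *)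

theory Defs
  imports
    Complex_Main
    "HOL-Library.Multiset"
    "HOL-Library.FuncSet"
    "HOL-Computational_Algebra.Polynomial"
    "HOL-Computational_Algebra.Polynomial_Factorial"
begin

definition partitions :: "nat \<Rightarrow> nat list set" where
  "partitions n = {lam. sorted_wrt (\<ge>) lam \<and> (\<forall>x\<in>set lam. 0 < x) \<and> sum_list lam = n}"

text \<open>The number \<open>|e\<^sub>\<lambda>|\<close>, i.e. the second elementary symmetric polynomial of the parts.\<close>

definition part_pairs :: "nat list \<Rightarrow> nat" where
  "part_pairs lam = (\<Sum>(i, j) \<in> {(i, j). i < j \<and> j < length lam}. lam ! i * lam ! j)"

text \<open>
  The field of rational functions in \<open>q\<close> is \<^typ>\<open>int poly fract\<close>. The \<open>q\<close>-integers are only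
  meaningful for \<open>q \<noteq> 1\<close>; they are used at the indeterminate \<open>qvar\<close>.
\<close>

definition qvar :: "int poly fract" where
  "qvar = to_fract [:0, 1:]"

definition qint :: "'a::field \<Rightarrow> nat \<Rightarrow> 'a" where
  "qint q n = (1 - q ^ n) / (1 - q)"

definition qfact :: "'a::field \<Rightarrow> nat \<Rightarrow> 'a" where
  "qfact q n = (\<Prod>i = 1..n. qint q i)"


text \<open>A sequence is a function on \<^typ>\<open>nat\<close> of which only the values at \<open>1, \<dots>, n\<close> matter.\<close>

definition ESeq :: "nat \<Rightarrow> (nat \<Rightarrow> nat) set" where
  "ESeq n = {e. (\<forall>i\<in>{1..n}. e i < i) \<and> (\<forall>i\<in>{1..<n}. e i \<le> e (i + 1))}"

definition eseq_sum :: "nat \<Rightarrow> (nat \<Rightarrow> nat) \<Rightarrow> nat" where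
  "eseq_sum n e = (\<Sum>i = 1..n. e i)"

definition hess :: "nat \<Rightarrow> (nat \<Rightarrow> nat) \<Rightarrow> nat \<Rightarrow> nat" where
  "hess n e i = n - e (n + 1 - i)"

definition edges :: "nat \<Rightarrow> (nat \<Rightarrow> nat) \<Rightarrow> (nat \<times> nat) set" where
  "edges n e = {(i, j). i \<in> {1..n} \<and> j \<in> {1..n} \<and> i < j \<and> j \<le> hess n e i}"

definition proper_colorings :: "nat \<Rightarrow> (nat \<Rightarrow> nat) \<Rightarrow> (nat \<Rightarrow> nat) set" where
  "proper_colorings n e =
     {\<kappa> \<in> {1..n} \<rightarrow>\<^sub>E {1..}. \<forall>(u, v) \<in> edges n e. \<kappa> u \<noteq> \<kappa> v}"

definition asc :: "nat \<Rightarrow> (nat \<Rightarrow> nat) \<Rightarrow> (nat \<Rightarrow> nat) \<Rightarrow> nat" where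
  "asc n e \<kappa> = card {(u, v). (u, v) \<in> edges n e \<and> \<kappa> u < \<kappa> v}"

text \<open>
  A formal power series in variables \<open>x\<^sub>i\<close> is the function assigning to each monomial its
  coefficient; a monomial is the multiset of the indices of its variables. Only variables
  \<open>x\<^sub>1, x\<^sub>2, \<dots>\<close> occur below.
\<close>

type_synonym 'a mseries = "nat multiset \<Rightarrow> 'a"

definition mseries_one :: "'a::comm_semiring_1 mseries" where
  "mseries_one M = (if M = {#} then 1 else 0)"

definition mseries_mult :: "'a::comm_semiring_1 mseries \<Rightarrow> 'a mseries \<Rightarrow> 'a mseries" where
  "mseries_mult f g M = (\<Sum>A | A \<subseteq># M. f A * g (M - A))"

text \<open>The \<open>k\<close>-th elementary symmetric function is the sum of the monomials of the
  \<open>k\<close>-element sets of positive integers.\<close>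

definition elem_sym :: "nat \<Rightarrow> 'a::comm_semiring_1 mseries" where
  "elem_sym k M = (if \<exists>S. finite S \<and> S \<subseteq> {1..} \<and> card S = k \<and> M = mset_set S then 1 else 0)"

definition elem_sym_part :: "nat list \<Rightarrow> 'a::comm_semiring_1 mseries" where
  "elem_sym_part lam = foldr mseries_mult (map elem_sym lam) mseries_one"

text \<open>The set of colorings with a given monomial is finite, so the inner sum is a genuine one.\<close>

definition chrom_qsym :: "nat \<Rightarrow> (nat \<Rightarrow> nat) \<Rightarrow> int poly mseries" where
  "chrom_qsym n e M =
     (\<Sum>\<kappa> | \<kappa> \<in> proper_colorings n e \<and> image_mset \<kappa> (mset_set {1..n}) = M.
        monom 1 (asc n e \<kappa>))"

text \<open>The coefficients \<open>c\<^sub>\<lambda>(e; q) \<in> \<int>[q]\<close> of the chromatic quasisymmetric function in the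
  basis of elementary symmetric functions; the coefficient function is set to zero outside the
  partitions of \<open>n\<close> to make it unique.\<close>

definition e_coeff :: "nat \<Rightarrow> (nat \<Rightarrow> nat) \<Rightarrow> nat list \<Rightarrow> int poly" where
  "e_coeff n e =
     (THE c. (\<forall>lam. lam \<notin> partitions n \<longrightarrow> c lam = 0) \<and>
             (\<forall>M. chrom_qsym n e M = (\<Sum>lam \<in> partitions n. c lam * elem_sym_part lam M)))"


text \<open>French convention: the box \<open>(i, j)\<close> lies in column \<open>i\<close> and row \<open>j\<close>, both counted from 1.\<close>

definition diagram :: "nat list \<Rightarrow> (nat \<times> nat) set" where
  "diagram lam = {(i, j). 1 \<le> j \<and> j \<le> length lam \<and> 1 \<le> i \<and> i \<le> lam ! (j - 1)}"

text \<open>A tableau is a partial map from boxes to labels; its shape is its domain.\<close>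

type_synonym tableau = "nat \<times> nat \<Rightarrow> nat option"

definition label :: "tableau \<Rightarrow> nat \<times> nat \<Rightarrow> nat" where
  "label T x = the (T x)"

definition SYT :: "nat list \<Rightarrow> tableau set" where
  "SYT lam = {T. dom T = diagram lam \<and>
     bij_betw (label T) (diagram lam) {1..sum_list lam} \<and>
     (\<forall>i i' j. (i, j) \<in> diagram lam \<and> (i', j) \<in> diagram lam \<and> i < i'
        \<longrightarrow> label T (i, j) < label T (i', j)) \<and>
     (\<forall>i j j'. (i, j) \<in> diagram lam \<and> (i, j') \<in> diagram lam \<and> j < j'
        \<longrightarrow> label T (i, j) < label T (i, j'))}"

definition tab_size :: "tableau \<Rightarrow> nat" where
  "tab_size T = card (dom T)"

definition col_height :: "tableau \<Rightarrow> nat \<Rightarrow> nat" where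
  "col_height T i = card {j. (i, j) \<in> dom T}"

definition tab_upto :: "nat \<Rightarrow> tableau \<Rightarrow> tableau" where
  "tab_upto m T = T |` {x. label T x \<le> m}"

definition add_on_column :: "nat \<Rightarrow> tableau \<Rightarrow> tableau" where
  "add_on_column c T = T((c, col_height T c + 1) \<mapsto> tab_size T + 1)"


definition color_seq :: "nat \<Rightarrow> tableau \<Rightarrow> nat list" where
  "color_seq r T =
     map (\<lambda>i. if 0 < col_height T i \<and> r < label T (i, col_height T i) then 1 else 0)
       [1..<tab_size T + 2]"

text \<open>\<open>is_color_runs \<delta> (l, a, b)\<close> says that
  \<open>\<delta> = (1\<^bsup>b 0\<^esup>, 0\<^bsup>a 1\<^esup>, 1\<^bsup>b 1\<^esup>, \<dots>, 0\<^bsup>a l\<^esup>, 1\<^bsup>b l\<^esup>, 0\<^bsup>a (l+1)\<^esup>)\<close>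
  with \<open>a i, b i > 0\<close> for \<open>1 \<le> i \<le> l\<close>; the irrelevant values of \<open>a\<close> and \<open>b\<close> are fixed to be
  zero to make the triple unique.\<close>

fun is_color_runs :: "nat list \<Rightarrow> nat \<times> (nat \<Rightarrow> nat) \<times> (nat \<Rightarrow> nat) \<Rightarrow> bool" where
  "is_color_runs \<delta> (l, a, b) \<longleftrightarrow>
     \<delta> = replicate (b 0) 1
         @ concat (map (\<lambda>i. replicate (a i) 0 @ replicate (b i) 1) [1..<l + 1])
         @ replicate (a (l + 1)) 0 \<and>
     (\<forall>i\<in>{1..l}. 0 < a i \<and> 0 < b i) \<and>
     (\<forall>i. i \<notin> {1..l + 1} \<longrightarrow> a i = 0) \<and> (\<forall>i. i \<notin> {0..l} \<longrightarrow> b i = 0)"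

definition color_runs :: "nat \<Rightarrow> tableau \<Rightarrow> nat \<times> (nat \<Rightarrow> nat) \<times> (nat \<Rightarrow> nat)" where
  "color_runs r T = (THE p. is_color_runs (color_seq r T) p)"

definition run_count :: "nat \<Rightarrow> tableau \<Rightarrow> nat" where
  "run_count r T = fst (color_runs r T)"

definition run_a :: "nat \<Rightarrow> tableau \<Rightarrow> nat \<Rightarrow> nat" where
  "run_a r T = fst (snd (color_runs r T))"

definition run_b :: "nat \<Rightarrow> tableau \<Rightarrow> nat \<Rightarrow> nat" where
  "run_b r T = snd (snd (color_runs r T))"

definition add_col :: "nat \<Rightarrow> tableau \<Rightarrow> nat \<Rightarrow> nat" where
  "add_col r T k = (\<Sum>i = 1..k. run_a r T i) + (\<Sum>i = 0..k. run_b r T i) + 1"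

definition add_box :: "nat \<Rightarrow> nat \<Rightarrow> tableau \<Rightarrow> tableau" where
  "add_box r k T = add_on_column (add_col r T k) T"

definition phi :: "'a::field \<Rightarrow> nat \<Rightarrow> nat \<Rightarrow> tableau \<Rightarrow> 'a" where
  "phi q r k T =
     (let a = run_a r T; b = run_b r T; l = run_count r T in
      q ^ (\<Sum>i = 1..k. a i)
      * (\<Prod>i = 1..k. qint q ((\<Sum>j = i + 1..k. a j) + (\<Sum>j = i..k. b j))
                    / qint q ((\<Sum>j = i..k. a j) + (\<Sum>j = i..k. b j)))
      * (\<Prod>i = k + 1..l. qint q ((\<Sum>j = k + 1..i. a j) + (\<Sum>j = k + 1..i - 1. b j))
                        / qint q ((\<Sum>j = k + 1..i. a j) + (\<Sum>j = k + 1..i. b j))))"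

definition is_step :: "(nat \<Rightarrow> nat) \<Rightarrow> tableau \<Rightarrow> nat \<Rightarrow> nat \<Rightarrow> bool" where
  "is_step e T i k \<longleftrightarrow>
     k \<le> run_count (e i) (tab_upto (i - 1) T) \<and>
     tab_upto i T = add_box (e i) k (tab_upto (i - 1) T)"

text \<open>The index \<open>k\<close> of a step is unique when it exists, because different \<open>k\<close> give different
  columns.\<close>

definition pT :: "'a::field \<Rightarrow> (nat \<Rightarrow> nat) \<Rightarrow> tableau \<Rightarrow> 'a" where
  "pT q e T =
     (if \<forall>i\<in>{1..tab_size T}. \<exists>k. is_step e T i k
      then \<Prod>i = 1..tab_size T. phi q (e i) (THE k. is_step e T i k) (tab_upto (i - 1) T)
      else 0)"

end

theory Submission
  imports Defs "HOL-Library.Function_Algebras"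
begin

text \<open>
  A tableau is the word of the columns of its labels \<open>1, \<dots>, n\<close>. If \<open>A\<close> is the set of columns
  whose top label exceeds \<open>r\<close> (equivalently, of the letters after the \<open>r\<close>-th), then Hikita's weight of
  adding a box to column \<open>c\<close> is the residue at \<open>x = q\<^sup>c\<close> of
  \<open>1 / (x - q) * (\<Prod>a\<in>A. (x - q ^ a) / (x - q ^ (a + 1)))\<close>. Colorings, read from vertex \<open>n\<close> down to
  vertex \<open>1\<close>, are words too, with letter weights depending on the set of colors of the neighbors.

  Both sums over words arise from the empty word by applying operators \<open>D\<^sub>+\<close> (append a letter, weighted
  by the set of active letters) and \<open>D\<^sub>-\<close> (deactivate the oldest active letter) in the order prescribed by
  \<open>e\<close>. In both systems the weights obey one exchange law, so that \<open>D\<^sub>+\<close>, \<open>D\<^sub>-\<close>, their commutator \<open>\<Phi>\<close> and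
  Hecke operators exchanging adjacent active letters satisfy the same relations. These relations reduce
  every product of the \<open>D\<^sub>+\<close>, \<open>D\<^sub>-\<close> from the empty word to itself to a polynomial, the same in both
  systems, in the loops \<open>D\<^sub>- \<Phi>\<^sup>b D\<^sub>+\<close>; and the loops agree because an explicit matrix intertwines the
  action of \<open>\<Phi>\<close> on one-letter words.

  So the sums agree for generic values of \<open>x\<^sub>1, \<dots>, x\<^sub>m\<close>. Powers \<open>x\<^sub>i = z ^ ((n + 1) ^ i)\<close> separate the
  monomials of degree \<open>n\<close>, and the \<open>e\<^sub>\<lambda>\<close> are unitriangular, whence the coefficients. Positivity is visible
  on the tableau side, where every factor is a quotient of polynomials positive at \<open>q = 1\<close>.
\<close>

text \<open>Up to normalization and the direction of reading, the relations are those of the Dyck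
  path algebra of Carlsson and Mellit, with \<open>Ph\<close> as the rotation of an affine Hecke
  algebra. The obstacle is closure under \<open>Dm\<close>: it shifts every \<open>U i\<close> with
  i \<ge> 1, passes \<open>Ph\<close> at the price of an inverse of \<open>U 0\<close>, and passes
  \<open>Dp\<close> at the price of a new \<open>Ph\<close>, but no relation carries a single
  \<open>Dm\<close> past \<open>U 0\<close>. So \<open>U 0\<close> has to be removed from the
  outside first. It becomes a scalar on \<open>Dp ^^ k\<close> and can be pushed through
  \<open>Ph\<close>, except in one chain of maximal length, which gives \<open>Y k\<close>. As
  \<open>Y k\<close> commutes with \<open>Dp\<close>, it can be pulled back to one active letter
  less, where an induction applies.

  States without active letters are scalars in each system, so a loop acts by a number, and
  comparing loops is enough. There the systems do not correspond letter by letter: on columns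
  \<open>Ph\<close> sends s to 1 and s + 1 only, on colors it reaches every color from s upward. The
  intertwiner is built from sums over subsets of the variables, whose recursion from size c to c + 1
  mirrors the step of columns from s to s + 1.\<close>

definition swap_at :: "nat \<Rightarrow> 'a list \<Rightarrow> 'a list" where
  "swap_at i xs = xs[i := xs ! Suc i, Suc i := xs ! i]"

lemma length_swap_at [simp]: "length (swap_at i xs) = length xs"
  by (simp add: swap_at_def)

lemma nth_swap_at:
  "Suc i < length xs \<Longrightarrow> j < length xs \<Longrightarrow>
   swap_at i xs ! j = (if j = i then xs ! Suc i else if j = Suc i then xs ! i else xs ! j)"
  by (auto simp: swap_at_def nth_list_update)

lemma set_swap_at [simp]: "Suc i < length xs \<Longrightarrow> set (swap_at i xs) = set xs"
  using set_swap[of i xs "Suc i"] by (simp add: swap_at_def)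

lemma distinct_swap_at [simp]: "Suc i < length xs \<Longrightarrow> distinct (swap_at i xs) = distinct xs"
  using distinct_swap[of i xs "Suc i"] by (simp add: swap_at_def)

lemma swap_at_0 [simp]: "swap_at 0 (a # b # xs) = b # a # xs"
  by (simp add: swap_at_def)

lemma swap_at_Suc [simp]: "swap_at (Suc i) (a # xs) = a # swap_at i xs"
  by (simp add: swap_at_def)

lemma swap_at_append: "Suc i < length xs \<Longrightarrow> swap_at i (xs @ ys) = swap_at i xs @ ys"
  by (simp add: swap_at_def nth_append list_update_append)

lemma swap_at_last [simp]: "swap_at (length xs) (xs @ [a, b]) = xs @ [b, a]"
  by (simp add: swap_at_def nth_append list_update_append)

lemma swap_at_swap_at: "Suc i < length xs \<Longrightarrow> swap_at i (swap_at i xs) = xs"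
  by (intro nth_equalityI) (auto simp: nth_swap_at)

lemma swap_at_commute:
  "Suc i < j \<Longrightarrow> Suc j < length xs \<Longrightarrow> swap_at i (swap_at j xs) = swap_at j (swap_at i xs)"
  by (intro nth_equalityI) (auto simp: nth_swap_at)

lemma swap_at_braid:
  "Suc (Suc i) < length xs \<Longrightarrow>
   swap_at i (swap_at (Suc i) (swap_at i xs)) = swap_at (Suc i) (swap_at i (swap_at (Suc i) xs))"
  by (intro nth_equalityI) (auto simp: nth_swap_at)

subsection \<open>Letter systems and their operators\<close>

text \<open>
  The systems to be compared are indexed by \<open>'i\<close>. A state is a function of the system and of the word of
  active letters, oldest first; thus a linear combination of states uses the same scalars in all systems.
\<close>

type_synonym ('i, 'k) state = "'i \<Rightarrow> nat list \<Rightarrow> 'k"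

text \<open>\<open>be g c s\<close> converts the weight of \<open>c\<close> with \<open>s\<close>
  active into the weight without; it may vanish, so \<open>wt_insert\<close> is stated as a product.
  \<open>be_sum\<close> yields the quadratic relation of the Hecke operators, \<open>be_yb\<close>
  their braid relation and, with \<open>wt_insert\<close>, the relations that move \<open>Ph\<close>
  across \<open>Dm\<close> and \<open>Dp\<close>.\<close>

locale letter_systems =
  fixes q :: "'k::field"
    and Om :: "'i \<Rightarrow> nat set"
    and be :: "'i \<Rightarrow> nat \<Rightarrow> nat \<Rightarrow> 'k"
    and wt :: "'i \<Rightarrow> nat set \<Rightarrow> nat \<Rightarrow> 'k"
  assumes q_nonzero: "q \<noteq> 0"
    and finite_letters: "finite (Om g)"
    and be_sum: "x \<in> Om g \<Longrightarrow> y \<in> Om g \<Longrightarrow> x \<noteq> y \<Longrightarrow> be g x y + be g y x = 1 + q"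
    and be_yb: "x \<in> Om g \<Longrightarrow> y \<in> Om g \<Longrightarrow> z \<in> Om g \<Longrightarrow> x \<noteq> y \<Longrightarrow> y \<noteq> z \<Longrightarrow> x \<noteq> z \<Longrightarrow>
       (be g x y - q) * (be g y z - q) = (be g x z - q) * (be g x y + be g y z - 1 - q)"
    and wt_outside: "c \<notin> Om g \<Longrightarrow> wt g A c = 0"
    and wt_member: "c \<in> A \<Longrightarrow> wt g A c = 0"
    and wt_insert: "finite A \<Longrightarrow> s \<in> Om g \<Longrightarrow> c \<in> Om g \<Longrightarrow> s \<notin> A \<Longrightarrow> c \<notin> A \<Longrightarrow> c \<noteq> s \<Longrightarrow>
       be g c s * wt g (insert s A) c = wt g A c"
begin

abbreviation lin :: "'k \<Rightarrow> ('i, 'k) state \<Rightarrow> 'k \<Rightarrow> ('i, 'k) state \<Rightarrow> ('i, 'k) state" where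
  "lin a u b v \<equiv> (\<lambda>g cs. a * u g cs + b * v g cs)"

definition Dm :: "('i, 'k) state \<Rightarrow> ('i, 'k) state" where
  "Dm v g cs = (\<Sum>s\<in>Om g. v g (s # cs))"

definition Dp :: "('i, 'k) state \<Rightarrow> ('i, 'k) state" where
  "Dp v g cs = (if cs = [] then 0 else v g (butlast cs) * wt g (set (butlast cs)) (last cs))"

definition Ph :: "('i, 'k) state \<Rightarrow> ('i, 'k) state" where
  "Ph v = Dp (Dm v) - Dm (Dp v)"

text \<open>A Demazure-Lusztig type operator: on two words exchanged by the swap,
  \<open>be_sum\<close> gives the 2 by 2 matrix trace \<open>q - 1\<close> and determinant
  \<open>- q\<close>, hence eigenvalues \<open>q\<close> and \<open>- 1\<close>.\<close>

definition U :: "nat \<Rightarrow> ('i, 'k) state \<Rightarrow> ('i, 'k) state" where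
  "U i v g cs = (be g (cs ! i) (cs ! Suc i) - 1) * v g cs
     + be g (cs ! i) (cs ! Suc i) * v g (swap_at i cs)"

text \<open>Letters are distinct because the axioms on \<open>be\<close> speak only of distinct
  letters; the vanishing weights in \<open>wt_member\<close> and \<open>wt_outside\<close> keep
  \<open>Dp\<close> inside these spaces.\<close>

definition W :: "nat \<Rightarrow> ('i, 'k) state set" where
  "W k = {v. \<forall>g cs. v g cs \<noteq> 0 \<longrightarrow> length cs = k \<and> distinct cs \<and> set cs \<subseteq> Om g}"

definition vac :: "('i, 'k) state" where
  "vac g cs = (if cs = [] then 1 else 0)"

lemma W_D: "v \<in> W k \<Longrightarrow> v g cs \<noteq> 0 \<Longrightarrow> length cs = k \<and> distinct cs \<and> set cs \<subseteq> Om g"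
  by (auto simp: W_def)

lemma Dp_Nil [simp]: "Dp v g [] = 0"
  and Dp_snoc [simp]: "Dp v g (cs @ [c]) = v g cs * wt g (set cs) c"
  by (simp_all add: Dp_def)

lemma Dp_Cons_snoc [simp]: "Dp v g (s # cs @ [c]) = v g (s # cs) * wt g (insert s (set cs)) c"
  by (simp add: Dp_def)

lemma Dm_diff: "Dm (u - v) = Dm u - Dm v"
  by (intro ext) (simp add: Dm_def sum_subtractf)

lemma Dp_diff: "Dp (u - v) = Dp u - Dp v"
  by (intro ext) (simp add: Dp_def algebra_simps)

lemma U_diff: "U i (u - v) = U i u - U i v"
  by (intro ext) (simp add: U_def algebra_simps)

lemma Dm_lin: "Dm (lin a u b v) = lin a (Dm u) b (Dm v)"
  by (intro ext) (simp add: Dm_def sum.distrib sum_distrib_left)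

lemma Dp_lin: "Dp (lin a u b v) = lin a (Dp u) b (Dp v)"
  by (intro ext) (simp add: Dp_def algebra_simps)

lemma U_lin: "U i (lin a u b v) = lin a (U i u) b (U i v)"
  by (intro ext) (simp add: U_def algebra_simps)

lemma Ph_lin: "Ph (lin a u b v) = lin a (Ph u) b (Ph v)"
  by (intro ext) (simp add: Ph_def Dm_lin Dp_lin algebra_simps)

lemma W_lin: "u \<in> W k \<Longrightarrow> v \<in> W k \<Longrightarrow> lin a u b v \<in> W k"
  unfolding W_def mem_Collect_eq by (metis add.right_neutral mult_zero_right)

lemma W_diff: "u \<in> W k \<Longrightarrow> v \<in> W k \<Longrightarrow> u - v \<in> W k"
  using W_lin[of u k v 1 "-1"] by (simp add: fun_diff_def)

lemma Dm_W: "v \<in> W (Suc k) \<Longrightarrow> Dm v \<in> W k"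
proof -
  assume v: "v \<in> W (Suc k)"
  show ?thesis
    unfolding W_def
  proof (intro CollectI allI impI)
    fix g cs assume "Dm v g cs \<noteq> 0"
    then obtain s where "v g (s # cs) \<noteq> 0"
      unfolding Dm_def by (metis sum.neutral)
    from W_D[OF v this] show "length cs = k \<and> distinct cs \<and> set cs \<subseteq> Om g" by simp
  qed
qed

lemma Dp_W: "v \<in> W k \<Longrightarrow> Dp v \<in> W (Suc k)"
proof -
  assume v: "v \<in> W k"
  show ?thesis
    unfolding W_def
  proof (intro CollectI allI impI)
    fix g cs assume nz: "Dp v g cs \<noteq> 0"
    then obtain as c where cs: "cs = as @ [c]" by (cases cs rule: rev_cases) auto
    with nz have *: "v g as \<noteq> 0" "wt g (set as) c \<noteq> 0" by auto
    from W_D[OF v *(1)] *(2) show "length cs = Suc k \<and> distinct cs \<and> set cs \<subseteq> Om g"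
      using wt_outside wt_member by (auto simp: cs)
  qed
qed

lemma Ph_W: "v \<in> W k \<Longrightarrow> 1 \<le> k \<Longrightarrow> Ph v \<in> W k"
  unfolding Ph_def by (cases k) (auto intro!: W_diff Dp_W Dm_W)

lemma U_W: "v \<in> W k \<Longrightarrow> Suc i < k \<Longrightarrow> U i v \<in> W k"
proof -
  assume v: "v \<in> W k" and i: "Suc i < k"
  show ?thesis
    unfolding W_def
  proof (intro CollectI allI impI)
    fix g cs assume "U i v g cs \<noteq> 0"
    then have "v g cs \<noteq> 0 \<or> v g (swap_at i cs) \<noteq> 0"
      by (auto simp: U_def)
    then show "length cs = k \<and> distinct cs \<and> set cs \<subseteq> Om g"
      using W_D[OF v, of g cs] W_D[OF v, of g "swap_at i cs"] i
      by (metis length_swap_at set_swap_at distinct_swap_at)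
  qed
qed

lemma vac_W: "vac \<in> W 0"
  by (auto simp: W_def vac_def split: if_splits)

lemma W_eqI:
  assumes "u \<in> W k" "v \<in> W k"
    and "\<And>g cs. length cs = k \<Longrightarrow> distinct cs \<Longrightarrow> set cs \<subseteq> Om g \<Longrightarrow> u g cs = v g cs"
  shows "u = v"
proof (intro ext)
  fix g cs
  show "u g cs = v g cs"
    using W_D[OF assms(1), of g cs] W_D[OF assms(2), of g cs] assms(3)[of cs g] by metis
qed

text \<open>In \<open>Dp (Dm v)\<close> the oldest letter \<open>s\<close> is retired before
  \<open>c\<close> is weighted, in \<open>Dm (Dp v)\<close> after it; the commutator keeps the
  difference of the two weights.\<close>

lemma Ph_snoc:
  "Ph v g (cs @ [c]) =
   (\<Sum>s\<in>Om g. v g (s # cs) * (wt g (set cs) c - wt g (insert s (set cs)) c))"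
  by (simp add: Ph_def Dm_def sum_distrib_right right_diff_distrib sum_subtractf)

section \<open>Relations among \<open>Dm\<close>, \<open>Dp\<close>, \<open>Ph\<close> and the Hecke
  operators\<close>

lemma Dm_U: "Dm (U (Suc i) v) = U i (Dm v)"
  by (intro ext) (simp add: Dm_def U_def sum.distrib sum_distrib_left)

lemma Dp_U:
  assumes v: "v \<in> W k" and i: "Suc i < k"
  shows "Dp (U i v) = U i (Dp v)"
proof (rule W_eqI)
  show "Dp (U i v) \<in> W (Suc k)" "U i (Dp v) \<in> W (Suc k)"
    using v i by (auto intro: U_W Dp_W)
  fix g and cs :: "nat list" assume l: "length cs = Suc k"
  then obtain as c where cs: "cs = as @ [c]" by (cases cs rule: rev_cases) auto
  with l i show "Dp (U i v) g cs = U i (Dp v) g cs"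
    by (simp add: U_def nth_append swap_at_append algebra_simps)
qed

lemma Ph_U:
  assumes "v \<in> W k" "Suc (Suc i) < k"
  shows "U i (Ph v) = Ph (U (Suc i) v)"
proof -
  obtain k' where k: "k = Suc k'" using assms(2) by (cases k) auto
  have "U i (Dp (Dm v)) = Dp (Dm (U (Suc i) v))"
    using Dp_U[of "Dm v" k' i] Dm_W[of v k'] assms by (simp add: Dm_U k)
  moreover have "U i (Dm (Dp v)) = Dm (Dp (U (Suc i) v))"
    using Dp_U[of v k "Suc i"] assms by (simp add: Dm_U)
  ultimately show ?thesis by (simp add: Ph_def U_diff)
qed

text \<open>In terms of the weights \<open>w1\<close> and \<open>w2\<close> with the other letter
  active, appending \<open>c, d\<close> or \<open>d, c\<close> gives \<open>be g c d\<close> or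
  \<open>be g d c\<close> times the same product, and this pair is the eigenvector for
  \<open>q\<close> of the 2 by 2 block of \<open>U k\<close>.\<close>

lemma U_Dp_Dp:
  assumes v: "v \<in> W k"
  shows "U k (Dp (Dp v)) = (\<lambda>g cs. q * Dp (Dp v) g cs)"
proof (rule W_eqI)
  have "lin q (Dp (Dp v)) 0 (Dp (Dp v)) \<in> W (Suc (Suc k))"
    using v by (intro W_lin Dp_W)
  then show "(\<lambda>g cs. q * Dp (Dp v) g cs) \<in> W (Suc (Suc k))" by simp
  show "U k (Dp (Dp v)) \<in> W (Suc (Suc k))"
    using v by (auto intro: U_W Dp_W)
  fix g and cs :: "nat list" assume l: "length cs = Suc (Suc k)" and d: "distinct cs" and s: "set cs \<subseteq> Om g"
  then obtain as0 d where cs0: "cs = as0 @ [d]" by (cases cs rule: rev_cases) auto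
  then obtain as c where as: "as0 = as @ [c]" using l by (cases as0 rule: rev_cases) auto
  have cs: "cs = as @ [c, d]" and cs': "cs = (as @ [c]) @ [d]" and sw: "as @ [d, c] = (as @ [d]) @ [c]"
    by (simp_all add: cs0 as)
  have la: "length as = k" using l cs by simp
  have A: "c \<notin> set as" "d \<notin> set as" "c \<noteq> d" "c \<in> Om g" "d \<in> Om g" using d s by (auto simp: cs)
  define w1 where "w1 = wt g (insert d (set as)) c"
  define w2 where "w2 = wt g (insert c (set as)) d"
  have e1: "wt g (set as) c = be g c d * w1" and e2: "wt g (set as) d = be g d c * w2"
    using wt_insert[of "set as" d g c] wt_insert[of "set as" c g d] A by (auto simp: w1_def w2_def)
  have v1: "Dp (Dp v) g (as @ [c, d]) = v g as * (be g c d * w1) * w2"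
    using e1 by (metis (no_types, lifting) cs cs' Dp_snoc w2_def list.simps(15) rotate1.simps(2) set_rotate1)
  have v2: "Dp (Dp v) g (as @ [d, c]) = v g as * (be g d c * w2) * w1"
    using e2 by (metis (no_types, lifting) sw Dp_snoc w1_def list.simps(15) rotate1.simps(2) set_rotate1)
  have "be g c d + be g d c = 1 + q" by (rule be_sum) (use A in auto)
  then have bd: "be g d c = 1 + q - be g c d" by (simp add: algebra_simps)
  have sw': "swap_at k (as @ [c, d]) = as @ [d, c]" using la swap_at_last by metis
  have n: "(as @ [c, d]) ! k = c" "(as @ [c, d]) ! Suc k = d" using la by (auto simp: nth_append)
  show "U k (Dp (Dp v)) g cs = q * Dp (Dp v) g cs"
    unfolding U_def cs sw' n v1 v2 bd by (simp add: algebra_simps)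
qed

lemma be_sq:
  assumes "x \<in> Om g" "y \<in> Om g" "x \<noteq> y"
  shows "be g y x = 1 + q - be g x y"
  using be_sum[OF assms] by (simp add: algebra_simps)

text \<open>The letterwise form of \<open>Ph_Dm\<close>. For \<open>c\<close> other than
  \<open>r\<close> and \<open>s\<close>, all weights are multiples of the one with both active, and
  what remains is \<open>be_yb\<close> for \<open>c, r, s\<close>; for \<open>c = r\<close> or
  \<open>c = s\<close> a single instance of \<open>wt_insert\<close> remains.\<close>

lemma wt_diff_exchange:
  assumes "finite A" "r \<in> Om g" "s \<in> Om g" "r \<noteq> s" "r \<notin> A" "s \<notin> A"
  shows "wt g A c - wt g (insert s A) c =
     (be g r s - 1) * (wt g (insert s A) c - wt g (insert r (insert s A)) c)
     + be g s r * (wt g (insert r A) c - wt g (insert s (insert r A)) c)"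
proof -
  consider "c \<notin> Om g \<or> c \<in> A" | "c \<in> Om g" "c \<notin> A" "c = r" | "c \<in> Om g" "c \<notin> A" "c = s"
    | "c \<in> Om g" "c \<notin> A" "c \<noteq> r" "c \<noteq> s" by blast
  then show ?thesis
  proof cases
    case 1
    then show ?thesis by (auto simp: wt_outside wt_member)
  next
    case 2
    have "be g r s * wt g (insert s A) r = wt g A r" using wt_insert[of A s g r] assms 2 by auto
    then show ?thesis using 2 by (simp add: wt_member algebra_simps)
  next
    case 3
    have "be g s r * wt g (insert r A) s = wt g A s" using wt_insert[of A r g s] assms 3 by auto
    then show ?thesis using 3 by (simp add: wt_member algebra_simps)
  next
    case 4
    define w where "w = wt g (insert r (insert s A)) c"
    have ic: "insert s (insert r A) = insert r (insert s A)" by auto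
    have 1: "wt g (insert s A) c = be g c r * w"
      using wt_insert[of "insert s A" r g c] assms 4 by (auto simp: w_def)
    have 2: "wt g (insert r A) c = be g c s * w"
      using wt_insert[of "insert r A" s g c] assms 4 by (auto simp: w_def insert_commute)
    have 3: "wt g A c = be g c s * (be g c r * w)"
      using wt_insert[of A s g c] assms 4 1 by auto
    have yb: "(be g c r - q) * (be g r s - q) = (be g c s - q) * (be g c r + be g r s - 1 - q)"
      using be_yb[of c g r s] assms 4 by auto
    have sr: "be g s r = 1 + q - be g r s" using be_sq[of r g s] assms by auto
    have "be g c s * (be g c r * w) - be g c r * w
        - ((be g r s - 1) * (be g c r * w - w) + (1 + q - be g r s) * (be g c s * w - w))
      = w * ((be g c s - q) * (be g c r + be g r s - 1 - q) - (be g c r - q) * (be g r s - q))"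
      by (simp add: algebra_simps)
    then show ?thesis unfolding ic 3 1 2 w_def[symmetric] sr using yb by simp
  qed
qed

lemma Ph_Dm:
  assumes v: "v \<in> W k" and k: "2 \<le> k"
  shows "Ph (Dm v) = Dm (Ph (U 0 v))"
proof -
  obtain k' where k': "k = Suc (Suc k')" using k by (cases k; cases "k - 1") auto
  show ?thesis
  proof (rule W_eqI)
    show "Ph (Dm v) \<in> W (Suc k')" "Dm (Ph (U 0 v)) \<in> W (Suc k')"
      using v by (auto simp: k' intro!: Ph_W Dm_W U_W)
    fix g and cs :: "nat list" assume "length cs = Suc k'"
    then obtain as c where cs: "cs = as @ [c]" by (cases cs rule: rev_cases) auto
    let ?A = "set as"
    let ?D = "\<lambda>s A. wt g A c - wt g (insert s A) c"
    have "Dm (Ph (U 0 v)) g cs = (\<Sum>r\<in>Om g. \<Sum>s\<in>Om g. (U 0 v) g (s # r # as) * ?D s (insert r ?A))"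
      using Ph_snoc[of "U 0 v" g "_ # as"] by (simp add: cs Dm_def)
    also have "\<dots> = (\<Sum>r\<in>Om g. \<Sum>s\<in>Om g. (be g s r - 1) * v g (s # r # as) * ?D s (insert r ?A))
       + (\<Sum>r\<in>Om g. \<Sum>s\<in>Om g. be g s r * v g (r # s # as) * ?D s (insert r ?A))"
      by (simp add: U_def sum.distrib[symmetric] algebra_simps)
    \<comment> \<open>The aim is the coefficient of \<open>v g (r # s # as)\<close>. The swapped
      part already carries this word; in the other part the two bound letters are renamed.\<close>
    also have "(\<Sum>r\<in>Om g. \<Sum>s\<in>Om g. be g s r * v g (r # s # as) * ?D s (insert r ?A)) =
        (\<Sum>s\<in>Om g. \<Sum>r\<in>Om g. be g s r * v g (r # s # as) * ?D s (insert r ?A))"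
      by (rule sum.swap)
    also have "(\<Sum>r\<in>Om g. \<Sum>s\<in>Om g. (be g s r - 1) * v g (s # r # as) * ?D s (insert r ?A))
       + (\<Sum>s\<in>Om g. \<Sum>r\<in>Om g. be g s r * v g (r # s # as) * ?D s (insert r ?A))
      = (\<Sum>s\<in>Om g. \<Sum>r\<in>Om g. v g (r # s # as) * ((be g r s - 1) * ?D r (insert s ?A)
             + be g s r * ?D s (insert r ?A)))"
      by (simp add: sum.distrib[symmetric] algebra_simps)
    also have "\<dots> = (\<Sum>s\<in>Om g. \<Sum>r\<in>Om g. v g (r # s # as) * ?D s ?A)"
    proof (intro sum.cong refl)
      fix s r assume sr: "s \<in> Om g" "r \<in> Om g"
      show "v g (r # s # as) * ((be g r s - 1) * ?D r (insert s ?A) + be g s r * ?D s (insert r ?A))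
         = v g (r # s # as) * ?D s ?A"
      proof (cases "v g (r # s # as) = 0")
        case False
        from W_D[OF v this] have "distinct (r # s # as)" by simp
        then show ?thesis using wt_diff_exchange[of ?A r g s c] sr by simp
      qed simp
    qed
    also have "\<dots> = Ph (Dm v) g cs"
      by (simp add: cs Ph_snoc Dm_def sum_distrib_right)
    finally show "Ph (Dm v) g cs = Dm (Ph (U 0 v)) g cs" by simp
  qed
qed

text \<open>The letterwise form of \<open>Dp_Ph\<close>, with \<open>s\<close> the retired letter
  and \<open>c\<close>, \<open>d\<close> the appended ones. A retired letter may be used again,
  hence the cases \<open>s = c\<close> and \<open>s = d\<close>; otherwise the identity is a
  multiple of \<open>be_yb\<close> for \<open>c, d, s\<close>.\<close>

lemma wt_pair_exchange:
  assumes "finite A" "s \<in> Om g" "s \<notin> A" "c \<in> Om g" "d \<in> Om g" "c \<noteq> d" "c \<notin> A" "d \<notin> A"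
  shows "(wt g A c - wt g (insert s A) c) * wt g (insert c A) d =
     (be g c d - 1) * (wt g (insert s A) c * (wt g (insert c A) d - wt g (insert s (insert c A)) d))
     + be g c d * (wt g (insert s A) d * (wt g (insert d A) c - wt g (insert s (insert d A)) c))"
proof -
  have cd: "be g c d * wt g (insert d A) c = wt g A c" using wt_insert[of A d g c] assms by auto
  have dc: "be g d c * wt g (insert c A) d = wt g A d" using wt_insert[of A c g d] assms by auto
  have b: "be g d c = 1 + q - be g c d" using be_sq[of c g d] assms by auto
  consider "s = c" | "s = d" | "s \<noteq> c" "s \<noteq> d" by blast
  then show ?thesis
  proof cases
    case 1
    then show ?thesis using cd by (simp add: wt_member algebra_simps)
  next
    case 2
    then show ?thesis by (simp add: wt_member cd[symmetric] algebra_simps)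
  next
    case 3
    define w1 where "w1 = wt g (insert s (insert d A)) c"
    define w2 where "w2 = wt g (insert s (insert c A)) d"
    have 1: "wt g (insert d A) c = be g c s * w1"
      using wt_insert[of "insert d A" s g c] assms 3 by (auto simp: w1_def)
    have 2: "wt g (insert c A) d = be g d s * w2"
      using wt_insert[of "insert c A" s g d] assms 3 by (auto simp: w2_def)
    have 4: "wt g (insert s A) c = be g c d * w1"
      using wt_insert[of "insert s A" d g c] assms 3 by (auto simp: w1_def insert_commute)
    have 5: "wt g (insert s A) d = be g d c * w2"
      using wt_insert[of "insert s A" c g d] assms 3 by (auto simp: w2_def insert_commute)
    have yb: "(be g c d - q) * (be g d s - q) = (be g c s - q) * (be g c d + be g d s - 1 - q)"
      using be_yb[of c g d s] assms 3 by auto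
    have 6: "wt g A c = be g c d * (be g c s * w1)" using cd 1 by simp
    have "(be g c d * (be g c s * w1) - be g c d * w1) * (be g d s * w2)
       - ((be g c d - 1) * (be g c d * w1 * (be g d s * w2 - w2))
          + be g c d * ((1 + q - be g c d) * w2 * (be g c s * w1 - w1)))
      = be g c d * w1 * w2 * ((be g c s - q) * (be g c d + be g d s - 1 - q)
          - (be g c d - q) * (be g d s - q))"
      by (simp add: algebra_simps)
    then show ?thesis unfolding 6 4 5 1 2 w1_def[symmetric] w2_def[symmetric] b using yb by simp
  qed
qed

lemma Dp_Ph:
  assumes v: "v \<in> W k" and k: "1 \<le> k"
  shows "Dp (Ph v) = U (k - 1) (Ph (Dp v))"
proof -
  obtain k' where k': "k = Suc k'" using k by (cases k) auto
  show ?thesis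
  proof (rule W_eqI)
    show "Dp (Ph v) \<in> W (Suc k)" "U (k - 1) (Ph (Dp v)) \<in> W (Suc k)"
      using v by (auto simp: k' intro!: Ph_W Dp_W U_W)
    fix g and cs :: "nat list" assume l: "length cs = Suc k" and dist: "distinct cs" and sub: "set cs \<subseteq> Om g"
    then obtain as0 d where cs0: "cs = as0 @ [d]" by (cases cs rule: rev_cases) auto
    then obtain as c where as: "as0 = as @ [c]" using l k by (cases as0 rule: rev_cases) auto
    have cs: "cs = as @ [c, d]" by (simp add: cs0 as)
    have la: "length as = k'" using l cs by (simp add: k')
    let ?A = "set as"
    let ?X = "\<lambda>s. (be g c d - 1) * (wt g (insert s ?A) c * (wt g (insert c ?A) d - wt g (insert s (insert c ?A)) d))
      + be g c d * (wt g (insert s ?A) d * (wt g (insert d ?A) c - wt g (insert s (insert d ?A)) c))"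
    have A: "c \<notin> ?A" "d \<notin> ?A" "c \<noteq> d" "c \<in> Om g" "d \<in> Om g" using dist sub by (auto simp: cs)
    have X: "Ph (Dp v) g (as @ [a, b]) = (\<Sum>s\<in>Om g. v g (s # as) * (wt g (insert s ?A) a *
        (wt g (insert a ?A) b - wt g (insert s (insert a ?A)) b)))" for a b
      using Ph_snoc[of "Dp v" g "as @ [a]" b] by (simp add: algebra_simps)
    have L: "Dp (Ph v) g cs = (\<Sum>s\<in>Om g. v g (s # as) *
        ((wt g ?A c - wt g (insert s ?A) c) * wt g (insert c ?A) d))"
      using Dp_snoc[of "Ph v" g "as @ [c]" d] by (simp add: cs Ph_snoc sum_distrib_right mult.assoc)
    have sw: "swap_at k' (as @ [c, d]) = as @ [d, c]" using la swap_at_last by metis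
    have n: "(as @ [c, d]) ! k' = c" "(as @ [c, d]) ! Suc k' = d" using la by (auto simp: nth_append)
    have "U (k - 1) (Ph (Dp v)) g cs = (\<Sum>s\<in>Om g. v g (s # as) *
       ?X s)"
      by (simp add: U_def cs k' sw n X sum_distrib_left sum.distrib[symmetric] algebra_simps)
    also have "\<dots> = Dp (Ph v) g cs"
      unfolding L
    proof (intro sum.cong refl)
      fix s assume s: "s \<in> Om g"
      show "v g (s # as) *
       ?X s
     = v g (s # as) * ((wt g ?A c - wt g (insert s ?A) c) * wt g (insert c ?A) d)"
      proof (cases "v g (s # as) = 0")
        case False
        from W_D[OF v this] have "s \<notin> ?A" by simp
        then show ?thesis using wt_pair_exchange[of ?A s g c d] s A by simp
      qed simp
    qed
    finally show "Dp (Ph v) g cs = U (k - 1) (Ph (Dp v)) g cs" by simp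
  qed
qed

text \<open>Expanding \<open>Ph\<close> as a commutator reduces this to moving \<open>Ph\<close>
  across \<open>Dm\<close> and \<open>Dp\<close> by \<open>Ph_Dm\<close> and
  \<open>Dp_Ph\<close>.\<close>

lemma Ph_Ph:
  assumes v: "v \<in> W k" and k: "2 \<le> k"
  shows "Ph (Ph (U 0 v)) = U (k - 2) (Ph (Ph v))"
proof -
  obtain k' where k': "k = Suc (Suc k')" using k by (cases k; cases "k - 1") auto
  have Uv: "U 0 v \<in> W k" using v by (auto simp: k' intro: U_W)
  have dv: "Dm v \<in> W (Suc k')" using v by (auto simp: k' intro: Dm_W)
  have 1: "Dp (Dm (Ph (U 0 v))) = Dp (Ph (Dm v))" using Ph_Dm[OF v k] by simp
  have "Dm (Dp (Ph (U 0 v))) = Dm (U (Suc k') (Ph (Dp (U 0 v))))"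
    using Dp_Ph[OF Uv] by (simp add: k')
  also have "\<dots> = U k' (Dm (Ph (U 0 (Dp v))))"
    using Dp_U[OF v, of 0] by (simp add: Dm_U k')
  also have "\<dots> = U k' (Ph (Dm (Dp v)))"
    using Ph_Dm[OF Dp_W[OF v]] by (simp add: k')
  finally have 2: "Dm (Dp (Ph (U 0 v))) = U k' (Ph (Dm (Dp v)))" .
  have 3: "Dp (Ph (Dm v)) = U k' (Ph (Dp (Dm v)))" using Dp_Ph[OF dv] by simp
  have Phd: "Ph (a - b) = Ph a - Ph b" for a b
    by (simp add: Ph_def Dm_diff Dp_diff algebra_simps)
  have "Ph (Ph (U 0 v)) = U k' (Ph (Dp (Dm v))) - U k' (Ph (Dm (Dp v)))"
    using 1 2 3 by (simp add: Ph_def[of "Ph (U 0 v)"])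
  also have "\<dots> = U k' (Ph (Ph v))" by (simp add: Ph_def[of v] Phd U_diff)
  finally show ?thesis by (simp add: k')
qed

lemma U_U:
  assumes v: "v \<in> W k" and i: "Suc i < k"
  shows "U i (U i v) = lin q v (q - 1) (U i v)"
proof (rule W_eqI)
  show "U i (U i v) \<in> W k" "lin q v (q - 1) (U i v) \<in> W k" using v i by (auto intro!: U_W W_lin)
  fix g and cs :: "nat list" assume l: "length cs = k" and d: "distinct cs" and s: "set cs \<subseteq> Om g"
  have ne: "cs ! i \<noteq> cs ! Suc i" using d l i by (simp add: nth_eq_iff_index_eq)
  have m: "cs ! i \<in> Om g" "cs ! Suc i \<in> Om g" using l i s by (auto intro!: subsetD[OF s] nth_mem)
  have b: "be g (cs ! Suc i) (cs ! i) = 1 + q - be g (cs ! i) (cs ! Suc i)" using be_sq[OF m ne] .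
  have sw: "swap_at i cs ! i = cs ! Suc i" "swap_at i cs ! Suc i = cs ! i" "swap_at i (swap_at i cs) = cs"
    using l i by (auto simp: nth_swap_at swap_at_swap_at)
  show "U i (U i v) g cs = q * v g cs + (q - 1) * U i v g cs"
    unfolding U_def sw b by (simp add: algebra_simps)
qed

lemma U_commute:
  assumes v: "v \<in> W k" and ij: "Suc i < j" "Suc j < k"
  shows "U i (U j v) = U j (U i v)"
proof (rule W_eqI)
  show "U i (U j v) \<in> W k" "U j (U i v) \<in> W k" using v ij by (auto intro!: U_W)
  fix g and cs :: "nat list" assume l: "length cs = k"
  have sw: "swap_at i cs ! j = cs ! j" "swap_at i cs ! Suc j = cs ! Suc j"
     "swap_at j cs ! i = cs ! i" "swap_at j cs ! Suc i = cs ! Suc i"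
    using l ij by (auto simp: nth_swap_at)
  have sw2: "swap_at i (swap_at j cs) = swap_at j (swap_at i cs)"
    by (rule swap_at_commute) (use l ij in auto)
  show "U i (U j v) g cs = U j (U i v) g cs"
    unfolding U_def sw sw2 by (simp add: algebra_simps)
qed

lemma U_braid:
  assumes v: "v \<in> W k" and i: "Suc (Suc i) < k"
  shows "U i (U (Suc i) (U i v)) = U (Suc i) (U i (U (Suc i) v))"
proof (rule W_eqI)
  show "U i (U (Suc i) (U i v)) \<in> W k" "U (Suc i) (U i (U (Suc i) v)) \<in> W k"
    using v i by (auto intro!: U_W)
  fix g and cs :: "nat list" assume l: "length cs = k" and d: "distinct cs" and s: "set cs \<subseteq> Om g"
  let ?j = "Suc i" and ?l = "Suc (Suc i)"
  define x y z where "x = cs ! i" and "y = cs ! ?j" and "z = cs ! ?l"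
  have ne: "x \<noteq> y" "y \<noteq> z" "x \<noteq> z" using d l i by (auto simp: x_def y_def z_def nth_eq_iff_index_eq)
  have m: "x \<in> Om g" "y \<in> Om g" "z \<in> Om g"
    using l i by (auto simp: x_def y_def z_def intro!: subsetD[OF s] nth_mem)
  have yb: "(be g x y - q) * (be g y z - q) = (be g x z - q) * (be g x y + be g y z - 1 - q)"
    using be_yb[OF m ne] .
  have b: "be g y x = 1 + q - be g x y" "be g z y = 1 + q - be g y z" "be g z x = 1 + q - be g x z"
    using be_sq[OF m(1,2) ne(1)] be_sq[OF m(2,3) ne(2)] be_sq[OF m(1,3) ne(3)] by simp_all
  define c1 c2 c12 c21 c121 where "c1 = swap_at i cs" and "c2 = swap_at ?j cs"
    and "c12 = swap_at ?j c1" and "c21 = swap_at i c2" and "c121 = swap_at i c12"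
  have n0: "cs ! i = x" "cs ! ?j = y" "cs ! ?l = z" by (simp_all add: x_def y_def z_def)
  have n1: "c1 ! i = y" "c1 ! ?j = x" "c1 ! ?l = z"
    and n2: "c2 ! i = x" "c2 ! ?j = z" "c2 ! ?l = y"
    using l i by (simp_all add: c1_def c2_def nth_swap_at n0)
  have n12: "c12 ! i = y" "c12 ! ?j = z" "c12 ! ?l = x"
    and n21: "c21 ! i = z" "c21 ! ?j = x" "c21 ! ?l = y"
    using l i by (simp_all add: c12_def c21_def c1_def c2_def nth_swap_at n0)
  have s1: "swap_at i cs = c1" "swap_at ?j cs = c2" "swap_at ?j c1 = c12" "swap_at i c2 = c21"
    "swap_at i c12 = c121" by (simp_all add: c1_def c2_def c12_def c21_def c121_def)
  have s2: "swap_at ?j c21 = c121" "swap_at i c1 = cs" "swap_at ?j c2 = cs"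
    using swap_at_braid[of i cs] swap_at_swap_at[of i cs] swap_at_swap_at[of ?j cs] l i
    by (simp_all add: c1_def c2_def c12_def c21_def c121_def)
  \<comment> \<open>The difference of the two braid words contains the defect of
    \<open>be_yb\<close> as a factor.\<close>
  have "U i (U (Suc i) (U i v)) g cs - U (Suc i) (U i (U (Suc i) v)) g cs
     = ((be g x z - q) * (be g x y + be g y z - 1 - q) - (be g x y - q) * (be g y z - q))
        * (be g y z * v g c2 - be g x y * v g c1 - (be g x y - be g y z) * v g cs)"
    unfolding U_def n0 s1 s2 n1 n2 n12 n21 b by (simp add: algebra_simps)
  then show "U i (U (Suc i) (U i v)) g cs = U (Suc i) (U i (U (Suc i) v)) g cs"
    using yb by simp
qed

subsection \<open>Reduction of words to loops\<close>

primrec ch :: "nat \<Rightarrow> ('i, 'k) state \<Rightarrow> ('i, 'k) state" where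
  "ch 0 v = v"
| "ch (Suc j) v = ch j (U j v)"

primrec ch1 :: "nat \<Rightarrow> ('i, 'k) state \<Rightarrow> ('i, 'k) state" where
  "ch1 0 v = v"
| "ch1 (Suc j) v = ch1 j (U (Suc j) v)"

text \<open>In affine Hecke terms, the translation made from the rotation \<open>Ph\<close> and the
  full chain \<open>U 0\<close>, ..., \<open>U (k - 2)\<close>.\<close>

definition Y :: "nat \<Rightarrow> ('i, 'k) state \<Rightarrow> ('i, 'k) state" where
  "Y k v = ch (k - 1) (Ph v)"

lemma ch_W: "v \<in> W k \<Longrightarrow> j < k \<Longrightarrow> ch j v \<in> W k"
  by (induction j arbitrary: v) (auto intro: U_W)

lemma Y_W: "v \<in> W k \<Longrightarrow> 1 \<le> k \<Longrightarrow> Y k v \<in> W k"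
  unfolding Y_def by (intro ch_W Ph_W) auto

lemma ch_lin: "ch j (lin a u b v) = lin a (ch j u) b (ch j v)"
  by (induction j arbitrary: u v) (auto simp: U_lin)

lemma Y_lin: "Y k (lin a u b v) = lin a (Y k u) b (Y k v)"
  by (simp add: Y_def ch_lin Ph_lin)

lemma ch_U_large: "v \<in> W k \<Longrightarrow> j < i \<Longrightarrow> Suc i < k \<Longrightarrow> ch j (U i v) = U i (ch j v)"
proof (induction j arbitrary: v)
  case (Suc j)
  then have "U j (U i v) = U i (U j v)" using U_commute[of v k j i] by simp
  then show ?case using Suc U_W[of v k j] by simp
qed simp

lemma ch_U_small: "v \<in> W k \<Longrightarrow> Suc i < j \<Longrightarrow> j < k \<Longrightarrow> ch j (U i v) = U (Suc i) (ch j v)"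
proof (induction j arbitrary: v)
  case (Suc j)
  show ?case
  proof (cases "Suc i = j")
    case True
    have "ch (Suc j) (U i v) = ch i (U (Suc i) (U i (U (Suc i) v)))"
      using U_braid[of v k i] Suc.prems by (simp flip: True)
    also have "\<dots> = U (Suc i) (ch i (U i (U (Suc i) v)))"
      using Suc.prems True by (intro ch_U_large[where k = k] U_W) auto
    finally show ?thesis by (simp flip: True)
  next
    case False
    then have "U i (U j v) = U j (U i v)"
      using U_commute[of v k i j] Suc.prems by simp
    then show ?thesis using Suc.IH[of "U j v"] Suc.prems False U_W[of v k j] by simp
  qed
qed simp

lemma ch_Ph: "v \<in> W k \<Longrightarrow> Suc j < k \<Longrightarrow> ch j (Ph v) = Ph (ch1 j v)"
proof (induction j arbitrary: v)
  case (Suc j)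
  then show ?case using Ph_U[of v k j] U_W[of v k "Suc j"] by simp
qed simp

lemma Dp_ch: "v \<in> W k \<Longrightarrow> j < k \<Longrightarrow> Dp (ch j v) = ch j (Dp v)"
proof (induction j arbitrary: v)
  case (Suc j)
  then show ?case using Dp_U[of v k j] U_W[of v k j] by simp
qed simp

text \<open>The \<open>U (k - 1)\<close> created by \<open>Dp_Ph\<close> is exactly the factor by
  which the chain of \<open>Y (Suc k)\<close> is longer than that of \<open>Y k\<close>.\<close>

lemma Dp_Y:
  assumes "v \<in> W k" "1 \<le> k"
  shows "Dp (Y k v) = Y (Suc k) (Dp v)"
proof -
  have "Dp (Y k v) = ch (k - 1) (Dp (Ph v))"
    unfolding Y_def using assms by (intro Dp_ch[where k = k] Ph_W) auto
  also have "\<dots> = ch (Suc (k - 1)) (Ph (Dp v))"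
    using Dp_Ph[OF assms] by simp
  finally show ?thesis using assms(2) by (simp add: Y_def)
qed

text \<open>Pulling \<open>U i\<close> out of \<open>Ph\<close> lowers its index by one, and
  crossing the chain \<open>ch (k - 1)\<close> raises it again.\<close>

lemma Y_U:
  assumes "v \<in> W k" "1 \<le> i" "Suc i < k"
  shows "Y k (U i v) = U i (Y k v)"
proof -
  obtain i' where i: "i = Suc i'" using assms(2) by (cases i) auto
  have "Y k (U i v) = ch (k - 1) (U i' (Ph v))"
    using Ph_U[of v k i'] assms by (simp add: Y_def i)
  also have "\<dots> = U i (ch (k - 1) (Ph v))"
    unfolding i using assms by (intro ch_U_small[where k = k] Ph_W) (auto simp: i)
  finally show ?thesis by (simp add: Y_def)
qed

text \<open>\<open>Ph_Ph\<close> trades the innermost factor \<open>U (k - 2)\<close> of the chain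
  for a \<open>U 0\<close> behind both factors \<open>Ph\<close>; the shorter chain then passes into
  the outer \<open>Ph\<close>, so that no Hecke operator is left outside.\<close>

lemma Y_Ph:
  assumes "v \<in> W k" "2 \<le> k"
  shows "Y k (Ph v) = Ph (ch1 (k - 2) (Ph (U 0 v)))"
proof -
  have k: "k - 1 = Suc (k - 2)" using assms(2) by simp
  have "Y k (Ph v) = ch (k - 2) (Ph (Ph (U 0 v)))"
    using Ph_Ph[OF assms] by (simp only: Y_def k ch.simps)
  also have "\<dots> = Ph (ch1 (k - 2) (Ph (U 0 v)))"
    using assms by (intro ch_Ph[where k = k] Ph_W U_W) auto
  finally show ?thesis .
qed

text \<open>Polynomials in the loops, applied to \<open>vac\<close>. The scalars in
  \<open>PP_lin\<close> are shared by all systems, so that equality of the loops propagates.\<close>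

inductive PP :: "('i, 'k) state \<Rightarrow> bool" where
  PP_vac: "PP vac"
| PP_loop: "PP p \<Longrightarrow> PP (Dm ((Ph ^^ b) (Dp p)))"
| PP_lin: "PP u \<Longrightarrow> PP v \<Longrightarrow> PP (lin a u b v)"

lemma Ph_pow_W: "v \<in> W k \<Longrightarrow> 1 \<le> k \<Longrightarrow> (Ph ^^ b) v \<in> W k"
  by (induction b) (auto intro: Ph_W)

lemma PP_W: "PP p \<Longrightarrow> p \<in> W 0"
  by (induction rule: PP.induct) (auto intro!: vac_W Dm_W Ph_pow_W Dp_W W_lin)

lemma Dp_pow_W: "p \<in> W 0 \<Longrightarrow> (Dp ^^ k) p \<in> W k"
  by (induction k) (auto intro: Dp_W)

lemma U_Dp_pow:
  "p \<in> W 0 \<Longrightarrow> Suc i < k \<Longrightarrow> U i ((Dp ^^ k) p) = lin q ((Dp ^^ k) p) 0 ((Dp ^^ k) p)"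
proof (induction k)
  case (Suc k)
  show ?case
  proof (cases "Suc i = k")
    case True
    have "U i (Dp (Dp ((Dp ^^ i) p))) = (\<lambda>g cs. q * Dp (Dp ((Dp ^^ i) p)) g cs)"
      by (rule U_Dp_Dp[OF Dp_pow_W[OF Suc.prems(1)]])
    then show ?thesis by (simp flip: True)
  next
    case False
    then show ?thesis
      using Suc Dp_U[of "(Dp ^^ k) p" k i] Dp_pow_W[of p k] Dp_lin[of q "(Dp ^^ k) p" 0 "(Dp ^^ k) p"]
      by simp
  qed
qed simp

lemma ch_Dp_pow:
  "p \<in> W 0 \<Longrightarrow> j < k \<Longrightarrow> ch j ((Dp ^^ k) p) = lin (q ^ j) ((Dp ^^ k) p) 0 ((Dp ^^ k) p)"
proof (induction j)
  case (Suc j)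
  have "ch (Suc j) ((Dp ^^ k) p) = lin q (ch j ((Dp ^^ k) p)) 0 (ch j ((Dp ^^ k) p))"
    using U_Dp_pow[of p j k] Suc.prems ch_lin[of j q "(Dp ^^ k) p" 0 "(Dp ^^ k) p"] by simp
  then show ?case using Suc by (simp add: algebra_simps)
qed simp

text \<open>\<open>d\<close> bounds the number of factors \<open>Ph\<close>; the induction showing closure under \<open>Dm\<close> runs over it.\<close>

inductive Z :: "nat \<Rightarrow> nat \<Rightarrow> ('i, 'k) state \<Rightarrow> bool" for k where
  Z_base: "PP p \<Longrightarrow> Z k d ((Dp ^^ k) p)"
| Z_Ph: "Z k d v \<Longrightarrow> 1 \<le> k \<Longrightarrow> Z k (Suc d) (Ph v)"
| Z_U: "Z k d v \<Longrightarrow> Suc i < k \<Longrightarrow> Z k d (U i v)"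
| Z_lin: "Z k d u \<Longrightarrow> Z k d v \<Longrightarrow> Z k d (lin a u b v)"
| Z_Suc: "Z k d v \<Longrightarrow> Z k (Suc d) v"

lemma Z_W: "Z k d v \<Longrightarrow> v \<in> W k"
  by (induction rule: Z.induct) (auto intro!: Dp_pow_W PP_W Ph_W U_W W_lin)

lemma Z_mono: "Z k d v \<Longrightarrow> d \<le> d' \<Longrightarrow> Z k d' v"
  by (rotate_tac, induction rule: dec_induct) (auto intro: Z_Suc)

text \<open>\<open>Dp\<close> passes \<open>Ph\<close> by producing a Hecke operator, so the bound
  on the factors \<open>Ph\<close> stays the same.\<close>

lemma Z_Dp: "Z k d v \<Longrightarrow> Z (Suc k) d (Dp v)"
proof (induction rule: Z.induct)
  case (Z_base p d)
  then show ?case using Z.Z_base[of p "Suc k" d] by simp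
next
  case (Z_Ph d v)
  have "Z (Suc k) (Suc d) (U (k - 1) (Ph (Dp v)))"
    using Z_Ph by (intro Z.Z_U Z.Z_Ph) auto
  then show ?case using Dp_Ph[of v k] Z_W[of k d v] Z_Ph by simp
next
  case (Z_U d v i)
  then show ?case using Dp_U[of v k i] Z_W[of k d v] by (auto intro!: Z.Z_U)
next
  case (Z_lin d u v a b)
  then show ?case by (auto simp: Dp_lin intro!: Z.Z_lin)
next
  case (Z_Suc d v)
  then show ?case by (auto intro!: Z.Z_Suc)
qed

lemma Z_ch1: "Z k d v \<Longrightarrow> Suc j < k \<Longrightarrow> Z k d (ch1 j v)"
  by (induction j arbitrary: v) (auto intro: Z_U)

text \<open>
  Normal forms on which \<open>Dm\<close> can be evaluated: it commutes with \<open>U i\<close> for \<open>i \<ge> 1\<close> up to a shift, moves past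
  \<open>Ph\<close>, and meets a \<open>Dp\<close> in the first case because \<open>Y\<close> commutes with \<open>Dp\<close>.
\<close>

inductive N :: "nat \<Rightarrow> nat \<Rightarrow> ('i, 'k) state \<Rightarrow> bool" for k d where
  N_base: "PP p \<Longrightarrow> b \<le> d \<Longrightarrow> N k d ((Y k ^^ b) ((Dp ^^ k) p))"
| N_Ph: "Z k d' v \<Longrightarrow> d' < d \<Longrightarrow> N k d (Ph v)"
| N_U: "N k d v \<Longrightarrow> 1 \<le> i \<Longrightarrow> Suc i < k \<Longrightarrow> N k d (U i v)"
| N_lin: "N k d u \<Longrightarrow> N k d v \<Longrightarrow> N k d (lin a u b v)"

lemma Y_pow_W: "v \<in> W k \<Longrightarrow> 1 \<le> k \<Longrightarrow> (Y k ^^ b) v \<in> W k"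
  by (induction b) (auto intro: Y_W)

lemma N_W: "N k d v \<Longrightarrow> 1 \<le> k \<Longrightarrow> v \<in> W k"
  by (induction rule: N.induct) (auto intro!: Y_pow_W Dp_pow_W PP_W Ph_W U_W W_lin dest: Z_W)

lemma N_mono: "N k d v \<Longrightarrow> d \<le> d' \<Longrightarrow> N k d' v"
  by (induction rule: N.induct) (auto intro: N.intros)

text \<open>\<open>Y k\<close> raises the power at the base, or slips into an outer
  \<open>Ph\<close> by \<open>Y_Ph\<close>, or commutes with \<open>U i\<close>; each time it costs
  one factor \<open>Ph\<close>.\<close>

lemma N_Y: "N k d v \<Longrightarrow> 2 \<le> k \<Longrightarrow> N k (Suc d) (Y k v)"
proof (induction rule: N.induct)
  case (N_base p b)
  then show ?case using N.N_base[of p "Suc b" "Suc d" k] by simp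
next
  case (N_Ph d' v)
  have "Z k (Suc d') (ch1 (k - 2) (Ph (U 0 v)))"
    using N_Ph by (intro Z_ch1 Z_Ph Z_U) auto
  then show ?case using N_Ph Y_Ph[OF Z_W[OF N_Ph(1)]] by (auto intro: N.N_Ph)
next
  case (N_U v i)
  then show ?case using Y_U[OF N_W[OF N_U(1)]] by (auto intro: N.N_U)
next
  case (N_lin u v a b)
  then show ?case by (auto simp: Y_lin intro: N.N_lin)
qed

text \<open>
  Every word in the \<open>U i\<close> is a combination of products of an element generated by \<open>U 1, U 2, \<dots>\<close> and one of
  the coset representatives \<open>ch j = U 0 \<circ> \<dots> \<circ> U (j - 1)\<close>.
\<close>

inductive C :: "nat \<Rightarrow> ('i, 'k) state \<Rightarrow> ('i, 'k) state \<Rightarrow> bool" for k u where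
  C_base: "j < k \<Longrightarrow> C k u (ch j u)"
| C_U: "C k u v \<Longrightarrow> 1 \<le> i \<Longrightarrow> Suc i < k \<Longrightarrow> C k u (U i v)"
| C_lin: "C k u v \<Longrightarrow> C k u w \<Longrightarrow> C k u (lin a v b w)"

text \<open>An extra \<open>U i\<close> on the inner side of \<open>ch j\<close> comes out as
  \<open>U (Suc i)\<close> if \<open>Suc i < j\<close>, is resolved by the quadratic relation if
  \<open>Suc i = j\<close>, lengthens the chain if \<open>i = j\<close>, and commutes with it if
  \<open>j < i\<close>.\<close>

lemma C_absorb:
  assumes "C k (U i u) v" "u \<in> W k" "Suc i < k"
  shows "C k u v"
  using assms(1)
proof (induction rule: C.induct)
  case (C_base j)
  consider "Suc i < j" | "Suc i = j" | "i = j" | "j < i" by linarith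
  then show ?case
  proof cases
    case 1
    then show ?thesis
      using ch_U_small[OF assms(2) 1] C_base by (auto intro!: C.C_U C.C_base)
  next
    case 2
    have "ch j (U i u) = lin q (ch i u) (q - 1) (ch (Suc i) u)"
      by (simp add: U_U[OF assms(2,3)] ch_lin flip: 2)
    then show ?thesis using assms(3) by (simp only:) (intro C.C_lin C.C_base; simp)
  next
    case 3
    then show ?thesis using C.C_base[of "Suc i" k u] assms by simp
  next
    case 4
    then show ?thesis
      using ch_U_large[OF assms(2) 4 assms(3)] C_base assms(3) by (auto intro!: C.C_U C.C_base)
  qed
qed (auto intro: C.intros)

lemma C_word:
  "u \<in> W k \<Longrightarrow> 1 \<le> k \<Longrightarrow> \<forall>i\<in>set js. Suc i < k \<Longrightarrow> C k u (foldr U js u)"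
proof (induction js arbitrary: u rule: rev_induct)
  case Nil
  then show ?case using C.C_base[of 0 k u] by simp
next
  case (snoc i js)
  then have "C k (U i u) (foldr U js (U i u))"
    by (auto intro: U_W)
  then show ?case using C_absorb snoc.prems by auto
qed

text \<open>Intermediate form: the Hecke operators outside the outermost \<open>Ph\<close> are
  gathered in one word, to which the coset decomposition \<open>C_word\<close> applies.\<close>

inductive E :: "nat \<Rightarrow> nat \<Rightarrow> ('i, 'k) state \<Rightarrow> bool" for k d where
  E_base: "PP p \<Longrightarrow> \<forall>i\<in>set js. Suc i < k \<Longrightarrow> E k d (foldr U js ((Dp ^^ k) p))"
| E_Ph: "Z k d' v \<Longrightarrow> d' < d \<Longrightarrow> \<forall>i\<in>set js. Suc i < k \<Longrightarrow> E k d (foldr U js (Ph v))"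
| E_lin: "E k d u \<Longrightarrow> E k d v \<Longrightarrow> E k d (lin a u b v)"

lemma E_U: "E k d v \<Longrightarrow> Suc i < k \<Longrightarrow> E k d (U i v)"
proof (induction rule: E.induct)
  case (E_base p js)
  then show ?case using E.E_base[of p "i # js" k d] by simp
next
  case (E_Ph d' v js)
  then show ?case using E.E_Ph[of k d' v d "i # js"] by simp
next
  case (E_lin u v a b)
  then show ?case by (simp add: U_lin E.E_lin)
qed

lemma E_mono: "E k d v \<Longrightarrow> d \<le> d' \<Longrightarrow> E k d' v"
  by (induction rule: E.induct) (auto intro: E.intros)

lemma Z_E: "Z k d v \<Longrightarrow> E k d v"
proof (induction rule: Z.induct)
  case (Z_base p d)
  then show ?case using E.E_base[of p "[]" k d] by simp
next
  case (Z_Ph d v)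
  then show ?case using E.E_Ph[of k d v "Suc d" "[]"] by simp
next
  case (Z_Suc d v)
  show ?case by (rule E_mono[OF Z_Suc.IH]) simp
qed (auto intro: E_U E.E_lin)

lemma C_N: "C k u v \<Longrightarrow> (\<And>j. j < k \<Longrightarrow> N k d (ch j u)) \<Longrightarrow> N k d v"
  by (induction rule: C.induct) (auto intro: N.intros)

text \<open>By \<open>C_word\<close> only chains \<open>ch j\<close> matter outside. On
  \<open>Dp ^^ k\<close> they are scalars; short ones pass into \<open>Ph\<close>; the full one
  turns \<open>Ph v\<close> into \<open>Y k v\<close>, where \<open>v\<close> has fewer factors
  \<open>Ph\<close> and is normal by induction.\<close>

lemma Z_N:
  assumes k: "2 \<le> k"
  shows "Z k d v \<Longrightarrow> N k d v"
proof (induction d arbitrary: v rule: less_induct)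
  case (less d)
  have k1: "1 \<le> k" using k by simp
  from Z_E[OF less.prems] show ?case
  proof (induction rule: E.induct)
    case (E_base p js)
    have pW: "p \<in> W 0" by (rule PP_W[OF E_base(1)])
    have "N k d (ch j ((Dp ^^ k) p))" if "j < k" for j
      unfolding ch_Dp_pow[OF pW that] using N.N_base[of p 0 d k] E_base(1) by (intro N.N_lin) auto
    then show ?case by (rule C_N[OF C_word[OF Dp_pow_W[OF pW] k1 E_base(2)]])
  next
    case (E_Ph d' v js)
    have vW: "v \<in> W k" by (rule Z_W[OF E_Ph(1)])
    have "N k d (ch j (Ph v))" if j: "j < k" for j
    proof (cases "Suc j < k")
      case True
      then show ?thesis using ch_Ph[OF vW True] E_Ph Z_ch1[OF E_Ph(1) True] by (auto intro: N.N_Ph)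
    next
      case False
      with j have "j = k - 1" by linarith
      then have "ch j (Ph v) = Y k v" by (simp add: Y_def)
      moreover have "N k (Suc d') (Y k v)" using less.IH[OF E_Ph(2,1)] k by (rule N_Y)
      ultimately show ?thesis using N_mono[of k "Suc d'" _ d] E_Ph(2) by auto
    qed
    then show ?case by (rule C_N[OF C_word[OF Ph_W[OF vW k1] k1 E_Ph(3)]])
  next
    case (E_lin u v a b)
    then show ?case by (auto intro: N.N_lin)
  qed
qed

section \<open>Closure under \<open>Dm\<close> and comparison of the values on the empty
  word\<close>

definition ZZ :: "nat \<Rightarrow> ('i, 'k) state \<Rightarrow> bool" where
  "ZZ k v \<longleftrightarrow> (\<exists>d. Z k d v)"

lemma ZZ_lin: "ZZ k u \<Longrightarrow> ZZ k v \<Longrightarrow> ZZ k (lin a u b v)"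
  unfolding ZZ_def
proof (elim exE)
  fix d d' assume "Z k d u" "Z k d' v"
  then have "Z k (max d d') (lin a u b v)"
    by (intro Z_lin) (auto intro: Z_mono)
  then show "\<exists>d. Z k d (lin a u b v)" ..
qed

lemma ZZ_U: "ZZ k v \<Longrightarrow> Suc i < k \<Longrightarrow> ZZ k (U i v)"
  unfolding ZZ_def by (auto intro: Z_U)

lemma ZZ_Ph: "ZZ k v \<Longrightarrow> 1 \<le> k \<Longrightarrow> ZZ k (Ph v)"
  unfolding ZZ_def by (meson Z_Ph)

lemma ZZ_Dp: "ZZ k v \<Longrightarrow> ZZ (Suc k) (Dp v)"
  unfolding ZZ_def by (auto intro: Z_Dp)

lemma ZZ_ch: "ZZ k v \<Longrightarrow> j < k \<Longrightarrow> ZZ k (ch j v)"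
  by (induction j arbitrary: v) (auto intro: ZZ_U)

lemma ZZ_Y: "ZZ k v \<Longrightarrow> 1 \<le> k \<Longrightarrow> ZZ k (Y k v)"
  unfolding Y_def by (intro ZZ_ch ZZ_Ph) auto

lemma Z_0: "Z 0 d v \<Longrightarrow> PP v"
  by (induction rule: Z.induct) (auto intro: PP.intros)

lemma Ph_pow_lin: "(Ph ^^ n) (lin a u b v) = lin a ((Ph ^^ n) u) b ((Ph ^^ n) v)"
  by (induction n) (auto simp: Ph_lin)

text \<open>With one active letter there are no Hecke operators, so only combinations of
  \<open>(Ph ^^ b) (Dp p)\<close> occur. The exponent \<open>n\<close> collects the factors
  \<open>Ph\<close> already stripped off.\<close>

lemma Z_1: "Z (Suc 0) d v \<Longrightarrow> PP (Dm ((Ph ^^ n) v))"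
proof (induction arbitrary: n rule: Z.induct)
  case (Z_base p d)
  then show ?case by (simp add: PP_loop)
next
  case (Z_Ph d v)
  then show ?case using Z_Ph.IH[of "Suc n"] by (simp add: funpow_swap1)
next
  case (Z_lin d u v a b)
  then show ?case by (simp add: Ph_pow_lin Dm_lin PP_lin)
qed auto

lemma Dp_Y_pow:
  "v \<in> W k \<Longrightarrow> 1 \<le> k \<Longrightarrow> Dp ((Y k ^^ b) v) = (Y (Suc k) ^^ b) (Dp v)"
  by (induction b) (auto simp: Dp_Y Y_pow_W)

text \<open>The outer induction on \<open>k\<close> serves \<open>Dm (Dp x)\<close>, where
  \<open>Dm x\<close> has one active letter less; the inner one on \<open>d\<close> serves
  \<open>Dm (Ph v)\<close>, where a factor \<open>Ph\<close> moves out.\<close>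

lemma ZZ_Dm: "ZZ (Suc k) v \<Longrightarrow> ZZ k (Dm v)"
proof (induction k arbitrary: v)
  case 0
  then obtain d where "Z (Suc 0) d v" by (auto simp: ZZ_def)
  from Z_1[OF this, of 0] show ?case using Z_base[of "Dm v" 0] by (auto simp: ZZ_def)
next
  case (Suc k)
  let ?K = "Suc (Suc k)"
  have N: "N ?K d x \<Longrightarrow> ZZ (Suc k) (Dm x)" for d x
  proof (induction d arbitrary: x rule: less_induct)
    case (less d)
    from less.prems show ?case
    proof (induction rule: N.induct)
      case (N_base p b)
      define x where "x = (Y (Suc k) ^^ b) ((Dp ^^ Suc k) p)"
      have "ZZ (Suc k) ((Dp ^^ Suc k) p)"
        unfolding ZZ_def using Z_base[OF N_base(1), of "Suc k"] by blast
      then have x: "ZZ (Suc k) x"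
        unfolding x_def by (induction b) (auto intro: ZZ_Y)
      have "(Y ?K ^^ b) ((Dp ^^ ?K) p) = Dp x"
        using Dp_Y_pow[of "(Dp ^^ Suc k) p" "Suc k" b] Dp_pow_W[OF PP_W[OF N_base(1)], of "Suc k"]
        by (simp add: x_def)
      moreover have "Dm (Dp x) = lin 1 (Dp (Dm x)) (- 1) (Ph x)"
        by (intro ext) (simp add: Ph_def)
      moreover have "ZZ (Suc k) (lin 1 (Dp (Dm x)) (- 1) (Ph x))"
        using x Suc.IH[OF x] by (intro ZZ_lin ZZ_Dp ZZ_Ph) auto
      ultimately show ?case by (simp only:)
    next
      case (N_Ph d' v)
      have vW: "v \<in> W ?K" by (rule Z_W[OF N_Ph(1)])
      \<comment> \<open>The inverse of \<open>U 0\<close> applied to \<open>v\<close>, read off from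
        \<open>U_U\<close>; here \<open>q\<close> must be nonzero.\<close>
      define w where "w = lin (1 / q) (U 0 v) ((1 - q) / q) v"
      have w: "Z ?K d' w" unfolding w_def using N_Ph(1) by (intro Z_lin Z_U) auto
      have "U 0 w = v"
        unfolding w_def U_lin U_U[OF vW, of 0, simplified]
        using q_nonzero by (intro ext) (simp add: field_simps)
      then have "Dm (Ph v) = Ph (Dm w)" using Ph_Dm[OF Z_W[OF w]] by simp
      moreover have "ZZ (Suc k) (Dm w)" using less.IH[OF N_Ph(2)] Z_N[OF _ w] by simp
      ultimately show ?case by (simp add: ZZ_Ph)
    next
      case (N_U v i)
      then show ?case using Dm_U[of "i - 1" v] ZZ_U[of "Suc k" "Dm v" "i - 1"] by simp
    next
      case (N_lin u v a b)
      then show ?case by (simp add: Dm_lin ZZ_lin)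
    qed
  qed
  from Suc.prems obtain d where "Z ?K d v" by (auto simp: ZZ_def)
  from N[OF Z_N[OF _ this]] show ?case by simp
qed

inductive reach :: "nat \<Rightarrow> ('i, 'k) state \<Rightarrow> bool" where
  reach_vac: "reach 0 vac"
| reach_Dp: "reach k v \<Longrightarrow> reach (Suc k) (Dp v)"
| reach_Dm: "reach (Suc k) v \<Longrightarrow> reach k (Dm v)"

lemma reach_ZZ: "reach k v \<Longrightarrow> ZZ k v"
proof (induction rule: reach.induct)
  case reach_vac
  then show ?case unfolding ZZ_def using Z_base[OF PP_vac, of 0] by auto
qed (auto intro: ZZ_Dp ZZ_Dm)

lemma reach_0: "reach 0 v \<Longrightarrow> PP v"
  using reach_ZZ Z_0 by (auto simp: ZZ_def)

lemma Dm_scale: "Dm (\<lambda>g cs. a g * v g cs) = (\<lambda>g cs. a g * Dm v g cs)"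
  by (intro ext) (simp add: Dm_def sum_distrib_left)

lemma Dp_scale: "Dp (\<lambda>g cs. a g * v g cs) = (\<lambda>g cs. a g * Dp v g cs)"
  by (intro ext) (simp add: Dp_def)

lemma Ph_scale: "Ph (\<lambda>g cs. a g * v g cs) = (\<lambda>g cs. a g * Ph v g cs)"
  by (intro ext) (simp add: Ph_def Dm_scale Dp_scale algebra_simps)

lemma Ph_pow_scale: "(Ph ^^ n) (\<lambda>g cs. a g * v g cs) = (\<lambda>g cs. a g * (Ph ^^ n) v g cs)"
  by (induction n) (auto simp: Ph_scale)

lemma W_0_scale: "p \<in> W 0 \<Longrightarrow> p = (\<lambda>g cs. p g [] * vac g cs)"
  by (intro ext) (auto simp: vac_def W_def)

text \<open>A state in \<open>W 0\<close> is a multiple of \<open>vac\<close>, by a scalar that may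
  depend on the system. A further loop multiplies this scalar by the value of the loop on
  \<open>vac\<close>.\<close>

theorem reach_agree:
  assumes loops: "\<And>b. Dm ((Ph ^^ b) (Dp vac)) g [] = Dm ((Ph ^^ b) (Dp vac)) h []"
    and "reach 0 v"
  shows "v g [] = v h []"
  using reach_0[OF assms(2)]
proof (induction rule: PP.induct)
  case PP_vac
  then show ?case by (simp add: vac_def)
next
  case (PP_loop p b)
  define a where "a g = p g []" for g
  have p: "p = (\<lambda>g cs. a g * vac g cs)"
    unfolding a_def by (rule W_0_scale[OF PP_W[OF PP_loop(1)]])
  have "a g = a h" using PP_loop.IH by (simp add: a_def)
  then show ?case unfolding p Dp_scale Ph_pow_scale Dm_scale using loops[of b] by simp
next
  case (PP_lin u v a b)
  then show ?case by simp
qed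

end

section \<open>Weighted sums over words as products of \<open>Dp\<close> and
  \<open>Dm\<close>\<close>

definition words :: "'a set \<Rightarrow> nat \<Rightarrow> 'a list set" where
  "words A n = {xs. length xs = n \<and> set xs \<subseteq> A}"

lemma words_0 [simp]: "words A 0 = {[]}"
  by (auto simp: words_def)

lemma finite_words [intro]: "finite A \<Longrightarrow> finite (words A n)"
  using finite_lists_length_eq[of A n] by (simp add: words_def conj_commute)

lemma sum_words_Suc:
  assumes "finite A"
  shows "(\<Sum>xs\<in>words A (Suc n). f xs) = (\<Sum>xs\<in>words A n. \<Sum>a\<in>A. f (xs @ [a]))"
proof -
  have "words A (Suc n) = (\<lambda>(xs, a). xs @ [a]) ` (words A n \<times> A)"
    unfolding words_def
    by (auto simp: image_iff length_Suc_conv_rev)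
  moreover have "inj_on (\<lambda>(xs, a). xs @ [a]) (words A n \<times> A)"
    by (auto simp: inj_on_def)
  ultimately show ?thesis
    by (simp add: sum.reindex sum.cartesian_product case_prod_beta' comp_def)
qed

lemma sum_if_const:
  "(\<Sum>a\<in>A. if P then f a else 0) = (if P then \<Sum>a\<in>A. f a else (0 :: 'b::comm_monoid_add))"
  by simp

context letter_systems
begin

definition word_wt :: "'i \<Rightarrow> (nat \<Rightarrow> nat) \<Rightarrow> nat list \<Rightarrow> 'k" where
  "word_wt g e cs = (\<Prod>i<length cs. wt g (set (drop (e (Suc i)) (take i cs))) (cs ! i))"

lemma word_wt_snoc:
  "word_wt g e (cs @ [c]) = word_wt g e cs * wt g (set (drop (e (Suc (length cs))) cs)) c"
  by (simp add: word_wt_def nth_append)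

text \<open>
  The state after \<open>i\<close> letters of which the first \<open>r\<close> have been deactivated.
\<close>

definition st :: "(nat \<Rightarrow> nat) \<Rightarrow> nat \<Rightarrow> nat \<Rightarrow> ('i, 'k) state" where
  "st e i r g cs =
     (if length cs + r = i \<and> set cs \<subseteq> Om g then \<Sum>us\<in>words (Om g) r. word_wt g e (us @ cs) else 0)"

lemma st_0: "st e 0 0 = vac"
  by (intro ext) (simp add: st_def vac_def word_wt_def)

lemma st_Dm: "st e i (Suc r) = Dm (st e i r)"
proof (intro ext)
  fix g cs
  have "Dm (st e i r) g cs = (\<Sum>s\<in>Om g. if length cs + Suc r = i \<and> set cs \<subseteq> Om g
      then \<Sum>us\<in>words (Om g) r. word_wt g e (us @ s # cs) else 0)"
    unfolding Dm_def st_def by (intro sum.cong refl) auto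
  also have "\<dots> = (if length cs + Suc r = i \<and> set cs \<subseteq> Om g
      then \<Sum>s\<in>Om g. \<Sum>us\<in>words (Om g) r. word_wt g e (us @ s # cs) else 0)"
    by (rule sum_if_const)
  also have "\<dots> = st e i (Suc r) g cs"
    using sum.swap[of "\<lambda>s us. word_wt g e (us @ s # cs)" "words (Om g) r" "Om g"]
    by (simp add: st_def sum_words_Suc finite_letters)
  finally show "st e i (Suc r) g cs = Dm (st e i r) g cs" by simp
qed

lemma st_Dp: "st e (Suc i) (e (Suc i)) = Dp (st e i (e (Suc i)))" if "e (Suc i) \<le> i"
proof (intro ext)
  fix g cs
  show "st e (Suc i) (e (Suc i)) g cs = Dp (st e i (e (Suc i))) g cs"
  proof (cases cs rule: rev_cases)
    case Nil
    then show ?thesis using that by (simp add: st_def)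
  next
    case (snoc as c)
    show ?thesis
    proof (cases "length as + e (Suc i) = i \<and> set as \<subseteq> Om g \<and> c \<in> Om g")
      case True
      have "word_wt g e (us @ as @ [c]) = word_wt g e (us @ as) * wt g (set as) c"
        if "us \<in> words (Om g) (e (Suc i))" for us
        using word_wt_snoc[of g e "us @ as" c] that True by (simp add: words_def add.commute)
      then show ?thesis
        using True by (simp add: snoc st_def sum_distrib_right)
    next
      case False
      then show ?thesis by (auto simp: snoc st_def wt_outside)
    qed
  qed
qed

lemma reach_st_Dm:
  assumes "reach (i - r) (st e i r)" "r \<le> r'" "r' \<le> i"
  shows "reach (i - r') (st e i r')"
  using assms(2,1,3)
proof (induction rule: dec_induct)
  case (step m)
  then have "reach (Suc (i - Suc m)) (st e i m)" by (simp add: Suc_diff_Suc)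
  then show ?case unfolding st_Dm by (rule reach_Dm)
qed simp

text \<open>\<open>ESeq\<close> does not constrain \<open>e 0\<close>; the conditional supplies the
  value 0 for the empty word.\<close>

lemma reach_st:
  assumes e: "e \<in> ESeq n"
  shows "i \<le> n \<Longrightarrow> reach (i - (if i = 0 then 0 else e i)) (st e i (if i = 0 then 0 else e i))"
proof (induction i)
  case 0
  then show ?case by (simp add: st_0 reach_vac)
next
  case (Suc i)
  have "e (Suc i) < Suc i" using e Suc.prems by (auto simp: ESeq_def)
  moreover have "(if i = 0 then 0 else e i) \<le> e (Suc i)"
    using e Suc.prems by (auto simp: ESeq_def)
  ultimately have le: "(if i = 0 then 0 else e i) \<le> e (Suc i)" "e (Suc i) \<le> i" by simp_all
  have "reach (i - e (Suc i)) (st e i (e (Suc i)))"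
    using reach_st_Dm[OF Suc.IH le] Suc.prems by simp
  then show ?case using le reach_Dp st_Dp[of e i, OF le(2)] by (simp add: Suc_diff_le)
qed

text \<open>After the last letter all letters still active are retired as well, which turns the
  state into the full sum over words.\<close>

theorem words_agree:
  assumes e: "e \<in> ESeq n"
    and loops: "\<And>b. Dm ((Ph ^^ b) (Dp vac)) g [] = Dm ((Ph ^^ b) (Dp vac)) h []"
  shows "(\<Sum>cs\<in>words (Om g) n. word_wt g e cs) = (\<Sum>cs\<in>words (Om h) n. word_wt h e cs)"
proof -
  have "(if n = 0 then 0 else e n) \<le> n"
    using e by (auto simp: ESeq_def intro!: less_imp_le)
  then have "reach 0 (st e n n)"
    using reach_st_Dm[OF reach_st[OF e order.refl], of n] by simp
  from reach_agree[OF loops this] show ?thesis by (simp add: st_def)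
qed

end

subsection \<open>The column system and the color system\<close>

text \<open>The reciprocal of the factor that an active column \<open>y\<close> contributes to
  \<open>cphi\<close> at column \<open>x\<close>.\<close>

definition col_be :: "'k::field \<Rightarrow> nat \<Rightarrow> nat \<Rightarrow> 'k" where
  "col_be q x y = (q ^ x - q ^ Suc y) / (q ^ x - q ^ y)"

text \<open>The residue from the introduction; for \<open>c > 1\<close> the pole comes from the factor \<open>a = c - 1\<close>.\<close>

definition cphi :: "'k::field \<Rightarrow> nat set \<Rightarrow> nat \<Rightarrow> 'k" where
  "cphi q A c =
     (if c \<in> A then 0
      else if c = 1 then \<Prod>a\<in>A. (q ^ c - q ^ a) / (q ^ c - q ^ Suc a)
      else if 1 < c \<and> c - 1 \<in> A
      then (q ^ c - q ^ (c - 1)) / (q ^ c - q) * (\<Prod>a\<in>A - {c - 1}. (q ^ c - q ^ a) / (q ^ c - q ^ Suc a))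
      else 0)"

definition esym :: "(nat \<Rightarrow> 'k::field) \<Rightarrow> nat \<Rightarrow> nat \<Rightarrow> 'k" where
  "esym t m c = (\<Sum>S | S \<subseteq> {1..m} \<and> card S = c. \<Prod>i\<in>S. t i)"

text \<open>Normalized so that the product along a row of length \<open>c\<close> telescopes to a multiple of \<open>esym t m c\<close>.\<close>

definition row_wt :: "'k::field \<Rightarrow> (nat \<Rightarrow> 'k) \<Rightarrow> nat \<Rightarrow> nat \<Rightarrow> 'k" where
  "row_wt q t m c = qint q c * esym t m c / (q ^ (c - 1) * esym t m (c - 1))"

text \<open>\<open>True\<close> indexes the system of columns and \<open>False\<close> that of colors.\<close>

definition sys_be :: "'k::field \<Rightarrow> bool \<Rightarrow> nat \<Rightarrow> nat \<Rightarrow> 'k" where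
  "sys_be q g x y = (if g then col_be q x y else if x < y then 1 else q)"

text \<open>Each active color below \<open>c\<close> costs \<open>1 / q\<close>, so a coloring
  collects \<open>1 / q\<close> for every edge that is not an ascent; the factor \<open>q\<close> to
  the number of edges later turns this into \<open>q\<close> to the number of ascents.\<close>

definition sys_wt :: "'k::field \<Rightarrow> (nat \<Rightarrow> 'k) \<Rightarrow> nat \<Rightarrow> bool \<Rightarrow> nat set \<Rightarrow> nat \<Rightarrow> 'k" where
  "sys_wt q t m g A c =
     (if c \<in> {1..m} \<and> c \<notin> A
      then if g then cphi q A c * row_wt q t m c else t c * (1 / q) ^ card {a\<in>A. a < c}
      else 0)"

lemma esym_0 [simp]: "esym t m 0 = 1"
proof -
  have "{S. S \<subseteq> {1..m} \<and> card S = 0} = {{}}"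
    using finite_subset by fastforce
  then show ?thesis by (simp add: esym_def)
qed

lemma sum_pow_rank:
  assumes "finite (I :: nat set)"
  shows "(\<Sum>k\<in>I. x ^ card {i\<in>I. i < k}) = (\<Sum>j<card I. (x :: 'k::field) ^ j)"
  using assms
proof (induction rule: finite_linorder_max_induct)
  case (insert b A)
  have "b \<notin> A" using insert by auto
  have "(\<Sum>k\<in>A. x ^ card {i \<in> insert b A. i < k}) = (\<Sum>k\<in>A. x ^ card {i \<in> A. i < k})"
    using insert.hyps(2) by (intro sum.cong arg_cong[where f = "\<lambda>n. x ^ n"] arg_cong[where f = card]) auto
  moreover have "{i \<in> insert b A. i < b} = A" using insert.hyps(2) by auto
  ultimately show ?case using insert \<open>b \<notin> A\<close> by (simp add: add.commute)
qed simp

text \<open>\<open>esym_nz\<close> keeps the denominators of \<open>row_wt\<close> and of the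
  intertwiner away from zero, \<open>q_pow\<close> those of \<open>col_be\<close>,
  \<open>cphi\<close> and the \<open>q\<close>-integers.\<close>

locale generic_systems =
  fixes q :: "'k::field" and t :: "nat \<Rightarrow> 'k" and m :: nat
  assumes q0: "q \<noteq> 0"
    and q_pow: "0 < i \<Longrightarrow> q ^ i \<noteq> 1"
    and esym_nz: "c \<le> m \<Longrightarrow> esym t m c \<noteq> 0"
begin

lemma q_pow_neq: "i < j \<Longrightarrow> q ^ i \<noteq> q ^ j"
proof
  assume "i < j" and eq: "q ^ i = q ^ j"
  then have "q ^ j = q ^ i * q ^ (j - i)" 
    by (metis le_add_diff_inverse less_imp_le power_add)
  with eq q0 have "q ^ (j - i) = 1" by simp
  with q_pow[of "j - i"] \<open>i < j\<close> show False by simp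
qed

lemma q_pow_eq_iff [simp]: "q ^ i = q ^ j \<longleftrightarrow> i = j"
  using q_pow_neq by (metis linorder_neqE_nat)

lemma q1: "q \<noteq> 1"
  using q_pow[of 1] by simp

lemma qint_nz: "0 < c \<Longrightarrow> qint q c \<noteq> 0"
  using q_pow[of c] q1 by (simp add: qint_def)

lemma col_be_minus: "x \<noteq> y \<Longrightarrow> col_be q x y - q = (1 - q) * (q ^ x / (q ^ x - q ^ y))"
  by (simp add: col_be_def field_simps)

text \<open>By \<open>col_be_minus\<close> this is the partial fraction identity \<open>main\<close>
  in \<open>X\<close>, \<open>Y\<close>, \<open>Z\<close>, multiplied by
  \<open>(1 - q) * (1 - q)\<close>.\<close>

lemma col_be_yb:
  assumes "x \<noteq> y" "y \<noteq> z" "x \<noteq> z"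
  shows "(col_be q x y - q) * (col_be q y z - q) = (col_be q x z - q) * (col_be q x y + col_be q y z - 1 - q)"
proof -
  define X Y Z where "X = q ^ x" and "Y = q ^ y" and "Z = q ^ z"
  have ne: "X - Y \<noteq> 0" "Y - Z \<noteq> 0" "X - Z \<noteq> 0" using assms by (simp_all add: X_def Y_def Z_def)
  have main: "X / (X - Y) * (Y / (Y - Z)) = X / (X - Z) * (X / (X - Y) + Y / (Y - Z) - 1)"
  proof -
    have "X / (X - Y) + Y / (Y - Z) - 1 = Y * (X - Z) / ((X - Y) * (Y - Z))"
      using ne by (simp add: divide_simps) (simp add: algebra_simps)
    then show ?thesis using ne by simp
  qed
  have "col_be q x y + col_be q y z - 1 - q = (col_be q x y - q) + (col_be q y z - q) - (1 - q)" by simp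
  also have "\<dots> = (1 - q) * (X / (X - Y) + Y / (Y - Z) - 1)"
    using col_be_minus[OF assms(1)] col_be_minus[OF assms(2)] by (simp add: X_def Y_def Z_def algebra_simps)
  finally have fin: "col_be q x y + col_be q y z - 1 - q = (1 - q) * (X / (X - Y) + Y / (Y - Z) - 1)" .
  have "col_be q x y - q = (1 - q) * (X / (X - Y))" "col_be q y z - q = (1 - q) * (Y / (Y - Z))"
    "col_be q x z - q = (1 - q) * (X / (X - Z))"
    using col_be_minus assms by (simp_all add: X_def Y_def Z_def)
  then show ?thesis
    unfolding fin using arg_cong[OF main, of "\<lambda>u. (1 - q) * (1 - q) * u"] by (simp only: mult_ac)
qed

lemma cphi_insert:
  assumes "finite A" "s \<noteq> 0" "s \<notin> A" "c \<notin> A" "c \<noteq> s"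
  shows "col_be q c s * cphi q (insert s A) c = cphi q A c"
proof -
  consider "c = 1" | "1 < c" "c - 1 \<in> A" | "1 < c" "c - 1 \<notin> A" | "c = 0" by linarith
  then show ?thesis
  proof cases
    case 1
    have "q - q * q ^ s \<noteq> 0" "q - q ^ s \<noteq> 0"
      using q_pow_eq_iff[of 1 "Suc s"] q_pow_eq_iff[of 1 s] assms 1 by auto
    then show ?thesis using assms 1 by (simp add: cphi_def col_be_def)
  next
    case 2
    have "insert s A - {c - 1} = insert s (A - {c - 1})" using 2 assms by auto
    moreover have "q ^ c - q ^ Suc s \<noteq> 0" "q ^ c - q ^ s \<noteq> 0"
      using 2 assms unfolding right_minus_eq q_pow_eq_iff by auto
    ultimately show ?thesis using assms 2 by (simp add: cphi_def col_be_def)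
  next
    case 3
    \<comment> \<open>Activating \<open>s = c - 1\<close> makes column \<open>c\<close> addable, but
      \<open>col_be q c (c - 1) = 0\<close>, in accordance with the zero weight without
      \<open>s\<close>.\<close>
    then show ?thesis using assms by (cases "s = c - 1") (auto simp: cphi_def col_be_def)
  next
    case 4
    then show ?thesis using assms by (auto simp: cphi_def)
  qed
qed

sublocale letter_systems q "\<lambda>_ :: bool. {1..m}" "sys_be q" "sys_wt q t m"
proof
  show "q \<noteq> 0" by (rule q0)
  fix g :: bool and A :: "nat set" and x y z c s :: nat
  show "finite {1..m}" by simp
  show "sys_be q g x y + sys_be q g y x = 1 + q" if "x \<noteq> y"
  proof (cases g)
    case True
    have "q ^ x - q ^ y \<noteq> 0" "q ^ y - q ^ x \<noteq> 0" using that by simp_all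
    then have "col_be q x y + col_be q y x = 1 + q"
      by (simp add: col_be_def divide_simps) (simp add: algebra_simps)
    then show ?thesis using True by (simp add: sys_be_def)
  next
    case False
    then show ?thesis using that by (auto simp: sys_be_def)
  qed
  show "(sys_be q g x y - q) * (sys_be q g y z - q) =
        (sys_be q g x z - q) * (sys_be q g x y + sys_be q g y z - 1 - q)"
    if "x \<noteq> y" "y \<noteq> z" "x \<noteq> z"
    using col_be_yb[OF that] that by (auto simp: sys_be_def algebra_simps)
  show "sys_wt q t m g A c = 0" if "c \<notin> {1..m}"
    using that by (auto simp: sys_wt_def)
  show "sys_wt q t m g A c = 0" if "c \<in> A"
    using that by (simp add: sys_wt_def)
  show "sys_be q g c s * sys_wt q t m g (insert s A) c = sys_wt q t m g A c"
    if *: "finite A" "s \<in> {1..m}" "c \<in> {1..m}" "s \<notin> A" "c \<notin> A" "c \<noteq> s"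
  proof (cases g)
    case True
    then show ?thesis
      using * cphi_insert[of A s c] by (auto simp: sys_be_def sys_wt_def)
  next
    case False
    have "{a \<in> insert s A. a < c} = (if s < c then insert s {a \<in> A. a < c} else {a \<in> A. a < c})"
      by auto
    then show ?thesis using False * q0 by (auto simp: sys_be_def sys_wt_def)
  qed
qed

section \<open>The intertwiner of the one-letter states\<close>

abbreviation "ksub c \<equiv> {I. I \<subseteq> {1..m} \<and> card I = c}"

abbreviation "kin c k \<equiv> {I. I \<subseteq> {1..m} \<and> card I = c \<and> k \<in> I}"

abbreviation "kout c k \<equiv> {I. I \<subseteq> {1..m} \<and> card I = c \<and> k \<notin> I}"

abbreviation "rk I k \<equiv> (1 / q) ^ card {i\<in>I. i < k}"

text \<open>Each subset gives its members weights in geometric progression; this is why sums over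
  all \<open>k\<close> produce \<open>q\<close>-integers and sums over \<open>s < k\<close>
  telescope.\<close>

definition bsum :: "nat \<Rightarrow> nat \<Rightarrow> 'k" where
  "bsum c k = (\<Sum>I\<in>kin c k. prod t I * rk I k)"

lemma sum_bsum:
  assumes "K \<subseteq> {1..m}"
  shows "(\<Sum>k\<in>K. bsum c k) = (\<Sum>I\<in>ksub c. prod t I *
     (\<Sum>k\<in>I \<inter> K. rk I k))"
proof -
  have fin: "finite (ksub c)" "finite K"
    using assms finite_subset by auto
  have "(\<Sum>k\<in>K. bsum c k) = (\<Sum>k\<in>K. \<Sum>I | I \<subseteq> {1..m} \<and> card I = c.
      if k \<in> I then prod t I * rk I k else 0)"
    unfolding bsum_def by (rule sum.cong[OF refl], rule sum.mono_neutral_cong_left) (use fin in auto)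
  also have "\<dots> = (\<Sum>I\<in>ksub c. \<Sum>k\<in>K.
      if k \<in> I then prod t I * rk I k else 0)"
    by (rule sum.swap)
  also have "\<dots> = (\<Sum>I\<in>ksub c. prod t I *
     (\<Sum>k\<in>I \<inter> K. rk I k))"
  proof (rule sum.cong[OF refl])
    fix I
    show "(\<Sum>k\<in>K. if k \<in> I then prod t I * rk I k else 0) =
      prod t I * (\<Sum>k\<in>I \<inter> K. rk I k)"
      unfolding sum_distrib_left Int_commute[of I K] by (subst sum.inter_restrict[OF fin(2)]) (rule refl)
  qed
  finally show ?thesis .
qed

lemma sum_bsum_all: "(\<Sum>k=1..m. bsum c k) = esym t m c * (\<Sum>j<c. (1 / q) ^ j)"
  unfolding sum_bsum[OF order.refl] esym_def sum_distrib_right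
proof (intro sum.cong refl)
  fix I assume I: "I \<in> ksub c"
  then have "finite I" using finite_subset by auto
  from sum_pow_rank[OF this, of "1 / q"] I show "prod t I * (\<Sum>k\<in>I \<inter> {1..m}. rk I k) =
       prod t I * (\<Sum>j<c. (1 / q) ^ j)"
    by (simp add: Int_absorb2)
qed

text \<open>Within each subset the members below \<open>k\<close> form a geometric series, which the
  factor \<open>1 - 1 / q\<close> telescopes.\<close>

lemma bsum_below:
  assumes "k \<in> {1..m}"
  shows "(1 - 1 / q) * (\<Sum>s=1..<k. bsum c s) =
    esym t m c - (\<Sum>I\<in>ksub c. prod t I * rk I k)"
proof -
  have below: "(\<Sum>s=1..<k. bsum c s) = (\<Sum>I\<in>ksub c. prod t I *
     (\<Sum>s\<in>I \<inter> {1..<k}. rk I s))"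
    using assms by (intro sum_bsum) auto
  show ?thesis
    unfolding below esym_def sum_subtractf[symmetric]
    unfolding sum_distrib_left[of "1 - 1 / q"]
  proof (intro sum.cong refl)
    fix I assume I: "I \<in> ksub c"
    then have fin: "finite (I \<inter> {1..<k})" and J: "{i\<in>I. i < k} = I \<inter> {1..<k}"
      using finite_subset by auto
    have "(\<Sum>s\<in>I \<inter> {1..<k}. rk I s)
        = (\<Sum>s\<in>I \<inter> {1..<k}. (1 / q) ^ card {i\<in>I \<inter> {1..<k}. i < s})"
      using I by (intro sum.cong arg_cong[where f = "\<lambda>n. (1 / q) ^ n"] arg_cong[where f = card]) auto
    also have "\<dots> = (\<Sum>j<card (I \<inter> {1..<k}). (1 / q) ^ j)"
      by (rule sum_pow_rank[OF fin])
    finally have "(1 - 1 / q) * (\<Sum>s\<in>I \<inter> {1..<k}. rk I s) = 1 - rk I k"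
      using one_diff_power_eq[of "1 / q" "card (I \<inter> {1..<k})"] by (simp add: J)
    then show "(1 - 1 / q) * (prod t I * (\<Sum>s\<in>I \<inter> {1..<k}. rk I s)) =
        prod t I - prod t I * rk I k"
      by (simp add: right_diff_distrib mult.left_commute)
  qed
qed

lemma bsum_Suc:
  assumes k: "k \<in> {1..m}"
  shows "bsum (Suc c) k = t k * (\<Sum>I\<in>kout c k. prod t I * rk I k)"
proof -
  have im: "kin (Suc c) k = insert k ` kout c k"
  proof (intro equalityI subsetI)
    fix I assume I: "I \<in> kin (Suc c) k"
    then have "finite I" using finite_subset by auto
    then have "I = insert k (I - {k})" "card (I - {k}) = c" using I by auto
    then show "I \<in> insert k ` kout c k" using I by blast
  next
    fix I assume "I \<in> insert k ` kout c k"
    then obtain J where J: "I = insert k J" "J \<subseteq> {1..m}" "card J = c" "k \<notin> J" by auto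
    then have "finite J" using finite_subset by auto
    then show "I \<in> kin (Suc c) k" using J k by auto
  qed
  have inj: "inj_on (insert k) (kout c k)"
    by (auto simp: inj_on_def)
  show ?thesis
    unfolding bsum_def im sum.reindex[OF inj] comp_def sum_distrib_left
  proof (intro sum.cong refl)
    fix I assume I: "I \<in> kout c k"
    then have "finite I" using finite_subset by auto
    moreover have "{i \<in> insert k I. i < k} = {i \<in> I. i < k}" by auto
    ultimately show "prod t (insert k I) * (1 / q) ^ card {i \<in> insert k I. i < k} =
         t k * (prod t I * rk I k)" using I by (simp add: mult.assoc)
  qed
qed

text \<open>The first term has the form in which \<open>Ph\<close> acts on colors
  (\<open>clr_step\<close>). The second one arises because the subsets without \<open>k\<close>
  become those of size \<open>Suc c\<close> with \<open>k\<close> by adding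
  \<open>k\<close>.\<close>

lemma bsum_recursion:
  assumes k: "k \<in> {1..m}"
  shows "t k * (bsum c k + (1 - 1 / q) * (\<Sum>s=1..<k. bsum c s)) + bsum (Suc c) k = esym t m c * t k"
proof -
  let ?f = "\<lambda>I. prod t I * rk I k"
  have "ksub c = kin c k \<union> kout c k"
    by auto
  then have "(\<Sum>I\<in>ksub c. ?f I) = bsum c k + (\<Sum>I\<in>kout c k. ?f I)"
    unfolding bsum_def by (simp only:) (rule sum.union_disjoint, auto)
  then show ?thesis
    unfolding bsum_below[OF k] bsum_Suc[OF k] by (simp add: algebra_simps)
qed

text \<open>The reciprocal of the sum of \<open>c\<close> consecutive powers of
  \<open>1 / q\<close>. It makes the rows of the intertwiner sum to 1, and it is also the weight
  \<open>cphi q {c} (Suc c)\<close>.\<close>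

definition rfac :: "nat \<Rightarrow> 'k" where
  "rfac c = q ^ (c - 1) / qint q c"

text \<open>The intertwiner between the one-letter states of the two systems.\<close>

definition B :: "nat \<Rightarrow> nat \<Rightarrow> 'k" where
  "B c k = rfac c / esym t m c * bsum c k"

lemma bsum_1: "k \<in> {1..m} \<Longrightarrow> bsum 1 k = t k"
proof -
  assume k: "k \<in> {1..m}"
  then have 1: "{I. I \<subseteq> {1..m} \<and> card I = 1 \<and> k \<in> I} = {{k}}"
    by (auto simp: card_1_singleton_iff)
  have 2: "card {i. i = k \<and> i < k} = 0" by (auto simp: card_eq_0_iff)
  show ?thesis unfolding bsum_def 1 by (simp add: 2)
qed

lemma bsum_top: "bsum (Suc m) k = 0"
proof -
  have "card I \<noteq> Suc m" if "I \<subseteq> {1..m}" for I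
    using card_mono[OF _ that] by simp
  then have *: "{I. I \<subseteq> {1..m} \<and> card I = Suc m \<and> k \<in> I} = {}"
    by blast
  show ?thesis unfolding bsum_def * by simp
qed

lemma row_wt_B:
  assumes "k \<in> {1..m}" "s < m"
  shows "row_wt q t m (Suc s) * B (Suc s) k = bsum (Suc s) k / esym t m s"
  using assms esym_nz[of "Suc s"] esym_nz[of s] qint_nz[of "Suc s"] q0
  by (simp add: row_wt_def B_def rfac_def)

lemma sum_B: "c \<in> {1..m} \<Longrightarrow> (\<Sum>k=1..m. B c k) = 1"
proof -
  assume c: "c \<in> {1..m}"
  have "q ^ (c - 1) * (\<Sum>j<c. (1 / q) ^ j) = qint q c"
  proof -
    have "(\<Sum>j<c. (1 / q) ^ j) = (1 - (1 / q) ^ c) / (1 - 1 / q)"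
      using one_diff_power_eq[of "1 / q" c] q1 q0 by (simp add: field_simps)
    moreover obtain d where "c = Suc d" using c by (cases c) auto
    ultimately show ?thesis
      using q0 q1 by (simp add: qint_def divide_simps) (simp add: algebra_simps)
  qed
  then have "rfac c * (\<Sum>j<c. (1 / q) ^ j) = 1"
    using qint_nz[of c] c by (simp add: rfac_def)
  then show ?thesis
    using esym_nz[of c] c unfolding B_def sum_distrib_left[symmetric] sum_bsum_all by simp
qed

lemma sys_wt_col_empty: "sys_wt q t m True {} c = (if c = 1 \<and> 1 \<le> m then row_wt q t m 1 else 0)"
  by (auto simp: sys_wt_def cphi_def)

lemma sys_wt_clr_empty: "c \<in> {1..m} \<Longrightarrow> sys_wt q t m False {} c = t c"
  by (auto simp: sys_wt_def)

abbreviation "dwt g s c \<equiv> sys_wt q t m g {} c - sys_wt q t m g {s} c"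

text \<open>With \<open>s\<close> alone active, only columns 1 and \<open>Suc s\<close> can have
  nonzero \<open>cphi\<close>, and these two values sum to 1. So, up to row weights, what column 1
  loses is what column \<open>Suc s\<close> gains, namely \<open>rfac s\<close>.\<close>

lemma col_step:
  assumes s: "s \<in> {1..m}" and c: "c \<in> {1..m}"
  shows "dwt True s c =
    rfac s * ((if c = 1 then row_wt q t m 1 else 0) - (if c = Suc s then row_wt q t m (Suc s) else 0))"
proof -
  have m: "1 \<le> m" using s by simp
  obtain d where d: "s = Suc d" using s by (cases s) auto
  have ne: "q - q * q ^ s \<noteq> 0" using q_pow_eq_iff[of 1 "Suc s"] s by auto
  have ne1: "1 - q ^ s \<noteq> 0" using q_pow[of s] s by auto
  have r: "rfac s = q ^ d * (1 - q) / (1 - q ^ s)"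
    using q1 by (simp add: rfac_def qint_def d)
  consider "c = 1" "s = 1" | "c = 1" "s \<noteq> 1" | "c = Suc s" | "c \<noteq> 1" "c \<noteq> Suc s" by blast
  then show ?thesis
  proof cases
    case 1
    then show ?thesis using r d q1 m by (simp add: sys_wt_def cphi_def)
  next
    case 2
    have "cphi q {s} 1 = (q - q ^ s) / (q - q * q ^ s)" using 2 by (simp add: cphi_def)
    moreover have "1 - (q - q ^ s) / (q - q * q ^ s) = rfac s"
    proof -
      have "q - q * q ^ s = q * (1 - q ^ s)" by (simp add: algebra_simps)
      then show ?thesis using ne ne1 q0 unfolding r
        by (simp add: divide_simps d) (simp add: algebra_simps)
    qed
    ultimately have "row_wt q t m 1 - cphi q {s} 1 * row_wt q t m 1 = rfac s * row_wt q t m 1"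
      by (metis mult.commute mult.right_neutral right_diff_distrib)
    then show ?thesis using 2 m s by (simp add: sys_wt_col_empty) (simp add: sys_wt_def)
  next
    case 3
    have "cphi q {s} (Suc s) = (q ^ Suc s - q ^ s) / (q ^ Suc s - q)" using s by (simp add: cphi_def)
    also have "\<dots> = rfac s"
    proof -
      have "q ^ Suc s - q = - (q * (1 - q ^ s))" "q ^ Suc s - q ^ s = - (q * (q ^ d * (1 - q)))"
        by (simp_all add: algebra_simps d)
      then show ?thesis using q0 ne1 unfolding r by simp
    qed
    finally show ?thesis using 3 s c by (simp add: sys_wt_col_empty) (simp add: sys_wt_def)
  next
    case 4
    then have "cphi q {s} c = 0" using c by (auto simp: cphi_def)
    then show ?thesis using 4 by (simp add: sys_wt_col_empty) (simp add: sys_wt_def)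
  qed
qed

lemma clr_step:
  assumes k: "k \<in> {1..m}"
  shows "(\<Sum>s=1..m. f s * dwt False s k)
    = t k * (f k + (1 - 1 / q) * (\<Sum>s=1..<k. f s))"
proof -
  have "(\<Sum>s=1..m. f s * dwt False s k)
    = (\<Sum>s=1..m. (if s = k then t k * f k else 0) + (if s < k then t k * ((1 - 1 / q) * f s) else 0))"
  proof (intro sum.cong refl)
    fix s assume "s \<in> {1..m}"
    have "{a \<in> {s}. a < k} = (if s < k then {s} else {})" by auto
    then show "f s * dwt False s k =
      (if s = k then t k * f k else 0) + (if s < k then t k * ((1 - 1 / q) * f s) else 0)"
      using k by (auto simp: sys_wt_def algebra_simps)
  qed
  also have "\<dots> = t k * f k + (\<Sum>s\<in>{1..m} \<inter> {s. s < k}. t k * ((1 - 1 / q) * f s))"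
    using k by (simp add: sum.distrib sum.If_cases)
  also have "{1..m} \<inter> {s. s < k} = {1..<k}" using k by auto
  finally show ?thesis by (simp add: sum_distrib_left distrib_left)
qed

lemma intertwine_step:
  fixes v :: "nat \<Rightarrow> 'k"
  assumes k: "k \<in> {1..m}"
  defines "u \<equiv> \<lambda>k. \<Sum>c=1..m. v c * B c k"
  shows "(\<Sum>s=1..m. u s * dwt False s k) =
    (\<Sum>c=1..m. (\<Sum>s=1..m. v s * dwt True s c) * B c k)"
proof -
  let ?e = "\<lambda>s c. rfac s * ((if c = 1 then row_wt q t m 1 else 0) - (if c = Suc s then row_wt q t m (Suc s) else 0))"
  have m: "1 \<le> m" using k by simp
  have "(\<Sum>s=1..m. u s * dwt False s k) =
      t k * (u k + (1 - 1 / q) * (\<Sum>s=1..<k. u s))"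
    by (rule clr_step[OF k])
  also have "\<dots> = (\<Sum>c=1..m. v c * (rfac c / esym t m c * (t k * (bsum c k + (1 - 1 / q) * (\<Sum>s=1..<k. bsum c s)))))"
  proof -
    have lin2: "r * ((\<Sum>c\<in>A. f c * b c) + a * (\<Sum>c\<in>A. f c * d c)) = (\<Sum>c\<in>A. f c * (r * (b c + a * d c)))"
      for r a :: 'k and f b d :: "nat \<Rightarrow> 'k" and A
      by (simp add: sum_distrib_left sum.distrib[symmetric] algebra_simps)
    have "(\<Sum>s=1..<k. u s) = (\<Sum>c=1..m. (v c * (rfac c / esym t m c)) * (\<Sum>s=1..<k. bsum c s))"
      unfolding u_def B_def by (subst sum.swap) (simp add: sum_distrib_left mult.assoc)
    moreover have "u k = (\<Sum>c=1..m. (v c * (rfac c / esym t m c)) * bsum c k)"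
      unfolding u_def B_def by (simp add: mult.assoc)
    ultimately have "t k * (u k + (1 - 1 / q) * (\<Sum>s=1..<k. u s)) = (\<Sum>c=1..m.
      (v c * (rfac c / esym t m c)) * (t k * (bsum c k + (1 - 1 / q) * (\<Sum>s=1..<k. bsum c s))))"
      by (simp only: lin2)
    then show ?thesis by (simp only: mult.assoc)
  qed
  \<comment> \<open>\<open>bsum_recursion\<close> removes the partial sums. Next, \<open>t k\<close>
    is recognized as the contribution of column 1 and \<open>bsum (Suc c) k\<close> as that of
    column \<open>Suc c\<close>; for \<open>c = m\<close> the latter vanishes, in accordance with
    column \<open>Suc m\<close> being absent.\<close>
  also have "\<dots> = (\<Sum>c=1..m. v c * (rfac c * (t k - bsum (Suc c) k / esym t m c)))"
  proof (intro sum.cong refl arg_cong[where f = "\<lambda>x. v _ * x"])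
    fix c assume c: "c \<in> {1..m}"
    have *: "t k * (bsum c k + (1 - 1 / q) * (\<Sum>s=1..<k. bsum c s)) = esym t m c * t k - bsum (Suc c) k"
      using bsum_recursion[OF k, of c] by (simp add: algebra_simps)
    show "rfac c / esym t m c * (t k * (bsum c k + (1 - 1 / q) * (\<Sum>s=1..<k. bsum c s))) =
      rfac c * (t k - bsum (Suc c) k / esym t m c)"
      unfolding * using esym_nz[of c] c by (simp add: field_simps)
  qed
  also have "\<dots> = (\<Sum>s=1..m. v s * (\<Sum>c=1..m. ?e s c * B c k))"
  proof (intro sum.cong refl arg_cong[where f = "\<lambda>x. v _ * x"])
    fix s assume s: "s \<in> {1..m}"
    have "(\<Sum>c=1..m. ?e s c * B c k)
      = rfac s * ((\<Sum>c=1..m. if c = 1 then row_wt q t m 1 * B 1 k else 0)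
         - (\<Sum>c=1..m. if c = Suc s then row_wt q t m (Suc s) * B (Suc s) k else 0))"
      unfolding sum_subtractf[symmetric] sum_distrib_left by (intro sum.cong refl) auto
    also have "(\<Sum>c=1..m. if c = 1 then row_wt q t m 1 * B 1 k else 0) = t k"
      using row_wt_B[OF k, of 0] bsum_1[OF k] m by simp
    also have "(\<Sum>c=1..m. if c = Suc s then row_wt q t m (Suc s) * B (Suc s) k else 0)
       = bsum (Suc s) k / esym t m s"
      using row_wt_B[OF k, of s] bsum_top[of k] s by (cases "s = m") auto
    finally show "rfac s * (t k - bsum (Suc s) k / esym t m s) = (\<Sum>c=1..m. ?e s c * B c k)" by simp
  qed
  also have "\<dots> = (\<Sum>s=1..m. v s * (\<Sum>c=1..m. dwt True s c * B c k))"
    by (intro sum.cong refl arg_cong[where f = "\<lambda>x. v _ * x"]) (simp add: col_step)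
  also have "\<dots> = (\<Sum>c=1..m. (\<Sum>s=1..m. v s * dwt True s c) * B c k)"
    unfolding sum_distrib_left sum_distrib_right by (subst sum.swap) (simp add: mult.assoc)
  finally show ?thesis .
qed

lemma loops_intertwine:
  assumes k: "k \<in> {1..m}"
  shows "(Ph ^^ b) (Dp vac) False [k] = (\<Sum>c=1..m. (Ph ^^ b) (Dp vac) True [c] * B c k)"
  using k
proof (induction b arbitrary: k)
  case 0
  have "(\<Sum>c=1..m. Dp vac True [c] * B c k) = (\<Sum>c=1..m. if c = 1 then row_wt q t m 1 * B 1 k else 0)"
    by (intro sum.cong refl) (auto simp: Dp_def vac_def sys_wt_col_empty)
  also have "\<dots> = t k" using row_wt_B[OF 0, of 0] bsum_1[OF 0] 0 by simp
  finally show ?case using 0 by (simp add: Dp_def vac_def sys_wt_clr_empty)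
next
  case (Suc b)
  define v where "v = (Ph ^^ b) (Dp vac)"
  have P: "Ph v g [c] = (\<Sum>s=1..m. v g [s] * dwt g s c)" for g c
    using Ph_snoc[of v g "[]" c] by simp
  have "Ph v False [k] = (\<Sum>s=1..m. (\<Sum>c=1..m. v True [c] * B c s) *
      dwt False s k)"
    unfolding P using Suc.IH by (intro sum.cong refl) (simp add: v_def)
  also have "\<dots> = (\<Sum>c=1..m. Ph v True [c] * B c k)"
    unfolding P using intertwine_step[OF Suc.prems, of "\<lambda>c. v True [c]"] by simp
  finally show ?case by (simp add: v_def)
qed

text \<open>\<open>Dm\<close> sums over the letter and each row of \<open>B\<close> sums to 1, so
  the intertwiner preserves totals.\<close>

lemma loops_agree: "Dm ((Ph ^^ b) (Dp vac)) True [] = Dm ((Ph ^^ b) (Dp vac)) False []"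
proof -
  have "Dm ((Ph ^^ b) (Dp vac)) False [] = (\<Sum>k=1..m. \<Sum>c=1..m. (Ph ^^ b) (Dp vac) True [c] * B c k)"
    unfolding Dm_def by (intro sum.cong refl loops_intertwine)
  also have "\<dots> = (\<Sum>c=1..m. (Ph ^^ b) (Dp vac) True [c] * (\<Sum>k=1..m. B c k))"
    by (subst sum.swap) (simp add: sum_distrib_left)
  also have "\<dots> = Dm ((Ph ^^ b) (Dp vac)) True []"
    unfolding Dm_def by (intro sum.cong refl) (simp only: sum_B mult_1_right)
  finally show ?thesis by simp
qed

theorem column_sum_eq_color_sum:
  assumes "e \<in> ESeq n"
  shows "(\<Sum>cs\<in>words {1..m} n. word_wt True e cs) = (\<Sum>cs\<in>words {1..m} n. word_wt False e cs)"
  by (rule words_agree[OF assms loops_agree])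

end

subsection \<open>Colorings as words\<close>

text \<open>Position \<open>i\<close>, counted from 0, holds the color of vertex
  \<open>n - i\<close>. The restriction to \<open>{1..n}\<close> matches the extensional functions
  in \<open>proper_colorings\<close>.\<close>

definition coloring_of :: "nat \<Rightarrow> nat list \<Rightarrow> nat \<Rightarrow> nat" where
  "coloring_of n ks = (\<lambda>v\<in>{1..n}. ks ! (n - v))"

text \<open>The edges in terms of positions: the letter at \<open>j\<close> is active when the
  letter at \<open>i\<close> is appended.\<close>

definition arcs :: "nat \<Rightarrow> (nat \<Rightarrow> nat) \<Rightarrow> (nat \<times> nat) set" where
  "arcs n e = {(i, j). i < n \<and> e (Suc i) \<le> j \<and> j < i}"

lemma finite_arcs [simp]: "finite (arcs n e)"
  by (rule finite_subset[of _ "{..<n} \<times> {..<n}"]) (auto simp: arcs_def)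

lemma ESeq_mono:
  assumes "e \<in> ESeq n" "1 \<le> i" "i \<le> j" "j \<le> n"
  shows "e i \<le> e j"
  using assms(3,4)
proof (induction rule: dec_induct)
  case (step k)
  then show ?case using assms(1,2) by (force simp: ESeq_def intro: order.trans)
qed simp

lemma ESeq_le: "e \<in> ESeq n \<Longrightarrow> i < n \<Longrightarrow> e (Suc i) \<le> i"
proof -
  assume "e \<in> ESeq n" "i < n"
  then have "e (Suc i) < Suc i" by (auto simp: ESeq_def)
  then show ?thesis by simp
qed

lemma edges_arcs:
  assumes e: "e \<in> ESeq n"
  shows "edges n e = (\<lambda>(i, j). (n - i, n - j)) ` arcs n e"
proof (intro equalityI subsetI; clarify)
  fix u v assume uv: "(u, v) \<in> edges n e"
  then have *: "1 \<le> u" "u < v" "v \<le> n" "v \<le> n - e (n + 1 - u)"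
    by (auto simp: edges_def hess_def)
  have "n + 1 - u = Suc (n - u)" using * by simp
  then have "(n - u, n - v) \<in> arcs n e" using * by (auto simp: arcs_def)
  then show "(u, v) \<in> (\<lambda>(i, j). (n - i, n - j)) ` arcs n e"
    using * by (intro image_eqI[of _ _ "(n - u, n - v)"]) auto
next
  fix i j assume ij: "(i, j) \<in> arcs n e"
  then have *: "i < n" "e (Suc i) \<le> j" "j < i" by (auto simp: arcs_def)
  then have "n + 1 - (n - i) = Suc i" by simp
  then show "(n - i, n - j) \<in> edges n e"
    using * by (auto simp: edges_def hess_def)
qed

lemma inj_on_arcs: "inj_on (\<lambda>(i, j). (n - i, n - j)) (arcs n e)"
  by (auto simp: inj_on_def arcs_def)

lemma card_edges: "e \<in> ESeq n \<Longrightarrow> card (edges n e) = card (arcs n e)"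
  by (simp add: edges_arcs card_image[OF inj_on_arcs])

lemma arcs_sigma: "arcs n e = Sigma {..<n} (\<lambda>i. {e (Suc i)..<i})"
  by (auto simp: arcs_def)

lemma card_arcs: "card (arcs n e) = (\<Sum>i<n. i - e (Suc i))"
  unfolding arcs_sigma by (subst card_SigmaI) auto

lemma card_edges_eseq_sum:
  assumes e: "e \<in> ESeq n"
  shows "card (edges n e) + eseq_sum n e = (\<Sum>i<n. i)"
proof -
  have "eseq_sum n e = (\<Sum>i<n. e (Suc i))"
    unfolding eseq_sum_def using sum.shift_bounds_Suc_ivl[of e 0 n]
    by (simp add: atLeast0LessThan atLeastLessThanSuc_atLeastAtMost flip: atLeastLessThanSuc_atLeastAtMost)
  moreover have "e (Suc i) \<le> i" if "i < n" for i
    using ESeq_le[OF e that] .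
  ultimately show ?thesis
    by (simp add: card_edges[OF e] card_arcs sum.distrib[symmetric])
qed

lemma coloring_of_nth: "i < n \<Longrightarrow> coloring_of n ks (n - i) = ks ! i"
  by (simp add: coloring_of_def Suc_le_eq)

lemma asc_arcs:
  assumes e: "e \<in> ESeq n"
  shows "asc n e (coloring_of n ks) = card {(i, j). (i, j) \<in> arcs n e \<and> ks ! i < ks ! j}"
proof -
  have "{(u, v). (u, v) \<in> edges n e \<and> coloring_of n ks u < coloring_of n ks v} =
     (\<lambda>(i, j). (n - i, n - j)) ` {(i, j). (i, j) \<in> arcs n e \<and> ks ! i < ks ! j}"
    (is "?L = ?f ` ?R")
  proof (intro equalityI subsetI)
    fix p assume "p \<in> ?L"
    then obtain i j where ij: "(i, j) \<in> arcs n e" "p = (n - i, n - j)"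
        "coloring_of n ks (n - i) < coloring_of n ks (n - j)"
      unfolding edges_arcs[OF e] by auto
    have "i < n" "j < n" using ij(1) by (auto simp: arcs_def)
    with ij have "(i, j) \<in> ?R" by (simp add: coloring_of_nth)
    then show "p \<in> ?f ` ?R" by (rule rev_image_eqI) (simp add: ij(2))
  next
    fix p assume "p \<in> ?f ` ?R"
    then obtain i j where ij: "(i, j) \<in> arcs n e" "p = (n - i, n - j)" "ks ! i < ks ! j"
      by auto
    have "i < n" "j < n" using ij(1) by (auto simp: arcs_def)
    moreover have "(n - i, n - j) \<in> edges n e"
      unfolding edges_arcs[OF e] using ij(1) by (rule rev_image_eqI) simp
    ultimately show "p \<in> ?L" using ij by (simp add: coloring_of_nth)
  qed
  moreover have "inj_on (\<lambda>(i, j). (n - i, n - j)) {(i, j). (i, j) \<in> arcs n e \<and> ks ! i < ks ! j}"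
    by (rule inj_on_subset[OF inj_on_arcs]) auto
  ultimately show ?thesis unfolding asc_def by (simp add: card_image)
qed

lemma proper_arcs:
  assumes e: "e \<in> ESeq n"
  shows "(\<forall>(u, v) \<in> edges n e. coloring_of n ks u \<noteq> coloring_of n ks v) \<longleftrightarrow>
     (\<forall>(i, j) \<in> arcs n e. ks ! i \<noteq> ks ! j)"
proof -
  have "coloring_of n ks (n - i) = ks ! i \<and> coloring_of n ks (n - j) = ks ! j" if "(i, j) \<in> arcs n e" for i j
    using that by (auto simp: arcs_def coloring_of_nth)
  then show ?thesis unfolding edges_arcs[OF e] by fastforce
qed

lemma (in generic_systems) word_wt_color:
  assumes e: "e \<in> ESeq n" and ks: "ks \<in> words {1..m} n"
  shows "q ^ card (edges n e) * word_wt False e ks =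
    (if \<forall>(u, v) \<in> edges n e. coloring_of n ks u \<noteq> coloring_of n ks v
     then (\<Prod>i<n. t (ks ! i)) * q ^ asc n e (coloring_of n ks) else 0)"
proof -
  have len: "length ks = n" and sub: "set ks \<subseteq> {1..m}" using ks by (auto simp: words_def)
  let ?A = "\<lambda>i. set (drop (e (Suc i)) (take i ks))"
  let ?D = "{(i, j). (i, j) \<in> arcs n e \<and> ks ! j < ks ! i}" and ?As = "{(i, j). (i, j) \<in> arcs n e \<and> ks ! i < ks ! j}"
    and ?Di = "\<lambda>i. {j. (i, j) \<in> arcs n e \<and> ks ! j < ks ! i}"
  have A: "?A i = (\<lambda>j. ks ! j) ` {e (Suc i)..<i}" if "i < n" for i
  proof -
    have "drop (e (Suc i)) (take i ks) = map ((!) ks) [e (Suc i)..<i]"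
      using that len by (intro nth_equalityI) auto
    then show ?thesis by simp
  qed
  have notin: "ks ! i \<notin> ?A i \<longleftrightarrow> (\<forall>j. (i, j) \<in> arcs n e \<longrightarrow> ks ! i \<noteq> ks ! j)" if "i < n" for i
    using that by (auto simp: A arcs_def)
  show ?thesis
  proof (cases "\<forall>(i, j) \<in> arcs n e. ks ! i \<noteq> ks ! j")
    case False
    then obtain i j where ij: "(i, j) \<in> arcs n e" "ks ! i = ks ! j" by auto
    then have i: "i < n" by (auto simp: arcs_def)
    have "ks ! i \<in> ?A i" using notin[OF i] ij by auto
    then have "word_wt False e ks = 0"
      unfolding word_wt_def len by (intro prod_zero[OF _ bexI[of _ i]]) (use i in \<open>auto simp: wt_member\<close>)
    then show ?thesis unfolding proper_arcs[OF e] if_not_P[OF False] by simp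
  next
    case True
    have wt: "sys_wt q t m False (?A i) (ks ! i) = t (ks ! i) * (1 / q) ^ card (?Di i)"
      if i: "i < n" for i
    proof -
      have mem: "ks ! i \<in> {1..m}" by (rule subsetD[OF sub nth_mem]) (use i len in simp)
      have ni: "ks ! i \<notin> ?A i" using notin[OF i] True by auto
      \<comment> \<open>Active letters are pairwise distinct: as \<open>e\<close> is monotone, any
        two of their positions are themselves joined by an arc. Hence the cardinality of a set of
        letters in \<open>sys_wt\<close> counts arcs.\<close>
      have inj: "inj_on ((!) ks) {e (Suc i)..<i}"
      proof (rule linorder_inj_onI')
        fix j j' assume j: "j \<in> {e (Suc i)..<i}" "j' \<in> {e (Suc i)..<i}" "j < j'"
        have "e (Suc j') \<le> e (Suc i)" using ESeq_mono[OF e, of "Suc j'" "Suc i"] i j by auto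
        then have "(j', j) \<in> arcs n e" using j i by (auto simp: arcs_def)
        then show "ks ! j \<noteq> ks ! j'" using True by fastforce
      qed
      have "{a \<in> ?A i. a < ks ! i} = (!) ks ` (?Di i)"
        unfolding A[OF i] using i by (auto simp: arcs_def)
      moreover have "inj_on ((!) ks) (?Di i)"
        by (rule inj_on_subset[OF inj]) (auto simp: arcs_def)
      ultimately have "card {a \<in> ?A i. a < ks ! i} = card (?Di i)"
        by (simp add: card_image)
      then show ?thesis using mem ni by (simp add: sys_wt_def)
    qed
    have down: "(\<Sum>i<n. card (?Di i)) = card ?D"
    proof -
      have "?D = Sigma {..<n} ?Di"
        by (auto simp: arcs_def)
      moreover have "finite (?Di i)" for i
        by (rule finite_subset[of _ "{..<n}"]) (auto simp: arcs_def)
      ultimately show ?thesis by simp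
    qed
    have split: "card (edges n e) = asc n e (coloring_of n ks) + card ?D"
    proof -
      have "arcs n e = ?As \<union> ?D"
        using True by (auto simp: neq_iff)
      then have "card (arcs n e) = card ?As + card ?D"
        by (subst card_Un_disjoint[symmetric]) (auto intro: finite_subset[OF _ finite_arcs[of n e]])
      then show ?thesis by (simp add: card_edges[OF e] asc_arcs[OF e])
    qed
    have "word_wt False e ks = (\<Prod>i<n. t (ks ! i)) * (1 / q) ^ card ?D"
      unfolding word_wt_def len down[symmetric] power_sum prod.distrib[symmetric]
      by (intro prod.cong refl) (simp add: wt)
    then have "q ^ card (edges n e) * word_wt False e ks = (\<Prod>i<n. t (ks ! i)) * q ^ asc n e (coloring_of n ks)"
      using q0 by (simp add: split power_add power_divide)
    then show ?thesis unfolding proper_arcs[OF e] if_P[OF True] .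
  qed
qed

definition msets :: "nat \<Rightarrow> nat \<Rightarrow> nat multiset set" where
  "msets m n = {M. size M = n \<and> set_mset M \<subseteq> {1..m}}"

lemma finite_msets [simp]: "finite (msets m n)"
proof (rule finite_subset)
  show "msets m n \<subseteq> mset ` words {1..m} n"
  proof
    fix M assume "M \<in> msets m n"
    moreover obtain xs where "M = mset xs" using ex_mset by metis
    ultimately show "M \<in> mset ` words {1..m} n" by (auto simp: msets_def words_def)
  qed
qed auto

lemma bij_coloring_of:
  "bij_betw (coloring_of n) (words {1..m} n) ({1..n} \<rightarrow>\<^sub>E {1..m})"
proof (rule bij_betwI[where g = "\<lambda>\<kappa>. map (\<lambda>i. \<kappa> (n - i)) [0..<n]"])
  show "coloring_of n \<in> words {1..m} n \<rightarrow> ({1..n} \<rightarrow>\<^sub>E {1..m})"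
  proof (intro funcsetI PiE_I)
    fix ks v assume "ks \<in> words {1..m} n" "v \<in> {1..n}"
    then have "ks ! (n - v) \<in> set ks" "set ks \<subseteq> {1..m}" by (auto simp: words_def)
    then show "coloring_of n ks v \<in> {1..m}" using \<open>v \<in> {1..n}\<close> by (auto simp: coloring_of_def)
  qed (auto simp: coloring_of_def)
  show "(\<lambda>\<kappa>. map (\<lambda>i. \<kappa> (n - i)) [0..<n]) \<in> ({1..n} \<rightarrow>\<^sub>E {1..m}) \<rightarrow> words {1..m} n"
    by (fastforce simp: words_def PiE_iff)
  show "map (\<lambda>i. coloring_of n ks (n - i)) [0..<n] = ks" if "ks \<in> words {1..m} n" for ks
    using that by (intro nth_equalityI) (auto simp: words_def coloring_of_def)
  show "coloring_of n (map (\<lambda>i. \<kappa> (n - i)) [0..<n]) = \<kappa>" if "\<kappa> \<in> {1..n} \<rightarrow>\<^sub>E {1..m}" for \<kappa>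
  proof
    fix v
    show "coloring_of n (map (\<lambda>i. \<kappa> (n - i)) [0..<n]) v = \<kappa> v"
      using PiE_arb[OF that, of v] by (cases "v \<in> {1..n}") (simp_all add: coloring_of_def)
  qed
qed

lemma qvar_power: "to_fract (monom 1 k) = qvar ^ k"
proof (induction k)
  case (Suc k)
  have "monom 1 (Suc k) = [:0, 1:] * (monom 1 k :: int poly)" by (simp add: monom_Suc)
  then show ?case using Suc by (simp only: qvar_def to_fract_mult power_Suc)
qed (simp add: one_pCons[symmetric])

theorem color_sum:
  assumes gen: "generic_systems qvar t m" and e: "e \<in> ESeq n"
  shows "qvar ^ card (edges n e) * (\<Sum>ks\<in>words {1..m} n. letter_systems.word_wt (sys_wt qvar t m) False e ks)
    = (\<Sum>M\<in>msets m n. (\<Prod>i\<in>#M. t i) * to_fract (chrom_qsym n e M))"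
proof -
  interpret generic_systems qvar t m by (rule gen)
  define okc where "okc \<kappa> \<longleftrightarrow> (\<forall>(u, v) \<in> edges n e. \<kappa> u \<noteq> \<kappa> v)" for \<kappa> :: "nat \<Rightarrow> nat"
  define w where "w \<kappa> = (\<Prod>v=1..n. t (\<kappa> v)) * qvar ^ asc n e \<kappa>" for \<kappa> :: "nat \<Rightarrow> nat"
  define \<mu> where "\<mu> \<kappa> = image_mset \<kappa> (mset_set {1..n})" for \<kappa> :: "nat \<Rightarrow> nat"
  let ?P = "{1..n} \<rightarrow>\<^sub>E {1..m}"
  define C where "C = {\<kappa> \<in> ?P. okc \<kappa>}"
  have finP: "finite ?P" by (intro finite_PiE) auto
  have "qvar ^ card (edges n e) * (\<Sum>ks\<in>words {1..m} n. word_wt False e ks)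
     = (\<Sum>ks\<in>words {1..m} n. if okc (coloring_of n ks) then w (coloring_of n ks) else 0)"
    unfolding sum_distrib_left
  proof (intro sum.cong refl)
    fix ks assume ks: "ks \<in> words {1..m} n"
    have "(\<Prod>v=1..n. t (coloring_of n ks v)) = (\<Prod>i<n. t (ks ! i))"
      by (rule prod.reindex_bij_witness[of _ "\<lambda>i. n - i" "\<lambda>v. n - v"]) (auto simp: coloring_of_def)
    then show "qvar ^ card (edges n e) * word_wt False e ks =
       (if okc (coloring_of n ks) then w (coloring_of n ks) else 0)"
      unfolding word_wt_color[OF e ks] okc_def w_def by (simp only:)
  qed
  also have "\<dots> = (\<Sum>\<kappa>\<in>?P. if okc \<kappa> then w \<kappa> else 0)"
    by (rule sum.reindex_bij_betw[OF bij_coloring_of])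
  also have "\<dots> = (\<Sum>\<kappa>\<in>C. w \<kappa>)"
    unfolding C_def by (rule sum.inter_filter[symmetric, OF finP])
  also have "\<dots> = (\<Sum>M\<in>msets m n. \<Sum>\<kappa>\<in>{\<kappa> \<in> C. \<mu> \<kappa> = M}. w \<kappa>)"
  proof (rule sum.group[symmetric])
    show "finite C" unfolding C_def using finP by simp
    show "\<mu> ` C \<subseteq> msets m n" by (fastforce simp: C_def \<mu>_def msets_def PiE_iff)
  qed simp
  also have "\<dots> = (\<Sum>M\<in>msets m n. (\<Prod>i\<in>#M. t i) * to_fract (chrom_qsym n e M))"
  proof (intro sum.cong refl)
    fix M assume M: "M \<in> msets m n"
    let ?K = "{\<kappa>. \<kappa> \<in> proper_colorings n e \<and> image_mset \<kappa> (mset_set {1..n}) = M}"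
    have "{\<kappa> \<in> C. \<mu> \<kappa> = M} = ?K"
    proof (intro equalityI subsetI)
      fix \<kappa> assume "\<kappa> \<in> {\<kappa> \<in> C. \<mu> \<kappa> = M}"
      then show "\<kappa> \<in> ?K"
        by (auto simp: C_def okc_def \<mu>_def proper_colorings_def PiE_iff)
    next
      fix \<kappa> assume \<kappa>: "\<kappa> \<in> ?K"
      then have "\<kappa> v \<in># M" if "v \<in> {1..n}" for v using that by auto
      moreover have "set_mset M \<subseteq> {1..m}" using M by (simp add: msets_def)
      ultimately have "\<kappa> v \<in> {1..m}" if "v \<in> {1..n}" for v using that by blast
      then show "\<kappa> \<in> {\<kappa> \<in> C. \<mu> \<kappa> = M}"
        using \<kappa> by (auto simp: C_def okc_def \<mu>_def proper_colorings_def PiE_iff)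
    qed
    then have "(\<Prod>i\<in>#M. t i) * to_fract (chrom_qsym n e M) =
       (\<Sum>\<kappa>\<in>{\<kappa> \<in> C. \<mu> \<kappa> = M}. (\<Prod>i\<in>#M. t i) * qvar ^ asc n e \<kappa>)"
      by (simp add: chrom_qsym_def qvar_power sum_distrib_left)
    also have "\<dots> = (\<Sum>\<kappa>\<in>{\<kappa> \<in> C. \<mu> \<kappa> = M}. w \<kappa>)"
      by (intro sum.cong refl) (auto simp: w_def \<mu>_def prod_unfold_prod_mset image_mset.compositionality comp_def)
    finally show "(\<Sum>\<kappa>\<in>{\<kappa> \<in> C. \<mu> \<kappa> = M}. w \<kappa>) = (\<Prod>i\<in>#M. t i) * to_fract (chrom_qsym n e M)" ..
  qed
  finally show ?thesis .
qed

subsection \<open>Tableaux as words\<close>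

definition tabw :: "nat list \<Rightarrow> tableau" where
  "tabw cs = foldl (\<lambda>T c. add_on_column c T) Map.empty cs"

lemma tabw_Nil [simp]: "tabw [] = Map.empty"
  and tabw_snoc: "tabw (cs @ [c]) = add_on_column c (tabw cs)"
  by (simp_all add: tabw_def)

lemma tabw_dom_card:
  "dom (tabw cs) = {(i, j). 1 \<le> j \<and> j \<le> count_list cs i} \<and> finite (dom (tabw cs))
     \<and> card (dom (tabw cs)) = length cs"
proof (induction cs rule: rev_induct)
  case (snoc c cs)
  let ?T = "tabw cs"
  have "{j. (c, j) \<in> dom ?T} = {1..count_list cs c}" using snoc by auto
  then have h: "col_height ?T c = count_list cs c" by (simp add: col_height_def)
  have d: "dom (tabw (cs @ [c])) = insert (c, count_list cs c + 1) (dom ?T)"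
    by (simp add: tabw_snoc add_on_column_def h)
  have new: "(c, count_list cs c + 1) \<notin> dom ?T" using snoc by auto
  have s: "insert (c, count_list cs c + 1) (dom ?T) = {(i, j). 1 \<le> j \<and> j \<le> count_list (cs @ [c]) i}"
    using snoc by (auto split: if_splits)
  have f: "finite (dom ?T)" "card (dom ?T) = length cs" using snoc by blast+
  show ?case unfolding d
    by (intro conjI s) (use f card_insert_disjoint[OF f(1) new] in simp_all)
qed auto

lemma dom_tabw: "dom (tabw cs) = {(i, j). 1 \<le> j \<and> j \<le> count_list cs i}"
  and tab_size_tabw [simp]: "tab_size (tabw cs) = length cs"
  unfolding tab_size_def using tabw_dom_card[of cs] by blast+

lemma col_height_tabw [simp]: "col_height (tabw cs) i = count_list cs i"
proof -
  have "{j. (i, j) \<in> dom (tabw cs)} = {1..count_list cs i}" by (auto simp: dom_tabw)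
  then show ?thesis by (simp add: col_height_def)
qed

lemma tabw_snoc_upd: "tabw (cs @ [c]) = (tabw cs)((c, Suc (count_list cs c)) \<mapsto> Suc (length cs))"
  by (simp add: tabw_snoc add_on_column_def)

lemma tabw_Some_iff:
  "tabw cs (i, j) = Some k \<longleftrightarrow> 1 \<le> k \<and> k \<le> length cs \<and> cs ! (k - 1) = i \<and> count_list (take k cs) i = j"
proof (induction cs arbitrary: k rule: rev_induct)
  case (snoc c cs)
  show ?case
  proof (cases "k = Suc (length cs)")
    case True
    have "tabw cs (i, j) \<noteq> Some k" using snoc[of k] True by simp
    then show ?thesis using True by (auto simp: tabw_snoc_upd)
  next
    case False
    have "(c, Suc (count_list cs c)) \<notin> dom (tabw cs)"
      by (simp add: dom_tabw)
    then have "tabw (cs @ [c]) (i, j) = Some k \<longleftrightarrow> tabw cs (i, j) = Some k"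
      using False by (simp add: tabw_snoc_upd domIff)
    then show ?thesis using snoc[of k] False by (auto simp: nth_append)
  qed
qed auto

lemma tab_upto_tabw: "tab_upto r (tabw cs) = tabw (take r cs)"
proof
  fix x :: "nat \<times> nat"
  obtain i j where x: "x = (i, j)" by (cases x)
  have "tab_upto r (tabw cs) x = Some k \<longleftrightarrow> tabw (take r cs) x = Some k" for k
  proof -
    have "tab_upto r (tabw cs) x = Some k \<longleftrightarrow> tabw cs x = Some k \<and> k \<le> r"
      by (auto simp: tab_upto_def restrict_map_def label_def)
    also have "\<dots> \<longleftrightarrow> tabw (take r cs) x = Some k"
      unfolding x tabw_Some_iff by (auto simp: min_def)
    finally show ?thesis .
  qed
  then show "tab_upto r (tabw cs) x = tabw (take r cs) x" by (metis not_Some_eq)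
qed

lemma top_label_tabw:
  "0 < count_list cs i \<Longrightarrow> r < label (tabw cs) (i, count_list cs i) \<longleftrightarrow> i \<in> set (drop r cs)"
proof (induction cs rule: rev_induct)
  case (snoc c cs)
  show ?case
  proof (cases "i = c")
    case True
    then show ?thesis
      by (cases "r \<le> length cs") (auto simp: tabw_snoc_upd label_def drop_Cons')
  next
    case False
    then have "i \<notin> set (drop (r - length cs) [c])" by (auto dest: in_set_dropD)
    then show ?thesis using snoc False by (auto simp: tabw_snoc_upd label_def)
  qed
qed simp

lemma color_seq_tabw:
  "color_seq r (tabw cs) = map (\<lambda>i. if i \<in> set (drop r cs) then 1 else 0) [1..<length cs + 2]"
proof -
  have "0 < count_list cs i \<and> r < label (tabw cs) (i, count_list cs i) \<longleftrightarrow> i \<in> set (drop r cs)" for i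
    using top_label_tabw[of cs i r] in_set_dropD[of i r cs] count_list_0_iff[of cs i] by auto
  then show ?thesis unfolding color_seq_def by simp
qed

section \<open>Lattice words and shapes\<close>

text \<open>Yamanouchi words: every prefix yields the diagram of a partition. Columns are counted
  from 1, so the letter 0 is ruled out.\<close>

definition lattice :: "nat list \<Rightarrow> bool" where
  "lattice cs \<longleftrightarrow> 0 \<notin> set cs \<and>
     (\<forall>k\<le>length cs. \<forall>i\<ge>1. count_list (take k cs) (Suc i) \<le> count_list (take k cs) i)"

lemma lattice_antimono:
  assumes "lattice cs" "1 \<le> i" "i \<le> i'" "k \<le> length cs"
  shows "count_list (take k cs) i' \<le> count_list (take k cs) i"
  using assms(3)
proof (induction rule: dec_induct)
  case (step i')
  then show ?case using assms unfolding lattice_def by (meson le_trans)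
qed simp

lemma count_take_mono: "k \<le> k' \<Longrightarrow> count_list (take k cs) i \<le> count_list (take k' cs) i"
proof -
  assume "k \<le> k'"
  then have "take k' cs = take k cs @ take (k' - k) (drop k cs)"
    by (metis le_add_diff_inverse take_add)
  then show ?thesis by simp
qed

lemma card_diagram: "finite (diagram lam) \<and> card (diagram lam) = sum_list lam"
proof -
  have "diagram lam = (\<lambda>(j, i). (i, Suc j)) ` Sigma {..<length lam} (\<lambda>j. {1..lam ! j})"
  proof (intro equalityI subsetI; clarify)
    fix i j assume "(i, j) \<in> diagram lam"
    then show "(i, j) \<in> (\<lambda>(j, i). (i, Suc j)) ` Sigma {..<length lam} (\<lambda>j. {1..lam ! j})"
      by (intro image_eqI[of _ _ "(j - 1, i)"]) (auto simp: diagram_def)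
  qed (auto simp: diagram_def)
  moreover have "inj_on (\<lambda>(j, i). (i, Suc j)) (Sigma {..<length lam} (\<lambda>j. {1..lam ! j}))"
    by (auto simp: inj_on_def)
  ultimately show ?thesis
    by (simp add: card_image sum_list_sum_nth atLeast0LessThan)
qed

lemma label_tabw:
  assumes "x \<in> dom (tabw cs)"
  shows "1 \<le> label (tabw cs) x" "label (tabw cs) x \<le> length cs"
    "cs ! (label (tabw cs) x - 1) = fst x" "count_list (take (label (tabw cs) x) cs) (fst x) = snd x"
proof -
  obtain i j where x: "x = (i, j)" by (cases x)
  from assms obtain k where k: "tabw cs (i, j) = Some k" unfolding x by blast
  then have "label (tabw cs) x = k" by (simp add: x label_def)
  then show "1 \<le> label (tabw cs) x" "label (tabw cs) x \<le> length cs"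
    "cs ! (label (tabw cs) x - 1) = fst x" "count_list (take (label (tabw cs) x) cs) (fst x) = snd x"
    using k by (simp_all add: x tabw_Some_iff)
qed

lemma label_tabw_bij:
  "bij_betw (label (tabw cs)) (dom (tabw cs)) {1..length cs}"
proof (rule bij_betwI[where g = "\<lambda>k. (cs ! (k - 1), count_list (take k cs) (cs ! (k - 1)))"])
  show "label (tabw cs) \<in> dom (tabw cs) \<rightarrow> {1..length cs}"
    using label_tabw by fastforce
  have *: "tabw cs (cs ! (k - 1), count_list (take k cs) (cs ! (k - 1))) = Some k" if "k \<in> {1..length cs}" for k
    using that by (simp add: tabw_Some_iff)
  then show "(\<lambda>k. (cs ! (k - 1), count_list (take k cs) (cs ! (k - 1)))) \<in> {1..length cs} \<rightarrow> dom (tabw cs)"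
    by blast
  show "label (tabw cs) (cs ! (k - 1), count_list (take k cs) (cs ! (k - 1))) = k"
    if "k \<in> {1..length cs}" for k using *[OF that] by (simp add: label_def)
  show "(cs ! (label (tabw cs) x - 1), count_list (take (label (tabw cs) x) cs) (cs ! (label (tabw cs) x - 1))) = x"
    if "x \<in> dom (tabw cs)" for x
    using label_tabw[OF that] by (intro prod_eqI) simp_all
qed

lemma length_shape: "dom (tabw cs) = diagram lam \<Longrightarrow> length cs = sum_list lam"
  using tabw_dom_card[of cs] card_diagram[of lam] by metis

lemma tabw_SYT:
  assumes cs: "lattice cs" and shape: "dom (tabw cs) = diagram lam"
  shows "tabw cs \<in> SYT lam"
proof -
  let ?L = "label (tabw cs)"
  have lab: "1 \<le> ?L (i, j) \<and> ?L (i, j) \<le> length cs \<and>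
      cs ! (?L (i, j) - 1) = i \<and> count_list (take (?L (i, j)) cs) i = j"
    if "(i, j) \<in> diagram lam" for i j
    using label_tabw[of "(i, j)" cs] that by (simp add: shape)
  have row: "?L (i, j) < ?L (i', j)"
    if ij: "(i, j) \<in> diagram lam" "(i', j) \<in> diagram lam" "i < i'" for i i' j
  \<comment> \<open>If the box in column \<open>i'\<close> came first, column \<open>i\<close> would
    have fewer than \<open>j\<close> boxes at a moment when column \<open>i'\<close> has
    \<open>j\<close>.\<close>
  proof (rule ccontr)
    define k where "k = ?L (i, j)"
    define k' where "k' = ?L (i', j)"
    note L = lab[OF ij(1), folded k_def] and L' = lab[OF ij(2), folded k'_def]
    assume "\<not> ?L (i, j) < ?L (i', j)"
    then have "k' \<le> k" by (simp add: k_def k'_def)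
    moreover have "k \<noteq> k'" using L L' ij(3) by auto
    ultimately have le: "k' \<le> k - 1" by simp
    have "take k cs = take (k - 1) cs @ [i]"
      using L by (metis Suc_diff_1 Suc_le_lessD less_eq_Suc_le take_Suc_conv_app_nth zero_less_iff_neq_zero not_one_le_zero)
    then have "count_list (take k cs) i = Suc (count_list (take (k - 1) cs) i)" by simp
    then have "count_list (take (k - 1) cs) i < j" using L by simp
    then have "count_list (take k' cs) i < j" using count_take_mono[OF le, of cs i] by simp
    moreover have "1 \<le> i" using ij(1) by (auto simp: diagram_def)
    then have "count_list (take k' cs) i' \<le> count_list (take k' cs) i"
      using lattice_antimono[OF cs, of i i' k'] L' ij(3) by simp
    ultimately show False using L' by simp
  qed
  have col: "?L (i, j) < ?L (i, j')"
    if ij: "(i, j) \<in> diagram lam" "(i, j') \<in> diagram lam" "j < j'" for i j j'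
    using lab[OF ij(1)] lab[OF ij(2)] ij(3) count_take_mono by (metis linorder_not_less)
  show ?thesis
    unfolding SYT_def using label_tabw_bij[of cs] shape length_shape[OF shape] row col by auto
qed

lemma partitions_nth_antimono: "lam \<in> partitions n \<Longrightarrow> i \<le> j \<Longrightarrow> j < length lam \<Longrightarrow> lam ! j \<le> lam ! i"
  by (cases "i = j") (auto simp: partitions_def sorted_wrt_iff_nth_less)

lemma diagram_down:
  assumes "lam \<in> partitions n" "(i, j) \<in> diagram lam" "1 \<le> i'" "i' \<le> i" "1 \<le> j'" "j' \<le> j"
  shows "(i', j') \<in> diagram lam"
proof -
  have "lam ! (j - 1) \<le> lam ! (j' - 1)"
    using assms by (intro partitions_nth_antimono[of lam n]) (auto simp: diagram_def)
  then show ?thesis using assms by (auto simp: diagram_def)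
qed

lemma count_list_card: "count_list xs a = card {k. k < length xs \<and> xs ! k = a}"
  by (simp add: count_list_eq_length_filter length_filter_conv_card eq_commute[of a])

lemma SYT_word:
  assumes lam: "lam \<in> partitions n" and T: "T \<in> SYT lam"
  obtains cs where "lattice cs" "tabw cs = T" "length cs = n"
proof -
  let ?D = "\<lambda>i k. {j. (i, j) \<in> diagram lam \<and> label T (i, j) \<le> k}"
  have n: "sum_list lam = n" using lam by (simp add: partitions_def)
  have domT: "dom T = diagram lam" and bij: "bij_betw (label T) (diagram lam) {1..n}"
    and row: "\<And>i i' j. (i, j) \<in> diagram lam \<Longrightarrow> (i', j) \<in> diagram lam \<Longrightarrow> i < i' \<Longrightarrow> label T (i, j) < label T (i', j)"
    and col: "\<And>i j j'. (i, j) \<in> diagram lam \<Longrightarrow> (i, j') \<in> diagram lam \<Longrightarrow> j < j' \<Longrightarrow> label T (i, j) < label T (i, j')"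
    using T n unfolding SYT_def by auto
  define box where "box = inv_into (diagram lam) (label T)"
  have box: "box k \<in> diagram lam" "label T (box k) = k" if "k \<in> {1..n}" for k
    using bij that unfolding box_def
    by (auto simp: bij_betw_def inv_into_into f_inv_into_f)
  have box_lab: "box (label T x) = x" "label T x \<in> {1..n}" if "x \<in> diagram lam" for x
    using bij that unfolding box_def by (auto simp: bij_betw_def)
  define cs where "cs = map (\<lambda>k. fst (box (Suc k))) [0..<n]"
  have len: "length cs = n" by (simp add: cs_def)
  have count: "count_list (take k cs) i = card (?D i k)" if "k \<le> n" for k i
  proof -
    have "count_list (take k cs) i = card {l. l < k \<and> fst (box (Suc l)) = i}"
      unfolding count_list_card using that by (intro arg_cong[where f = card]) (auto simp: cs_def)
    also have "\<dots> = card (?D i k)"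
    proof (rule bij_betw_same_card[where f = "\<lambda>l. snd (box (Suc l))"],
        rule bij_betwI[where g = "\<lambda>j. label T (i, j) - 1"])
      show "(\<lambda>l. snd (box (Suc l))) \<in> {l. l < k \<and> fst (box (Suc l)) = i} \<rightarrow> ?D i k"
      proof (intro funcsetI CollectI conjI)
        fix l assume l: "l \<in> {l. l < k \<and> fst (box (Suc l)) = i}"
        then have b: "(i, snd (box (Suc l))) = box (Suc l)" by auto
        have "Suc l \<in> {1..n}" using l that by auto
        from box[OF this] show "(i, snd (box (Suc l))) \<in> diagram lam" "label T (i, snd (box (Suc l))) \<le> k"
          unfolding b using l by auto
      qed
      show "(\<lambda>j. label T (i, j) - 1) \<in> ?D i k \<rightarrow> {l. l < k \<and> fst (box (Suc l)) = i}"
        using box_lab by fastforce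
      show "label T (i, snd (box (Suc l))) - 1 = l" if "l \<in> {l. l < k \<and> fst (box (Suc l)) = i}" for l
        using that box[of "Suc l"] \<open>k \<le> n\<close> by auto
      show "snd (box (Suc (label T (i, j) - 1))) = j" if "j \<in> ?D i k" for j
        using that box_lab[of "(i, j)"] by auto
    qed
    finally show ?thesis .
  qed
  have finj: "finite {j. (i, j) \<in> diagram lam \<and> P j}" for i P
    by (rule finite_subset[of _ "{..length lam}"]) (auto simp: diagram_def)
  have "lattice cs"
    unfolding lattice_def
  proof (intro conjI allI impI)
    show "0 \<notin> set cs"
    proof
      assume "0 \<in> set cs"
      then obtain k where "k < n" "fst (box (Suc k)) = 0" by (auto simp: cs_def)
      then show False using box(1)[of "Suc k"] by (cases "box (Suc k)") (auto simp: diagram_def)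
    qed
    fix k i assume k: "k \<le> length cs" and i: "1 \<le> (i :: nat)"
    have "?D (Suc i) k \<subseteq> ?D i k"
    proof
      fix j assume j: "j \<in> ?D (Suc i) k"
      then have "1 \<le> j" by (auto simp: diagram_def)
      then have d: "(i, j) \<in> diagram lam" using diagram_down[OF lam, of "Suc i" j i j] j i by auto
      then show "j \<in> ?D i k" using row[OF d, of "Suc i"] j by auto
    qed
    then show "count_list (take k cs) (Suc i) \<le> count_list (take k cs) i"
      using k len by (simp add: count card_mono finj)
  qed
  moreover have "tabw cs = T"
  proof -
    have fwd: "tabw cs (i, j) = Some k" if "T (i, j) = Some k" for i j k
    proof -
      have d: "(i, j) \<in> diagram lam" using that domT by auto
      have k: "label T (i, j) = k" using that by (simp add: label_def)
      have kn: "k \<in> {1..n}" and b: "box k = (i, j)" using box_lab[OF d] k by auto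
      have "{j'. (i, j') \<in> diagram lam \<and> label T (i, j') \<le> k} = {1..j}"
      proof (intro equalityI subsetI)
        fix j' assume j': "j' \<in> {j'. (i, j') \<in> diagram lam \<and> label T (i, j') \<le> k}"
        then have "1 \<le> j'" by (auto simp: diagram_def)
        moreover have "j' \<le> j"
        proof (rule ccontr)
          assume "\<not> j' \<le> j"
          then show False using col[OF d, of j'] j' k by auto
        qed
        ultimately show "j' \<in> {1..j}" by simp
      next
        fix j' assume j': "j' \<in> {1..j}"
        have "1 \<le> i" using d by (auto simp: diagram_def)
        then have d': "(i, j') \<in> diagram lam" using diagram_down[OF lam d, of i j'] j' by auto
        show "j' \<in> {j'. (i, j') \<in> diagram lam \<and> label T (i, j') \<le> k}"
          using d' col[OF d' d] j' k by (cases "j' = j") auto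
      qed
      then have "count_list (take k cs) i = j" using count[of k i] kn by simp
      moreover have "cs ! (k - 1) = i" using kn b by (cases k) (simp_all add: cs_def)
      ultimately show ?thesis using kn len by (simp add: tabw_Some_iff)
    qed
    \<comment> \<open>The two domains have the same finite size, so the inclusion of maps given by
      \<open>fwd\<close> is already an equality.\<close>
    have "dom T \<subseteq> dom (tabw cs)" using fwd by force
    then have "dom T = dom (tabw cs)"
      using conjunct2[OF tabw_dom_card[of cs]] card_diagram[of lam] len n domT by (intro card_subset_eq) simp_all
    moreover have "T \<subseteq>\<^sub>m tabw cs" using fwd by (auto simp: map_le_def)
    ultimately show ?thesis by (intro map_le_antisym) (auto simp: map_le_def)
  qed
  ultimately show ?thesis using that len by blast
qed

lemma inj_tabw: "inj tabw"
proof
  fix cs cs' assume eq: "tabw cs = tabw cs'"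
  have l: "length cs = length cs'" using eq tabw_dom_card by metis
  show "cs = cs'"
  proof (rule nth_equalityI[OF l])
    fix k assume "k < length cs"
    then have "tabw cs (cs ! k, count_list (take (Suc k) cs) (cs ! k)) = Some (Suc k)"
      by (simp add: tabw_Some_iff)
    then show "cs ! k = cs' ! k" unfolding eq by (simp add: tabw_Some_iff)
  qed
qed

definition lattice_words :: "nat \<Rightarrow> nat list \<Rightarrow> nat list set" where
  "lattice_words n lam = {cs. length cs = n \<and> lattice cs \<and> dom (tabw cs) = diagram lam}"

lemma bij_tabw: "lam \<in> partitions n \<Longrightarrow> bij_betw tabw (lattice_words n lam) (SYT lam)"
  unfolding bij_betw_def
proof (intro conjI equalityI subsetI)
  assume lam: "lam \<in> partitions n"
  show "inj_on tabw (lattice_words n lam)" by (rule inj_on_subset[OF inj_tabw]) simp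
  show "T \<in> SYT lam" if "T \<in> tabw ` lattice_words n lam" for T
    using that tabw_SYT by (auto simp: lattice_words_def)
  show "T \<in> tabw ` lattice_words n lam" if T: "T \<in> SYT lam" for T
  proof -
    obtain cs where "lattice cs" "tabw cs = T" "length cs = n" using SYT_word[OF lam T] .
    then show ?thesis using T by (auto simp: lattice_words_def SYT_def)
  qed
qed

lemma partitions_diagram_inj:
  assumes "lam \<in> partitions n" "mu \<in> partitions n'" and eq: "diagram lam = diagram mu"
  shows "lam = mu"
proof -
  have mem: "(1, j) \<in> diagram lam \<longleftrightarrow> 1 \<le> j \<and> j \<le> length lam" if "lam \<in> partitions n" for lam n j
  proof -
    have "1 \<le> lam ! (j - 1)" if j: "1 \<le> j" "j \<le> length lam"
    proof -
      have "lam ! (j - 1) \<in> set lam" by (rule nth_mem) (use j in linarith)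
      then have "0 < lam ! (j - 1)" using \<open>lam \<in> partitions n\<close> unfolding partitions_def by blast
      then show ?thesis by linarith
    qed
    then show ?thesis by (auto simp: diagram_def)
  qed
  have "{j. (1, j) \<in> diagram lam} = {1..length lam}" "{j. (1, j) \<in> diagram mu} = {1..length mu}"
    using mem[OF assms(1)] mem[OF assms(2)] by auto
  then have l: "length lam = length mu" using eq by (metis card_atLeastAtMost diff_Suc_1)
  show ?thesis
  proof (rule nth_equalityI[OF l])
    fix j assume j: "j < length lam"
    have "{i. (i, Suc j) \<in> diagram lam} = {1..lam ! j}" "{i. (i, Suc j) \<in> diagram mu} = {1..mu ! j}"
      using j l by (auto simp: diagram_def)
    then show "lam ! j = mu ! j" using eq by (metis card_atLeastAtMost diff_Suc_1)
  qed
qed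

lemma down_closed_interval:
  assumes "finite A" "0 \<notin> A" "\<And>i i'. i \<in> A \<Longrightarrow> 1 \<le> i' \<Longrightarrow> i' \<le> i \<Longrightarrow> i' \<in> A"
  shows "A = {1..card A}"
proof (cases "A = {}")
  case False
  have "A = {1..Max A}"
  proof (intro equalityI subsetI)
    fix i assume "i \<in> A"
    then show "i \<in> {1..Max A}" using assms by (auto simp: Suc_le_eq intro: gr0I)
  next
    fix i assume "i \<in> {1..Max A}"
    then show "i \<in> A" using assms(3)[OF Max_in[OF assms(1) False]] by simp
  qed
  then show ?thesis by (metis card_atLeastAtMost diff_Suc_1)
qed simp

text \<open>A partition lists row lengths, hence it is the conjugate of the column heights:
  \<open>A j\<close> collects the columns that reach row \<open>j\<close>, an initial
  segment.\<close>

lemma lattice_shape: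
  assumes cs: "lattice cs"
  obtains lam where "lam \<in> partitions (length cs)" "dom (tabw cs) = diagram lam"
proof -
  let ?h = "count_list cs"
  define A where "A j = {i. 1 \<le> i \<and> j \<le> ?h i}" for j
  have anti: "?h i' \<le> ?h i" if "1 \<le> i" "i \<le> i'" for i i'
    using lattice_antimono[OF cs that, of "length cs"] by simp
  have fin: "finite (A j)" if "1 \<le> j" for j
  proof (rule finite_subset)
    show "A j \<subseteq> set cs" using that by (auto simp: A_def intro: ccontr)
  qed simp
  have A: "A j = {1..card (A j)}" if "1 \<le> j" for j
    by (rule down_closed_interval[OF fin[OF that]]) (auto simp: A_def intro: order.trans[OF _ anti])
  define lam where "lam = map (\<lambda>j. card (A j)) [1..<Suc (?h 1)]"
  have len: "length lam = ?h 1" by (simp add: lam_def del: upt_Suc)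
  have nth: "lam ! (j - 1) = card (A j)" if "1 \<le> j" "j \<le> ?h 1" for j
    using that nth_upt[of 1 "j - 1" "Suc (?h 1)"] by (simp add: lam_def del: upt_Suc)
  have mem: "i \<in> A j \<longleftrightarrow> 1 \<le> i \<and> i \<le> card (A j)" if "1 \<le> j" for i j
    using A[OF that] by (metis atLeastAtMost_iff)
  have dom: "dom (tabw cs) = diagram lam"
  proof (intro equalityI subsetI; clarify)
    fix i j k assume "tabw cs (i, j) = Some k"
    then have "(i, j) \<in> dom (tabw cs)" by blast
    then have j: "1 \<le> j" "j \<le> ?h i" by (auto simp: dom_tabw)
    then have "i \<in> set cs" by (metis count_notin not_one_le_zero le_zero_eq)
    then have i: "1 \<le> i" using cs by (auto simp: lattice_def Suc_le_eq intro: gr0I)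
    then have j1: "j \<le> ?h 1" using anti[of 1 i] j by simp
    have "i \<in> A j" using i j by (simp add: A_def)
    then have "i \<le> card (A j)" using mem[OF j(1)] by blast
    then show "(i, j) \<in> diagram lam"
      using i j j1 nth[OF j(1) j1] by (simp add: diagram_def len)
  next
    fix i j assume "(i, j) \<in> diagram lam"
    then have ij: "1 \<le> j" "j \<le> ?h 1" "1 \<le> i" "i \<le> lam ! (j - 1)"
      by (auto simp: diagram_def len)
    then have "i \<in> A j" using mem[OF ij(1)] nth[OF ij(1,2)] by simp
    then have "(i, j) \<in> dom (tabw cs)" using ij by (simp add: A_def dom_tabw)
    then show "\<exists>k. tabw cs (i, j) = Some k" by blast
  qed
  have "lam \<in> partitions (length cs)"
    unfolding partitions_def
  proof (intro CollectI conjI)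
    have "card (A j') \<le> card (A j)" if "1 \<le> j" "j \<le> j'" for j j'
      using that by (intro card_mono fin) (auto simp: A_def)
    then show "sorted_wrt (\<ge>) lam"
      unfolding sorted_wrt_iff_nth_less lam_def by (auto simp del: upt_Suc)
    have "0 < card (A j)" if "1 \<le> j" "j \<le> ?h 1" for j
    proof -
      have "1 \<in> A j" using that by (simp add: A_def)
      then show ?thesis using fin[OF that(1)] by (auto simp: card_gt_0_iff)
    qed
    then show "\<forall>x\<in>set lam. 0 < x" by (auto simp: lam_def simp del: upt_Suc)
    show "sum_list lam = length cs" using length_shape[OF dom] by simp
  qed
  then show ?thesis using that dom by blast
qed

text \<open>Both sides run over the boxes, once in the order of the labels and once row by row.
  Hence the product of the row weights depends on the shape only.\<close>

lemma prod_over_word: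
  assumes shape: "dom (tabw cs) = diagram lam"
  shows "(\<Prod>k<length cs. f (cs ! k)) = (\<Prod>j<length lam. \<Prod>i=1..lam ! j. (f i :: 'k::comm_monoid_mult))"
proof -
  have "(\<Prod>k<length cs. f (cs ! k)) = (\<Prod>k\<in>{1..length cs}. f (cs ! (k - 1)))"
    by (rule prod.reindex_bij_witness[of _ "\<lambda>k. k - 1" Suc]) auto
  also have "\<dots> = (\<Prod>x\<in>dom (tabw cs). f (cs ! (label (tabw cs) x - 1)))"
    by (rule prod.reindex_bij_betw[OF label_tabw_bij, symmetric])
  also have "\<dots> = (\<Prod>x\<in>dom (tabw cs). f (fst x))"
    by (intro prod.cong refl) (simp add: label_tabw(3)[unfolded One_nat_def])
  also have "\<dots> = (\<Prod>(j, i)\<in>Sigma {..<length lam} (\<lambda>j. {1..lam ! j}). f i)"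
    unfolding shape
    by (rule prod.reindex_bij_witness[of _ "\<lambda>(j, i). (i, Suc j)" "\<lambda>(i, j). (j - 1, i)"])
      (auto simp: diagram_def)
  also have "\<dots> = (\<Prod>j<length lam. \<Prod>i=1..lam ! j. f i)"
    by (rule prod.Sigma[symmetric]) auto
  finally show ?thesis .
qed

definition col_wt :: "'k::field \<Rightarrow> (nat \<Rightarrow> nat) \<Rightarrow> nat list \<Rightarrow> 'k" where
  "col_wt q e cs = (\<Prod>i<length cs. cphi q (set (drop (e (Suc i)) (take i cs))) (cs ! i))"

lemma col_wt_snoc: "col_wt q e (cs @ [c]) = col_wt q e cs * cphi q (set (drop (e (Suc (length cs))) cs)) c"
  by (simp add: col_wt_def nth_append)

lemma cphi_nonzero: "cphi q A c \<noteq> 0 \<Longrightarrow> c \<notin> A \<and> (c = 1 \<or> 1 < c \<and> c - 1 \<in> A)"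
  by (auto simp: cphi_def split: if_splits)

lemma lattice_snoc:
  "lattice (cs @ [c]) \<longleftrightarrow> lattice cs \<and> c \<noteq> 0 \<and> (1 < c \<longrightarrow> count_list cs c < count_list cs (c - 1))"
  (is "?L \<longleftrightarrow> ?R")
proof
  assume L: ?L
  have Lk: "count_list (take k (cs @ [c])) (Suc i) \<le> count_list (take k (cs @ [c])) i"
    if "k \<le> Suc (length cs)" "1 \<le> i" for k i
    using L that unfolding lattice_def by simp
  have "lattice cs" unfolding lattice_def
  proof (intro conjI allI impI)
    fix k i assume "k \<le> length cs" "1 \<le> (i :: nat)"
    then show "count_list (take k cs) (Suc i) \<le> count_list (take k cs) i"
      using Lk[of k i] by simp
  qed (use L in \<open>auto simp: lattice_def\<close>)
  moreover have "count_list (cs @ [c]) c \<le> count_list (cs @ [c]) (c - 1)" if "1 < c"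
    using Lk[of "Suc (length cs)" "c - 1"] that by simp
  ultimately show ?R using L by (auto simp: lattice_def split: if_splits)
next
  assume R: ?R
  show ?L unfolding lattice_def
  proof (intro conjI allI impI)
    show "0 \<notin> set (cs @ [c])" using R by (auto simp: lattice_def)
    fix k i assume k: "k \<le> length (cs @ [c])" and i: "1 \<le> (i :: nat)"
    show "count_list (take k (cs @ [c])) (Suc i) \<le> count_list (take k (cs @ [c])) i"
    proof (cases "k \<le> length cs")
      case True
      then show ?thesis using R i by (auto simp: lattice_def)
    next
      case False
      have "count_list cs (Suc i) \<le> count_list cs i"
        using R i lattice_antimono[of cs i "Suc i" "length cs"] by auto
      then show ?thesis using R False i by auto
    qed
  qed
qed

text \<open>A nonzero weight at \<open>c > 1\<close> requires \<open>c - 1\<close> active and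
  \<open>c\<close> inactive. Among the retired letters \<open>c\<close> is at most as frequent as
  \<open>c - 1\<close>, and among the active ones only \<open>c - 1\<close> occurs, so column
  \<open>c - 1\<close> is strictly higher.\<close>

lemma col_wt_lattice: "0 \<notin> set cs \<Longrightarrow> col_wt q e cs \<noteq> 0 \<Longrightarrow> lattice cs"
proof (induction cs rule: rev_induct)
  case Nil
  then show ?case by (simp add: lattice_def)
next
  case (snoc c cs)
  let ?r = "e (Suc (length cs))"
  have lat: "lattice cs" and "cphi q (set (drop ?r cs)) c \<noteq> 0"
    using snoc by (auto simp: col_wt_snoc)
  note c = cphi_nonzero[OF this(2)]
  have "count_list cs c < count_list cs (c - 1)" if "1 < c"
  proof -
    have cm: "c - 1 \<in> set (drop ?r cs)" "c \<notin> set (drop ?r cs)" using c that by auto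
    have cnt: "count_list cs x = count_list (take ?r cs) x + count_list (drop ?r cs) x" for x
      by (metis append_take_drop_id count_list_append)
    have tk: "take (min ?r (length cs)) cs = take ?r cs" by (simp add: min_def)
    have "count_list (take ?r cs) c \<le> count_list (take ?r cs) (c - 1)"
      using lattice_antimono[OF lat, of "c - 1" c "min ?r (length cs)", unfolded tk] that by simp
    moreover have "count_list (drop ?r cs) c = 0" "count_list (drop ?r cs) (c - 1) \<noteq> 0"
      using cm by (simp_all add: count_list_0_iff)
    ultimately show ?thesis unfolding cnt[of c] cnt[of "c - 1"] by simp
  qed
  then show ?case using lat snoc.prems by (simp add: lattice_snoc)
qed

lemma lattice_le_length: "lattice cs \<Longrightarrow> x \<in> set cs \<Longrightarrow> x \<le> length cs"
proof -
  assume cs: "lattice cs" and x: "x \<in> set cs"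
  have "{1..x} \<subseteq> set cs"
  proof
    fix i assume i: "i \<in> {1..x}"
    then have "count_list cs x \<le> count_list cs i"
      using lattice_antimono[OF cs, of i x "length cs"] by simp
    moreover have "count_list cs x \<noteq> 0" using x by (simp add: count_list_0_iff)
    ultimately show "i \<in> set cs" by (metis count_notin le_zero_eq)
  qed
  then have "x \<le> card (set cs)" using card_mono[of "set cs" "{1..x}"] by simp
  then show ?thesis using card_length[of cs] by simp
qed

subsection \<open>Hikita's weights as residues\<close>

text \<open>The color sequence up to its final zeros. Recursion on the last block allows uniqueness
  to be proved by peeling off maximal runs from the right.\<close>

primrec pre :: "(nat \<Rightarrow> nat) \<Rightarrow> (nat \<Rightarrow> nat) \<Rightarrow> nat \<Rightarrow> nat list" where
  "pre a b 0 = replicate (b 0) 1"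
| "pre a b (Suc l) = (pre a b l @ replicate (a (Suc l)) 0) @ replicate (b (Suc l)) 1"

lemma is_color_runs_pre:
  "is_color_runs \<delta> (l, a, b) \<longleftrightarrow> \<delta> = pre a b l @ replicate (a (Suc l)) 0 \<and>
     (\<forall>i\<in>{1..l}. 0 < a i \<and> 0 < b i) \<and> (\<forall>i. i \<notin> {1..Suc l} \<longrightarrow> a i = 0) \<and> (\<forall>i. i \<notin> {0..l} \<longrightarrow> b i = 0)"
proof -
  have "replicate (b 0) 1 @ concat (map (\<lambda>i. replicate (a i) 0 @ replicate (b i) 1) [1..<l + 1]) = pre a b l"
    by (induction l) auto
  then show ?thesis by (simp flip: append_assoc)
qed

lemma pre_cong:
  "(\<And>i. i \<le> l \<Longrightarrow> b i = b' i) \<Longrightarrow> (\<And>i. 1 \<le> i \<Longrightarrow> i \<le> l \<Longrightarrow> a i = a' i) \<Longrightarrow> pre a b l = pre a' b' l"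
  by (induction l) auto

lemma append_replicate_eq:
  assumes "xs @ replicate p v = ys @ replicate r v" "xs = [] \<or> last xs \<noteq> v" "ys = [] \<or> last ys \<noteq> v"
  shows "xs = ys \<and> p = r"
  using assms(1)
proof (induction p arbitrary: r)
  case 0
  show ?case
  proof (cases r)
    case (Suc r')
    then have "xs = (ys @ replicate r' v) @ [v]" using 0 by (simp add: replicate_append_same)
    then have "xs \<noteq> []" "last xs = v" by simp_all
    then show ?thesis using assms(2) by blast
  qed (use 0 in simp)
next
  case (Suc p)
  show ?case
  proof (cases r)
    case 0
    then have "ys = (xs @ replicate p v) @ [v]" using Suc.prems by (simp add: replicate_append_same)
    then have "ys \<noteq> []" "last ys = v" by simp_all
    then show ?thesis using assms(3) by blast
  next
    case (Suc r')
    have "(xs @ replicate p v) @ [v] = (ys @ replicate r' v) @ [v]"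
      using Suc.prems Suc by (simp add: replicate_append_same)
    then have "xs @ replicate p v = ys @ replicate r' v" by blast
    from Suc.IH[OF this] Suc show ?thesis by simp
  qed
qed

lemma last_pre: "\<forall>i\<in>{1..l}. 0 < a i \<and> 0 < b i \<Longrightarrow> pre a b l = [] \<or> last (pre a b l) \<noteq> 0"
  by (cases l; cases "b 0 = 0") auto

lemma pre_unique:
  assumes "\<forall>i\<in>{1..l}. 0 < a i \<and> 0 < b i" "\<forall>i\<in>{1..l'}. 0 < a' i \<and> 0 < b' i" "pre a b l = pre a' b' l'"
  shows "l = l' \<and> (\<forall>i\<in>{1..l}. a i = a' i) \<and> (\<forall>i\<le>l. b i = b' i)"
  using assms
proof (induction l arbitrary: l')
  case 0
  show ?case
  proof (cases l')
    case 0
    then show ?thesis using "0.prems" by simp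
  next
    case (Suc k)
    have "0 \<in> set (pre a' b' l')" using 0 Suc by auto
    moreover have "0 \<notin> set (pre a b 0)" by simp
    ultimately show ?thesis using "0.prems"(3) by metis
  qed
next
  case (Suc l)
  show ?case
  proof (cases l')
    case 0
    have "0 < a (Suc l)" using Suc.prems(1) by simp
    then have "0 \<in> set (pre a b (Suc l))" by simp
    moreover have "0 \<notin> set (pre a' b' 0)" by simp
    ultimately show ?thesis using Suc.prems(3) 0 by metis
  next
    case (Suc k)
    have pos: "0 < a (Suc l)" "0 < a' (Suc k)" using Suc.prems Suc by auto
    have "pre a b l @ replicate (a (Suc l)) 0 = pre a' b' k @ replicate (a' (Suc k)) 0 \<and> b (Suc l) = b' (Suc k)"
      using Suc.prems(3) pos unfolding Suc by (intro append_replicate_eq[where v = 1]) simp_all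
    moreover from this have "pre a b l = pre a' b' k \<and> a (Suc l) = a' (Suc k)"
      using Suc.prems(1,2) Suc by (intro append_replicate_eq[where v = 0] last_pre) auto
    moreover have "l = k \<and> (\<forall>i\<in>{1..l}. a i = a' i) \<and> (\<forall>i\<le>l. b i = b' i)"
      using Suc.IH[of k] Suc.prems(1,2) Suc calculation by auto
    ultimately show ?thesis using Suc by (auto simp: le_Suc_eq)
  qed
qed

lemma is_color_runs_unique:
  assumes "is_color_runs \<delta> p" "is_color_runs \<delta> p'"
  shows "p = p'"
proof -
  obtain l a b where p1: "p = (l, a, b)" by (cases p)
  obtain l' a' b' where p2: "p' = (l', a', b')" by (cases p')
  note p = p1 p2
  note R = assms(1)[unfolded p1 is_color_runs_pre] and R' = assms(2)[unfolded p2 is_color_runs_pre]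
  note pos = conjunct1[OF conjunct2[OF R]] and pos' = conjunct1[OF conjunct2[OF R']]
  note z = conjunct2[OF conjunct2[OF R]] and z' = conjunct2[OF conjunct2[OF R']]
  have "pre a b l @ replicate (a (Suc l)) 0 = pre a' b' l' @ replicate (a' (Suc l')) 0"
    using conjunct1[OF R] conjunct1[OF R'] by (rule box_equals[OF refl[of \<delta>]])
  from append_replicate_eq[OF this last_pre[OF pos] last_pre[OF pos']]
  have 1: "pre a b l = pre a' b' l'" and 2: "a (Suc l) = a' (Suc l')" by blast+
  from pre_unique[OF pos pos' 1] have l: "l = l'" and 3: "\<forall>i\<in>{1..l}. a i = a' i" "\<forall>i\<le>l. b i = b' i"
    by blast+
  have "a i = a' i" for i
  proof -
    consider "i \<in> {1..l}" | "i = Suc l" | "i \<notin> {1..Suc l}" by force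
    then show ?thesis
    proof cases
      case 3
      then show ?thesis using z z' l by (metis (no_types))
    qed (use 2 3 l in auto)
  qed
  moreover have "b i = b' i" for i
  proof (cases "i \<le> l")
    case False
    then have "i \<notin> {0..l}" by simp
    then show ?thesis using z z' l by (metis (no_types))
  qed (use 3 in blast)
  ultimately show ?thesis unfolding p using l by auto
qed

lemma is_color_runs_exists:
  "set \<delta> \<subseteq> {0, 1} \<Longrightarrow> \<exists>l a b. is_color_runs \<delta> (l, a, b)"
proof (induction \<delta> rule: rev_induct)
  case Nil
  have "is_color_runs [] (0, \<lambda>_. 0, \<lambda>_. 0)" unfolding is_color_runs_pre by simp
  then show ?case by blast
next
  case (snoc x \<delta>)
  then obtain l a b where "is_color_runs \<delta> (l, a, b)" by auto
  note R = this[unfolded is_color_runs_pre]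
  show ?case
  proof (cases "x = 0")
    case True
    have "is_color_runs (\<delta> @ [x]) (l, a(Suc l := Suc (a (Suc l))), b)"
      unfolding is_color_runs_pre using R pre_cong[of l b b a "a(Suc l := Suc (a (Suc l)))"] True
      by (auto simp: replicate_append_same)
    then show ?thesis by blast
  next
    case False
    then have x: "x = 1" using snoc.prems by auto
    show ?thesis
    proof (cases "a (Suc l) = 0")
      case True
      have "pre a (b(l := Suc (b l))) l = pre a b l @ [1]"
      proof (cases l)
        case (Suc l0)
        then show ?thesis using pre_cong[of l0 b "b(l := Suc (b l))" a a]
          by (simp add: replicate_append_same)
      qed (simp add: replicate_append_same)
      then have "is_color_runs (\<delta> @ [x]) (l, a, b(l := Suc (b l)))"
        unfolding is_color_runs_pre using R True x by auto
      then show ?thesis by blast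
    next
      case False
      have "pre a (b(Suc l := 1)) l = pre a b l" by (intro pre_cong) auto
      then have "is_color_runs (\<delta> @ [x]) (Suc l, a, b(Suc l := 1))"
        unfolding is_color_runs_pre using R False x by (auto simp: le_Suc_eq)
      then show ?thesis by blast
    qed
  qed
qed

definition ones :: "nat list \<Rightarrow> nat set" where
  "ones xs = {x. 1 \<le> x \<and> x \<le> length xs \<and> xs ! (x - 1) = 1}"

lemma ones_zeros: "ones (xs @ replicate p 0) = ones xs"
proof (intro set_eqI)
  fix x
  consider "x = 0" | "1 \<le> x" "x - 1 < length xs" | "length xs \<le> x - 1" "1 \<le> x" "x - 1 < length xs + p"
    | "length xs + p \<le> x - 1" "1 \<le> x" by linarith
  then show "x \<in> ones (xs @ replicate p 0) \<longleftrightarrow> x \<in> ones xs"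
    by cases (auto simp: ones_def nth_append)
qed

lemma ones_ones: "ones (xs @ replicate p 1) = ones xs \<union> {length xs + 1..<length xs + p + 1}"
proof (intro set_eqI)
  fix x
  consider "x = 0" | "1 \<le> x" "x - 1 < length xs" | "length xs \<le> x - 1" "1 \<le> x" "x - 1 < length xs + p"
    | "length xs + p \<le> x - 1" "1 \<le> x" by linarith
  then show "x \<in> ones (xs @ replicate p 1) \<longleftrightarrow> x \<in> ones xs \<union> {length xs + 1..<length xs + p + 1}"
    by cases (auto simp: ones_def nth_append)
qed

text \<open>\<open>add_col\<close> as a function of the run lengths: the column just after the
  \<open>k\<close>-th run of ones.\<close>

definition cc :: "(nat \<Rightarrow> nat) \<Rightarrow> (nat \<Rightarrow> nat) \<Rightarrow> nat \<Rightarrow> nat" where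
  "cc a b k = (\<Sum>i = 1..k. a i) + (\<Sum>i = 0..k. b i) + 1"

lemma cc_0: "cc a b 0 = b 0 + 1"
  and cc_Suc: "cc a b (Suc k) = cc a b k + a (Suc k) + b (Suc k)"
  by (simp_all add: cc_def)

lemma length_pre: "length (pre a b l) + 1 = cc a b l"
  by (induction l) (simp_all add: cc_0 cc_Suc)

abbreviation run_cols :: "(nat \<Rightarrow> nat) \<Rightarrow> (nat \<Rightarrow> nat) \<Rightarrow> nat \<Rightarrow> nat set" where
  "run_cols a b l \<equiv> \<Union>i\<le>l. {cc a b i - b i..<cc a b i}"

lemma ones_pre: "ones (pre a b l) = run_cols a b l"
proof (induction l)
  case 0
  have "ones [] = {}" by (simp add: ones_def)
  then show ?case using ones_ones[of "[]" "b 0"] by (simp add: cc_0)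
next
  case (Suc l)
  have "ones (pre a b (Suc l)) = ones (pre a b l) \<union> {cc a b (Suc l) - b (Suc l)..<cc a b (Suc l)}"
    unfolding pre.simps ones_ones ones_zeros by (simp add: cc_Suc add.assoc flip: length_pre)
  then show ?case using Suc by (simp add: atMost_Suc Un_commute)
qed

lemma prod_telescope:
  fixes f :: "nat \<Rightarrow> 'k::field"
  assumes "u \<le> v" "\<And>x. u \<le> x \<Longrightarrow> x \<le> v \<Longrightarrow> f x \<noteq> 0"
  shows "(\<Prod>x\<in>{u..<v}. f x / f (Suc x)) = f u / f v"
  using assms
proof (induction rule: dec_induct)
  case (step v)
  then have "(\<Prod>x\<in>{u..<v}. f x / f (Suc x)) = f u / f v" "f v \<noteq> 0" by auto
  then show ?case using step by simp
qed simp

locale run_data =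
  fixes a b :: "nat \<Rightarrow> nat" and l k :: nat and A :: "nat set" and q :: "'k::field"
  assumes pos: "1 \<le> i \<Longrightarrow> i \<le> l \<Longrightarrow> 0 < a i \<and> 0 < b i"
    and k: "k \<le> l"
    and A: "A = run_cols a b l"
    and q0: "q \<noteq> 0" and q_inj: "q ^ x = q ^ y \<longleftrightarrow> x = y"
begin

text \<open>
  The \<open>i\<close>-th run of ones occupies the columns \<open>oo i, \<dots>, c i - 1\<close>, along which the product defining
  \<open>cphi\<close> telescopes.
\<close>

abbreviation "c \<equiv> cc a b"
definition "oo i = c i - b i"
definition "f x = q ^ c k - q ^ x"

lemma o_0: "oo 0 = 1"
  and o_Suc: "oo (Suc i) = c i + a (Suc i)"
  and o_le: "oo i \<le> c i"
  by (simp_all add: oo_def cc_0 cc_Suc)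

lemma o_b: "oo i + b i = c i"
proof -
  have "b i \<le> c i" unfolding cc_def by (simp add: member_le_sum trans_le_add2 le_SucI)
  then show ?thesis by (simp add: oo_def)
qed

lemma c_less_o: "i < j \<Longrightarrow> j \<le> l \<Longrightarrow> c i < oo j"
proof (induction j)
  case (Suc j)
  have "0 < a (Suc j)" using pos[of "Suc j"] Suc.prems by simp
  moreover have "c i \<le> c j"
  proof (cases "i = j")
    case False
    then have "c i < oo j" using Suc by simp
    then show ?thesis using o_le[of j] by simp
  qed simp
  ultimately show ?case by (simp add: o_Suc)
qed simp

lemma c_less: "i < j \<Longrightarrow> j \<le> l \<Longrightarrow> c i < c j"
  using c_less_o[of i j] o_le[of j] by simp

lemma A': "A = (\<Union>i\<le>l. {oo i..<c i})"
  by (simp add: A oo_def)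

lemma f_eq_0: "f x = 0 \<longleftrightarrow> x = c k"
  by (auto simp: f_def q_inj)

lemma outside: "i \<le> l \<Longrightarrow> i \<noteq> k \<Longrightarrow> oo i \<le> x \<Longrightarrow> x \<le> c i \<Longrightarrow> x \<noteq> c k"
  using c_less_o[of k i] c_less[of i k] k by (cases "i < k") auto

lemma c_notin: "c k \<notin> A"
proof
  assume "c k \<in> A"
  then obtain i where i: "i \<le> l" "oo i \<le> c k" "c k < c i" by (auto simp: A')
  then have "i \<noteq> k" by auto
  from outside[OF i(1) this i(2)] i(3) show False by simp
qed

lemma c_pos: "1 \<le> c k"
  by (simp add: cc_def)

lemma finA: "finite A"
  by (simp add: A)

lemma pred_mem: "1 < c k \<Longrightarrow> c k - 1 \<in> A"
proof -
  assume "1 < c k"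
  then have "0 < b k" using pos[of k] k by (cases k) (simp_all add: cc_0)
  then have "c k - 1 \<in> {oo k..<c k}" using o_b[of k] c_pos by auto
  then show ?thesis using k by (auto simp: A')
qed

text \<open>A factor of the residue product; the denominator that vanishes, at
  \<open>Suc x = c k\<close>, is dropped.\<close>

definition "h x = (if Suc x = c k then f x else f x / f (Suc x))"

lemma prod_h_other:
  assumes "i \<le> l" "i \<noteq> k"
  shows "(\<Prod>x\<in>{oo i..<c i}. h x) = f (oo i) / f (c i)"
proof -
  have "h x = f x / f (Suc x)" if "x \<in> {oo i..<c i}" for x
    using outside[OF assms, of "Suc x"] that by (auto simp: h_def)
  then have "(\<Prod>x\<in>{oo i..<c i}. h x) = (\<Prod>x\<in>{oo i..<c i}. f x / f (Suc x))" by simp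
  also have "\<dots> = f (oo i) / f (c i)"
    using outside[OF assms] by (intro prod_telescope o_le) (auto simp: f_eq_0)
  finally show ?thesis .
qed

lemma prod_h_self: "(\<Prod>x\<in>{oo k..<c k}. h x) = (if b k = 0 then 1 else f (oo k))"
proof (cases "b k = 0")
  case True
  then have "oo k = c k" using o_b[of k] by simp
  then show ?thesis using True by simp
next
  case False
  then obtain d where d: "c k = Suc d" "oo k \<le> d" using o_b[of k] c_pos by (cases "c k") auto
  have "h x = f x / f (Suc x)" if "x \<in> {oo k..<d}" for x
    using that d by (auto simp: h_def)
  then have "(\<Prod>x\<in>{oo k..<d}. h x) = (\<Prod>x\<in>{oo k..<d}. f x / f (Suc x))" by simp
  also have "\<dots> = f (oo k) / f d"
    using d by (intro prod_telescope) (auto simp: f_eq_0)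
  finally have "(\<Prod>x\<in>{oo k..<Suc d}. h x) = f (oo k) / f d * f d"
    using d by (simp add: h_def)
  moreover have "f d \<noteq> 0" using d by (simp add: f_eq_0)
  ultimately show ?thesis using False d by simp
qed

lemma prod_h: "(\<Prod>x\<in>A. h x) = (if b k = 0 then 1 else f (oo k)) * (\<Prod>i\<in>{..l} - {k}. f (oo i) / f (c i))"
proof -
  have disj: "{oo i..<c i} \<inter> {oo j..<c j} = {}" if "i \<le> l" "j \<le> l" "i \<noteq> j" for i j
    using c_less_o[of i j] c_less_o[of j i] that by (cases "i < j") auto
  have "(\<Prod>x\<in>A. h x) = (\<Prod>i\<le>l. \<Prod>x\<in>{oo i..<c i}. h x)"
    unfolding A' by (rule prod.UNION_disjoint) (use disj in simp_all)
  also have "\<dots> = (\<Prod>x\<in>{oo k..<c k}. h x) * (\<Prod>i\<in>{..l} - {k}. \<Prod>x\<in>{oo i..<c i}. h x)"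
    using k by (intro prod.remove) auto
  also have "(\<Prod>i\<in>{..l} - {k}. \<Prod>x\<in>{oo i..<c i}. h x) = (\<Prod>i\<in>{..l} - {k}. f (oo i) / f (c i))"
    by (intro prod.cong refl) (simp add: prod_h_other)
  finally show ?thesis by (simp add: prod_h_self)
qed

text \<open>\<open>f 1\<close> is the denominator \<open>x - q\<close> of the residue formula at the
  pole. If \<open>c k = 1\<close>, it is itself what vanishes, and it is dropped.\<close>

lemma cphi_h: "cphi q A (c k) * (if c k = 1 then 1 else f 1) = (\<Prod>x\<in>A. h x)"
proof (cases "c k = 1")
  case True
  have "h x = (q ^ c k - q ^ x) / (q ^ c k - q ^ Suc x)" if "x \<in> A" for x
  proof -
    have "1 \<le> x"
    proof -
      from that obtain i where i: "i \<le> l" "oo i \<le> x" by (auto simp: A')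
      have "1 \<le> oo i" using o_0 c_less_o[of 0 i] i(1) by (cases "i = 0") auto
      then show ?thesis using i by simp
    qed
    then show ?thesis using True by (simp add: h_def f_def)
  qed
  then show ?thesis using True c_notin by (simp add: cphi_def)
next
  case False
  then have c1: "1 < c k" using c_pos by simp
  note m = pred_mem[OF c1]
  have "(\<Prod>x\<in>A. h x) = h (c k - 1) * (\<Prod>x\<in>A - {c k - 1}. h x)"
    by (rule prod.remove[OF finA m])
  also have "(\<Prod>x\<in>A - {c k - 1}. h x) = (\<Prod>x\<in>A - {c k - 1}. (q ^ c k - q ^ x) / (q ^ c k - q ^ Suc x))"
    using c1 by (intro prod.cong refl) (auto simp: h_def f_def)
  also have "h (c k - 1) = q ^ c k - q ^ (c k - 1)"
    using c1 by (simp add: h_def f_def)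
  finally show ?thesis
    using c1 c_notin m f_eq_0[of 1] by (simp add: cphi_def f_def)
qed

lemma cphi_formula:
  "cphi q A (c k) = (\<Prod>i=1..k. f (oo i) / f (c (i - 1))) * (\<Prod>i=k+1..l. f (oo i) / f (c i))"
proof -
  have split: "{..l} - {k} = {0..<k} \<union> {k+1..l}" using k by auto
  have P: "(\<Prod>i\<in>{..l} - {k}. f (oo i) / f (c i)) = (\<Prod>i=0..<k. f (oo i) / f (c i)) * (\<Prod>i=k+1..l. f (oo i) / f (c i))"
    unfolding split by (rule prod.union_disjoint) auto
  note H = cphi_h[unfolded prod_h P]
  show ?thesis
  proof (cases k)
    case 0
    show ?thesis
    proof (cases "b 0 = 0")
      case True
      then have "c k = 1" by (simp add: 0 cc_0)
      then show ?thesis using H True 0 by simp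
    next
      case False
      then have "c k \<noteq> 1" by (simp add: 0 cc_0)
      moreover from this have "f 1 \<noteq> 0" by (simp add: f_eq_0)
      ultimately show ?thesis using H False 0 o_0 by simp
    qed
  next
    case (Suc k')
    have "b k \<noteq> 0" using pos[of k] k Suc by simp
    have "c k \<noteq> 1" using c_less[of 0 k] k Suc by (simp add: cc_0)
    then have f1: "f 1 \<noteq> 0" by (simp add: f_eq_0)
    \<comment> \<open>The numerators are shifted by one index against the denominators:
      \<open>f (oo 0)\<close> is the prefactor \<open>f 1\<close>, and \<open>f (oo k)\<close>, left
      over from the \<open>k\<close>-th run, fills the last place.\<close>
    have S: "f (oo k) * (\<Prod>i=0..<k. f (oo i) / f (c i)) = f 1 * (\<Prod>i=1..k. f (oo i) / f (c (i - 1)))"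
    proof -
      have "(\<Prod>i=1..k. f (c (i - 1))) = (\<Prod>i=0..<k. f (c i))"
        by (rule prod.reindex_bij_witness[of _ Suc "\<lambda>i. i - 1"]) auto
      moreover have "f (oo k) * (\<Prod>i=0..<k. f (oo i)) = f (oo 0) * (\<Prod>i=1..k. f (oo i))"
        using prod.atLeast0_lessThan_Suc[of "\<lambda>i. f (oo i)" k]
          prod.atLeast0_atMost_Suc_shift[of "\<lambda>i. f (oo i)" k'] prod.atLeast_Suc_atMost[of 0 k "\<lambda>i. f (oo i)"]
        by (simp add: mult.commute atLeastLessThanSuc_atLeastAtMost)
      ultimately show ?thesis by (simp add: prod_dividef o_0)
    qed
    have "cphi q A (c k) * f 1 = f 1 * (\<Prod>i=1..k. f (oo i) / f (c (i - 1))) * (\<Prod>i=k+1..l. f (oo i) / f (c i))"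
      using H \<open>b k \<noteq> 0\<close> \<open>c k \<noteq> 1\<close> by (simp add: mult.assoc[symmetric] S)
    then show ?thesis using f1 by (simp add: mult.commute mult.left_commute)
  qed
qed

lemma q1: "q \<noteq> 1"
  using q_inj[of 1 0] by auto

lemma qint_quot: "qint q x / qint q y = (1 - q ^ x) / (1 - q ^ y)"
  using q1 by (simp add: qint_def)

lemma sum_split_a: "i \<le> j \<Longrightarrow> cc a b j = cc a b i + (\<Sum>x=i+1..j. a x) + (\<Sum>x=i+1..j. b x)"
proof (induction rule: dec_induct)
  case (step n)
  then show ?case by (simp add: cc_Suc)
qed simp

lemma f_low: "x + y = c k \<Longrightarrow> f x = - (q ^ x * (1 - q ^ y))"
  by (simp add: f_def algebra_simps flip: power_add)

lemma f_high: "x = c k + y \<Longrightarrow> f x = q ^ c k * (1 - q ^ y)"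
  by (simp add: f_def power_add algebra_simps)

text \<open>Each \<open>f x\<close> is \<open>1 - q ^ d\<close> up to sign and a power of
  \<open>q\<close>, with \<open>d\<close> the distance from \<open>x\<close> to \<open>c k\<close>.
  Above \<open>c k\<close> the powers cancel; below it, \<open>oo i\<close> exceeds
  \<open>c (i - 1)\<close> by \<open>a i\<close>, so the quotient leaves \<open>q ^ a i\<close>.
  These make up the prefactor of Hikita's formula.\<close>

lemma phi_formula:
  "q ^ (\<Sum>i = 1..k. a i)
      * (\<Prod>i = 1..k. qint q ((\<Sum>j = i + 1..k. a j) + (\<Sum>j = i..k. b j))
                    / qint q ((\<Sum>j = i..k. a j) + (\<Sum>j = i..k. b j)))
      * (\<Prod>i = k + 1..l. qint q ((\<Sum>j = k + 1..i. a j) + (\<Sum>j = k + 1..i - 1. b j))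
                        / qint q ((\<Sum>j = k + 1..i. a j) + (\<Sum>j = k + 1..i. b j)))
   = cphi q A (c k)"
proof -
  let ?x = "\<lambda>i. (\<Sum>j = i + 1..k. a j) + (\<Sum>j = i..k. b j)"
    and ?y = "\<lambda>i. (\<Sum>j = i..k. a j) + (\<Sum>j = i..k. b j)"
    and ?u = "\<lambda>i. (\<Sum>j = k + 1..i. a j) + (\<Sum>j = k + 1..i - 1. b j)"
    and ?v = "\<lambda>i. (\<Sum>j = k + 1..i. a j) + (\<Sum>j = k + 1..i. b j)"
  have low: "q ^ a i * (qint q (?x i)
                    / qint q (?y i)) = f (oo i) / f (c (i - 1))"
    if i: "i \<in> {1..k}" for i
  proof -
    obtain i' where i': "i = Suc i'" using i by (cases i) auto
    have "c k = c i' + (?y i)"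
      using sum_split_a[of i' k] i i' by simp
    then have 1: "f (c i') = - (q ^ c i' * (1 - q ^ (?y i)))"
      by (intro f_low) simp
    have "c k = oo i + (?x i)"
      using sum_split_a[of i k] i o_b[of i] by (simp add: sum.atLeast_Suc_atMost[of i k b])
    then have 2: "f (oo i) = - (q ^ oo i * (1 - q ^ (?x i)))"
      by (intro f_low) simp
    have 3: "q ^ oo i = q ^ c i' * q ^ a i" by (simp add: i' o_Suc power_add)
    have "q ^ c i' \<noteq> 0" using q0 by simp
    then show ?thesis unfolding qint_quot i' diff_Suc_1 by (simp add: 1 2 3 q0 flip: i')
  qed
  have high: "qint q (?u i)
                        / qint q (?v i) = f (oo i) / f (c i)"
    if i: "i \<in> {k + 1..l}" for i
  proof -
    obtain i' where i': "i = Suc i'" "k \<le> i'" using i by (cases i) auto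
    have 1: "f (c i) = q ^ c k * (1 - q ^ (?v i))"
      using sum_split_a[of k i] i by (intro f_high) simp
    have 2: "f (oo i) = q ^ c k * (1 - q ^ (?u i))"
      using sum_split_a[of k i'] i' by (intro f_high) (simp add: o_Suc)
    have "q ^ c k \<noteq> 0" using q0 by simp
    then show ?thesis unfolding qint_quot 1 2 by (simp add: q0)
  qed
  show ?thesis
    unfolding cphi_formula power_sum prod.distrib[symmetric]
    by (intro arg_cong2[where f = "(*)"] prod.cong refl low high)
qed

end

text \<open>For \<open>c = 1\<close> the witness is the initial run, which must then be empty;
  otherwise it is the run of ones that ends at \<open>c - 1\<close>.\<close>

lemma addable_is_corner:
  assumes A: "A = run_cols a b l" and c: "c \<notin> A" "c = 1 \<or> 1 < c \<and> c - 1 \<in> A"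
  shows "\<exists>k\<le>l. c = cc a b k"
  using c(2)
proof
  assume "c = 1"
  have "b 0 = 0"
  proof (rule ccontr)
    assume "b 0 \<noteq> 0"
    then have "1 \<in> {cc a b 0 - b 0..<cc a b 0}" by (simp add: cc_0)
    then have "1 \<in> A" unfolding A by blast
    then show False using c \<open>c = 1\<close> by simp
  qed
  then show ?thesis using \<open>c = 1\<close> by (intro exI[of _ 0]) (simp add: cc_0)
next
  assume c1: "1 < c \<and> c - 1 \<in> A"
  then obtain i where i: "i \<le> l" "cc a b i - b i \<le> c - 1" "c - 1 < cc a b i" unfolding A by auto
  have "\<not> c < cc a b i"
  proof
    assume "c < cc a b i"
    then have "c \<in> {cc a b i - b i..<cc a b i}" using i by auto
    then show False using c(1) i(1) unfolding A by blast
  qed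
  then show ?thesis using i c1 by (intro exI[of _ i]) auto
qed

text \<open>\<open>color_seq\<close> sees only the columns up to \<open>length cs + 1\<close>, hence
  the intersection; \<open>phi_cphi\<close> removes it for words whose letters are at most their
  length.\<close>

lemma color_runs_word:
  obtains l a b where "color_runs r (tabw cs) = (l, a, b)" "\<forall>i\<in>{1..l}. 0 < a i \<and> 0 < b i"
    "set (drop r cs) \<inter> {1..length cs + 1} = run_cols a b l"
proof -
  let ?\<delta> = "color_seq r (tabw cs)"
  have "set ?\<delta> \<subseteq> {0, 1}" by (auto simp: color_seq_tabw)
  then obtain l a b where R: "is_color_runs ?\<delta> (l, a, b)" using is_color_runs_exists by blast
  have "color_runs r (tabw cs) = (l, a, b)"
    unfolding color_runs_def using R by (rule the_equality) (rule is_color_runs_unique[OF _ R])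
  moreover note R' = R[unfolded is_color_runs_pre]
  moreover have "ones ?\<delta> = run_cols a b l"
    unfolding conjunct1[OF R'] ones_zeros ones_pre ..
  moreover have "ones ?\<delta> = set (drop r cs) \<inter> {1..length cs + 1}"
  proof (intro set_eqI)
    fix x
    have "?\<delta> ! (x - 1) = (if x \<in> set (drop r cs) then 1 else 0)" if "1 \<le> x" "x \<le> length cs + 1"
      using that nth_upt[of 1 "x - 1" "length cs + 2"] by (simp add: color_seq_tabw del: upt_Suc)
    then show "x \<in> ones ?\<delta> \<longleftrightarrow> x \<in> set (drop r cs) \<inter> {1..length cs + 1}"
      by (cases "1 \<le> x \<and> x \<le> length cs + 1") (auto simp: ones_def color_seq_tabw simp del: upt_Suc split: if_splits)
  qed
  ultimately show ?thesis by (intro that[of l a b]) auto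
qed

lemma phi_cphi:
  fixes q :: "'k::field"
  assumes q0: "q \<noteq> 0" and q_inj: "\<And>x y. q ^ x = q ^ y \<longleftrightarrow> x = y" and cs: "set cs \<subseteq> {1..length cs}"
  shows "(\<And>k. k \<le> run_count r (tabw cs) \<Longrightarrow> phi q r k (tabw cs) = cphi q (set (drop r cs)) (add_col r (tabw cs) k))"
    and "cphi q (set (drop r cs)) c \<noteq> 0 \<Longrightarrow> \<exists>k\<le>run_count r (tabw cs). c = add_col r (tabw cs) k"
    and "k \<le> run_count r (tabw cs) \<Longrightarrow> k' \<le> run_count r (tabw cs) \<Longrightarrow>
      add_col r (tabw cs) k = add_col r (tabw cs) k' \<Longrightarrow> k = k'"
proof -
  obtain l a b where R: "color_runs r (tabw cs) = (l, a, b)"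
    and pos: "\<forall>i\<in>{1..l}. 0 < a i \<and> 0 < b i"
    and A: "set (drop r cs) \<inter> {1..length cs + 1} = run_cols a b l"
    by (rule color_runs_word[of r cs]) (rule that)
  have "set (drop r cs) \<inter> {1..length cs + 1} = set (drop r cs)"
    using cs set_drop_subset[of r cs] by fastforce
  with A have A: "set (drop r cs) = run_cols a b l" by simp
  have rd: "run_data a b l k (set (drop r cs)) q" if "k \<le> l" for k
    by unfold_locales (use pos that A q0 q_inj in auto)
  have ac: "add_col r (tabw cs) k = cc a b k" for k
    by (simp add: add_col_def cc_def run_a_def run_b_def R)
  show "phi q r k (tabw cs) = cphi q (set (drop r cs)) (add_col r (tabw cs) k)"
    if "k \<le> run_count r (tabw cs)" for k
    using run_data.phi_formula[OF rd[of k]] that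
    by (simp only: phi_def Let_def ac run_a_def run_b_def run_count_def R fst_conv snd_conv)
  show "\<exists>k\<le>run_count r (tabw cs). c = add_col r (tabw cs) k" if "cphi q (set (drop r cs)) c \<noteq> 0"
    using addable_is_corner[OF A] cphi_nonzero[OF that] by (simp add: ac run_count_def R)
  show "k = k'" if "k \<le> run_count r (tabw cs)" "k' \<le> run_count r (tabw cs)"
      "add_col r (tabw cs) k = add_col r (tabw cs) k'"
    using that run_data.c_less[OF rd[of k], of k k'] run_data.c_less[OF rd[of k], of k' k]
    by (cases k k' rule: linorder_cases) (auto simp: ac run_count_def R)
qed

text \<open>A step exists exactly when the next letter is one of the columns \<open>add_col\<close>;
  for any other letter \<open>cphi\<close> vanishes, so both sides are zero together.\<close>

lemma pT_tabw:
  fixes q :: "'k::field"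
  assumes q0: "q \<noteq> 0" and q_inj: "\<And>x y. q ^ x = q ^ y \<longleftrightarrow> x = y" and lat: "lattice cs"
  shows "pT q e (tabw cs) = col_wt q e cs"
proof -
  have sub: "set (take i cs) \<subseteq> {1..length (take i cs)}" if "i \<le> length cs" for i
  proof
    fix x assume x: "x \<in> set (take i cs)"
    have L: "lattice (take i cs)"
      using lat that unfolding lattice_def by (auto simp: min_def dest: in_set_takeD)
    have "x \<noteq> 0" using L x unfolding lattice_def by metis
    moreover note lattice_le_length[OF L x]
    ultimately show "x \<in> {1..length (take i cs)}" by simp
  qed
  let ?T = "\<lambda>i. tabw (take i cs)" and ?k = "\<lambda>i. THE k. is_step e (tabw cs) (Suc i) k"
  have step: "is_step e (tabw cs) (Suc i) k \<longleftrightarrow> k \<le> run_count (e (Suc i)) (?T i) \<and> cs ! i = add_col (e (Suc i)) (?T i) k"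
    if "i < length cs" for i k
  proof -
    have "?T (Suc i) = add_box (e (Suc i)) k (?T i) \<longleftrightarrow>
        tabw (take i cs @ [cs ! i]) = tabw (take i cs @ [add_col (e (Suc i)) (?T i) k])"
      unfolding add_box_def tabw_snoc[symmetric] using that by (simp add: take_Suc_conv_app_nth)
    also have "\<dots> \<longleftrightarrow> cs ! i = add_col (e (Suc i)) (?T i) k"
      using inj_tabw by (auto dest: injD)
    finally show ?thesis by (simp add: is_step_def tab_upto_tabw)
  qed
  note P = phi_cphi[OF q0 q_inj sub]
  show ?thesis
  proof (cases "\<forall>i\<in>{1..length cs}. \<exists>k. is_step e (tabw cs) i k")
    case True
    have "phi q (e (Suc i)) (?k i) (?T i)
        = cphi q (set (drop (e (Suc i)) (take i cs))) (cs ! i)" if i: "i < length cs" for i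
    proof -
      have "Suc i \<in> {1..length cs}" using i by simp
      then obtain k where k: "is_step e (tabw cs) (Suc i) k" using True by blast
      have "(?k i) = k"
        using k by (rule the_equality) (use k P(3)[of i] i in \<open>auto simp: step[OF i]\<close>)
      then show ?thesis using k P(1)[of i k "e (Suc i)"] i by (simp add: step[OF i])
    qed
    then have "(\<Prod>i<length cs. phi q (e (Suc i)) (?k i) (?T i)) = col_wt q e cs"
      unfolding col_wt_def by (intro prod.cong refl) auto
    moreover have "(\<Prod>i = 1..length cs. phi q (e i) (THE k. is_step e (tabw cs) i k) (?T (i - 1)))
       = (\<Prod>i<length cs. phi q (e (Suc i)) (?k i) (?T i))"
      by (rule prod.reindex_bij_witness[of _ Suc "\<lambda>i. i - 1"]) auto
    ultimately show ?thesis using True by (simp add: pT_def tab_upto_tabw)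
  next
    case False
    then obtain i' where i': "i' \<in> {1..length cs}" "\<nexists>k. is_step e (tabw cs) i' k" by blast
    then obtain i where "i' = Suc i" by (cases i') auto
    then have i: "i < length cs" "\<nexists>k. is_step e (tabw cs) (Suc i) k" using i' by auto
    have "cphi q (set (drop (e (Suc i)) (take i cs))) (cs ! i) = 0"
      using P(2)[of i "e (Suc i)" "cs ! i"] i by (auto simp: step)
    then have "col_wt q e cs = 0" unfolding col_wt_def using i(1) by (intro prod_zero) auto
    then show ?thesis unfolding pT_def tab_size_tabw if_not_P[OF False] by simp
  qed
qed

subsection \<open>Uniqueness of the expansion in elementary symmetric functions\<close>

lemma finite_submultisets [simp]: "finite {A. A \<subseteq># M}"
proof (rule finite_subset)
  show "{A. A \<subseteq># M} \<subseteq> mset ` {xs. set xs \<subseteq> set_mset M \<and> length xs \<le> size M}"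
  proof
    fix A assume "A \<in> {A. A \<subseteq># M}"
    then have A: "A \<subseteq># M" by simp
    obtain xs where "A = mset xs" using ex_mset by metis
    then show "A \<in> mset ` {xs. set xs \<subseteq> set_mset M \<and> length xs \<le> size M}"
      using set_mset_mono[OF A] size_mset_mono[OF A] by auto
  qed
  show "finite (mset ` {xs. set xs \<subseteq> set_mset M \<and> length xs \<le> size M})"
    by (intro finite_imageI finite_lists_length_le) simp
qed

text \<open>The monomial of the conjugate partition: the exponent of variable \<open>i\<close> is
  the number of parts that are at least \<open>i\<close>.\<close>

definition mon :: "nat list \<Rightarrow> nat multiset" where
  "mon lam = (\<Sum>x\<leftarrow>lam. mset_set {1..x})"

text \<open>
  Among the monomials of \<open>e\<^sub>\<lambda>\<close>, \<open>mon \<lambda>\<close> has the least sum of indices, namely \<open>stat \<lambda>\<close>, and it occurs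
  with coefficient \<open>1\<close>; this is the unitriangularity.
\<close>

definition stat :: "nat list \<Rightarrow> nat" where
  "stat lam = (\<Sum>x\<leftarrow>lam. \<Sum>{1..x})"

lemma mon_Nil [simp]: "mon [] = {#}"
  and mon_Cons [simp]: "mon (x # lam) = mset_set {1..x} + mon lam"
  and stat_Nil [simp]: "stat [] = 0"
  and stat_Cons [simp]: "stat (x # lam) = \<Sum>{1..x} + stat lam"
  by (simp_all add: mon_def stat_def)

lemma sum_mset_mset_set: "sum_mset (mset_set S) = \<Sum>S"
  by (simp add: sum_unfold_sum_mset)

lemma sum_mset_mon [simp]: "sum_mset (mon lam) = stat lam"
  by (induction lam) (simp_all add: sum_mset_mset_set)

lemma initial_segment_minimal:
  "finite S \<Longrightarrow> S \<subseteq> {1..} \<Longrightarrow> card S = k \<Longrightarrow> \<Sum>{1..k} \<le> \<Sum>S \<and> (\<Sum>S = \<Sum>{1..k} \<longrightarrow> S = {1..k})"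
proof (induction k arbitrary: S)
  case (Suc k)
  then have ne: "S \<noteq> {}" by auto
  let ?m = "Max S" and ?S = "S - {Max S}"
  have m: "?m \<in> S" using Suc.prems ne by simp
  have "S \<subseteq> {1..?m}" using Suc.prems by auto
  then have "card S \<le> ?m" using card_mono[of "{1..?m}" S] by simp
  then have km: "Suc k \<le> ?m" using Suc.prems by simp
  have IH: "\<Sum>{1..k} \<le> \<Sum>?S \<and> (\<Sum>?S = \<Sum>{1..k} \<longrightarrow> ?S = {1..k})"
    using Suc.prems m by (intro Suc.IH) auto
  have S: "\<Sum>S = ?m + \<Sum>?S" using sum.remove[OF Suc.prems(1) m, of "\<lambda>x. x"] .
  have T: "\<Sum>{1..Suc k} = Suc k + \<Sum>{1..k}" by simp
  show ?case
  proof (intro conjI impI)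
    show "\<Sum>{1..Suc k} \<le> \<Sum>S" using IH km S T by linarith
    assume "\<Sum>S = \<Sum>{1..Suc k}"
    then have "?m = Suc k" "\<Sum>?S = \<Sum>{1..k}" using IH km S T by linarith+
    then have "S = insert (Suc k) {1..k}" using IH m by auto
    then show "S = {1..Suc k}" by auto
  qed
qed simp

lemma elem_sym_nonzero:
  "elem_sym k M \<noteq> 0 \<Longrightarrow> \<exists>S. finite S \<and> S \<subseteq> {1..} \<and> card S = k \<and> M = mset_set S"
  by (auto simp: elem_sym_def split: if_splits)

lemma elem_sym_mset_set: "finite S \<Longrightarrow> S \<subseteq> {1..} \<Longrightarrow> card S = k \<Longrightarrow> elem_sym k (mset_set S) = 1"
  by (auto simp: elem_sym_def)

lemma elem_sym_part_Nil: "elem_sym_part [] = mseries_one"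
  and elem_sym_part_Cons: "elem_sym_part (k # lam) M = (\<Sum>A | A \<subseteq># M. elem_sym k A * elem_sym_part lam (M - A))"
  by (simp_all add: elem_sym_part_def mseries_mult_def)

lemma elem_sym_part_nonzero:
  "elem_sym_part lam M \<noteq> (0 :: 'a::comm_semiring_1) \<Longrightarrow> stat lam \<le> sum_mset M \<and> size M = sum_list lam \<and> 0 \<notin># M"
proof (induction lam arbitrary: M)
  case Nil
  then show ?case by (auto simp: elem_sym_part_Nil mseries_one_def split: if_splits)
next
  case (Cons k lam)
  from Cons.prems[unfolded elem_sym_part_Cons] obtain A
    where A: "A \<subseteq># M" "elem_sym k A * elem_sym_part lam (M - A) \<noteq> (0 :: 'a)"
    by (rule sum.not_neutral_contains_not_neutral) auto
  then have nz: "elem_sym k A \<noteq> (0 :: 'a)" "elem_sym_part lam (M - A) \<noteq> (0 :: 'a)" by auto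
  obtain S where S: "finite S" "S \<subseteq> {1..}" "card S = k" "A = mset_set S"
    using elem_sym_nonzero[OF nz(1)] by auto
  have M: "M = A + (M - A)" using A(1) by (simp add: subset_mset.add_diff_inverse)
  have "\<Sum>{1..k} \<le> \<Sum>S" using initial_segment_minimal[OF S(1-3)] by simp
  moreover have "sum_mset M = \<Sum>S + sum_mset (M - A)" "size M = k + size (M - A)"
    using M S by (metis sum_mset.union sum_mset_mset_set, metis size_union size_mset_set)
  moreover have "0 \<notin># M"
  proof
    assume "0 \<in># M"
    then have "0 \<in># A \<or> 0 \<in># M - A" by (subst (asm) M) auto
    then show False using S Cons.IH[OF nz(2)] by auto
  qed
  ultimately show ?case using Cons.IH[OF nz(2)] by simp
qed

text \<open>A minimal sum of indices forces every factor to use its own minimal set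
  \<open>{1..k}\<close>, so at most one term of the product survives.\<close>

lemma elem_sym_part_minimal:
  "sum_mset M = stat lam \<Longrightarrow> elem_sym_part lam M = (if M = mon lam then 1 else (0 :: 'a::comm_semiring_1))"
proof (induction lam arbitrary: M)
  case Nil
  then show ?case by (auto simp: elem_sym_part_Nil mseries_one_def)
next
  case (Cons k lam)
  let ?A = "mset_set {1..k}"
  have only: "elem_sym k A * elem_sym_part lam (M - A) = (0 :: 'a)" if A: "A \<subseteq># M" "A \<noteq> ?A" for A
  proof (rule ccontr)
    assume "elem_sym k A * elem_sym_part lam (M - A) \<noteq> (0 :: 'a)"
    then have nz: "elem_sym k A \<noteq> (0 :: 'a)" "elem_sym_part lam (M - A) \<noteq> (0 :: 'a)" by auto
    obtain S where S: "finite S" "S \<subseteq> {1..}" "card S = k" "A = mset_set S"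
      using elem_sym_nonzero[OF nz(1)] by auto
    have M: "sum_mset M = sum_mset A + sum_mset (M - A)"
      using A(1) by (metis subset_mset.add_diff_inverse sum_mset.union)
    have "sum_mset A = \<Sum>S" by (simp add: S(4) sum_mset_mset_set)
    moreover have "stat lam \<le> sum_mset (M - A)" using elem_sym_part_nonzero[OF nz(2)] by simp
    ultimately have "\<Sum>S \<le> \<Sum>{1..k}" using M Cons.prems by simp
    then have "S = {1..k}" using initial_segment_minimal[OF S(1-3)] by simp
    then show False using A(2) S(4) by simp
  qed
  have "elem_sym_part (k # lam) M = (\<Sum>A\<in>{A. A \<subseteq># M} \<inter> {?A}. elem_sym k A * elem_sym_part lam (M - A) :: 'a)"
    unfolding elem_sym_part_Cons by (rule sum.mono_neutral_right) (auto simp: only)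
  also have "\<dots> = (if M = mon (k # lam) then 1 else 0)"
  proof (cases "?A \<subseteq># M")
    case True
    then have i: "{A. A \<subseteq># M} \<inter> {?A} = {?A}" by auto
    have "sum_mset M = sum_mset ?A + sum_mset (M - ?A)"
      using True by (metis subset_mset.add_diff_inverse sum_mset.union)
    then have "sum_mset (M - ?A) = stat lam" using Cons.prems by (simp add: sum_mset_mset_set)
    from Cons.IH[OF this] have "elem_sym_part lam (M - ?A) = (if M - ?A = mon lam then 1 else (0 :: 'a))" .
    moreover have "M - ?A = mon lam \<longleftrightarrow> M = mon (k # lam)"
      using True by (metis add_diff_cancel_left' mon_Cons subset_mset.add_diff_inverse)
    moreover have "elem_sym k ?A = (1 :: 'a)" by (rule elem_sym_mset_set) auto
    ultimately show ?thesis unfolding i by simp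
  next
    case False
    then have "{A. A \<subseteq># M} \<inter> {?A} = {}" by auto
    moreover have "M \<noteq> mon (k # lam)" using False by auto
    ultimately show ?thesis by simp
  qed
  finally show ?case .
qed

lemma count_mon: "count (mon lam) i = (if i = 0 then 0 else size (filter_mset (\<lambda>x. i \<le> x) (mset lam)))"
  by (induction lam) auto

text \<open>Successive differences of the exponents are the multiplicities of the parts.\<close>

lemma mon_inj:
  assumes "lam \<in> partitions n" "mu \<in> partitions n'" "mon lam = mon mu"
  shows "lam = mu"
proof -
  have sz: "size (filter_mset (\<lambda>x. i \<le> x) (mset lam)) = size (filter_mset (\<lambda>x. i \<le> x) (mset mu))" if "1 \<le> i" for i
    using count_mon[of lam i] count_mon[of mu i] assms(3) that by simp
  have cnt: "count A x + size (filter_mset (\<lambda>y. Suc x \<le> y) A) = size (filter_mset (\<lambda>y. x \<le> y) A)" for A x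
    by (induction A) auto
  have pos: "count (mset nu) 0 = 0" if "nu \<in> partitions k" for nu k
    using that by (auto simp: partitions_def count_eq_zero_iff)
  have "mset lam = mset mu"
  proof (rule multiset_eqI)
    fix x
    show "count (mset lam) x = count (mset mu) x"
    proof (cases "x = 0")
      case True
      then show ?thesis using pos assms by metis
    next
      case False
      then show ?thesis using cnt[of "mset lam" x] cnt[of "mset mu" x] sz[of x] sz[of "Suc x"] by simp
    qed
  qed
  moreover have "sorted (rev lam)" "sorted (rev mu)"
    using assms by (auto simp: partitions_def sorted_wrt_rev)
  ultimately have "rev lam = rev mu"
    by (metis mset_rev properties_for_sort)
  then show ?thesis by simp
qed

lemma length_le_sum_list: "\<forall>x\<in>set xs. 0 < x \<Longrightarrow> length xs \<le> sum_list (xs :: nat list)"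
proof (induction xs)
  case (Cons a xs)
  then have "1 \<le> a" "length xs \<le> sum_list xs" by auto
  then show ?case by simp
qed simp

lemma finite_partitions [simp]: "finite (partitions n)"
proof (rule finite_subset)
  show "partitions n \<subseteq> {xs. set xs \<subseteq> {..n} \<and> length xs \<le> n}"
    using length_le_sum_list by (auto simp: partitions_def dest: member_le_sum_list)
qed (rule finite_lists_length_le, simp)

abbreviation lower_sum :: "nat \<Rightarrow> nat list \<Rightarrow> (nat list \<Rightarrow> 'a) \<Rightarrow> 'a::comm_semiring_1" where
  "lower_sum n lam c \<equiv> \<Sum>mu | mu \<in> partitions n \<and> stat mu < stat lam. c mu * elem_sym_part mu (mon lam)"

lemma elem_expansion_at_mon:
  fixes c :: "nat list \<Rightarrow> 'a::comm_semiring_1"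
  assumes "lam \<in> partitions n"
  shows "(\<Sum>mu\<in>partitions n. c mu * elem_sym_part mu (mon lam))
    = c lam + lower_sum n lam c"
proof -
  let ?I = "insert lam {mu. mu \<in> partitions n \<and> stat mu < stat lam}"
  have "(\<Sum>mu\<in>partitions n. c mu * elem_sym_part mu (mon lam))
      = (\<Sum>mu\<in>?I. c mu * elem_sym_part mu (mon lam))"
  proof (rule sum.mono_neutral_right)
    show "\<forall>mu\<in>partitions n - ?I. c mu * elem_sym_part mu (mon lam) = 0"
    proof
      fix mu assume mu: "mu \<in> partitions n - ?I"
      then have "stat lam \<le> stat mu" "mon lam \<noteq> mon mu" using mon_inj assms by auto
      then have "elem_sym_part mu (mon lam) = (0 :: 'a)"
        using elem_sym_part_nonzero[of mu "mon lam"] elem_sym_part_minimal[of "mon lam" mu]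
        by (cases "stat lam = stat mu") (auto simp: not_le)
      then show "c mu * elem_sym_part mu (mon lam) = 0" by simp
    qed
  qed (use assms in auto)
  also have "\<dots> = c lam * elem_sym_part lam (mon lam) + lower_sum n lam c"
    by (rule sum.insert) auto
  finally show ?thesis by (simp add: elem_sym_part_minimal)
qed

lemma to_fract_elem_sym_part:
  "to_fract (elem_sym_part lam M :: int poly) = elem_sym_part lam M"
proof (induction lam arbitrary: M)
  case (Cons k lam)
  have "to_fract (elem_sym k A :: int poly) = elem_sym k A" for A
    unfolding elem_sym_def if_distrib[of to_fract] to_fract_0 to_fract_1 ..
  then show ?case using Cons by (simp add: elem_sym_part_Cons)
qed (simp add: elem_sym_part_Nil mseries_one_def)

text \<open>\<open>e_coeff\<close> asks for coefficients in \<open>int poly\<close>, whereas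
  \<open>c\<close> lives in the fraction field. Since the diagonal entries are 1, induction on
  \<open>stat\<close> solves for the coefficients without division; this gives first integrality,
  then uniqueness.\<close>

theorem e_coeff_unique:
  assumes X: "\<And>M. to_fract (chrom_qsym n e M) = (\<Sum>lam\<in>partitions n. c lam * elem_sym_part lam M)"
    and lam: "lam \<in> partitions n"
  shows "to_fract (e_coeff n e lam) = c lam"
proof -
  have "\<exists>d. c lam = to_fract d" if "lam \<in> partitions n" for lam
    using that
  proof (induction "stat lam" arbitrary: lam rule: less_induct)
    case less
    have "\<forall>mu. \<exists>d. mu \<in> partitions n \<and> stat mu < stat lam \<longrightarrow> c mu = to_fract d"
      using less.hyps by blast
    then obtain d where d: "\<And>mu. mu \<in> partitions n \<Longrightarrow> stat mu < stat lam \<Longrightarrow> c mu = to_fract (d mu)" by metis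
    have "c lam = to_fract (chrom_qsym n e (mon lam)) -
       lower_sum n lam c"
      using X[of "mon lam"] elem_expansion_at_mon[OF less.prems, of c] by simp
    also have "lower_sum n lam c
      = to_fract (lower_sum n lam d)"
      unfolding to_fract_sum to_fract_mult to_fract_elem_sym_part by (intro sum.cong refl) (auto simp: d)
    finally have "c lam = to_fract (chrom_qsym n e (mon lam) - lower_sum n lam d)"
      by simp
    then show ?case by blast
  qed
  then obtain d where d: "\<And>lam. lam \<in> partitions n \<Longrightarrow> c lam = to_fract (d lam)" by metis
  define d' where "d' lam = (if lam \<in> partitions n then d lam else 0)" for lam
  have "to_fract (chrom_qsym n e M) = to_fract (\<Sum>lam\<in>partitions n. d' lam * elem_sym_part lam M)" for M
    unfolding X to_fract_sum to_fract_mult to_fract_elem_sym_part by (intro sum.cong refl) (auto simp: d d'_def)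
  then have d'X: "chrom_qsym n e M = (\<Sum>lam\<in>partitions n. d' lam * elem_sym_part lam M)" for M
    unfolding to_fract_eq_iff .
  have "e_coeff n e = d'"
    unfolding e_coeff_def
  proof (rule the_equality)
    show "(\<forall>lam. lam \<notin> partitions n \<longrightarrow> d' lam = 0) \<and>
      (\<forall>M. chrom_qsym n e M = (\<Sum>lam\<in>partitions n. d' lam * elem_sym_part lam M))"
      using d'X by (simp add: d'_def)
  next
    fix f assume f: "(\<forall>lam. lam \<notin> partitions n \<longrightarrow> f lam = 0) \<and>
      (\<forall>M. chrom_qsym n e M = (\<Sum>lam\<in>partitions n. f lam * elem_sym_part lam M))"
    have "f lam = d' lam" if "lam \<in> partitions n" for lam
      using that
    proof (induction "stat lam" arbitrary: lam rule: less_induct)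
      case less
      have "lower_sum n lam f
         = lower_sum n lam d'"
        using less.hyps by (intro sum.cong refl) auto
      moreover have "(\<Sum>mu\<in>partitions n. f mu * elem_sym_part mu (mon lam)) = (\<Sum>mu\<in>partitions n. d' mu * elem_sym_part mu (mon lam))"
        using f d'X by metis
      ultimately show ?case
        unfolding elem_expansion_at_mon[OF less.prems] by simp
    qed
    then show "f = d'" using f by (intro ext) (metis d'_def)
  qed
  then show ?thesis using d[OF lam] lam by (simp add: d'_def)
qed

section \<open>Evaluation in finitely many variables\<close>

lemma elem_sym_eval:
  fixes t :: "nat \<Rightarrow> 'k::field"
  shows "(\<Sum>A\<in>msets m k. elem_sym k A * (\<Prod>i\<in>#A. t i)) = esym t m k"
proof -
  let ?P = "{S. S \<subseteq> {1..m} \<and> card S = k}"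
  have fin: "finite S" if "S \<in> ?P" for S using that finite_subset by auto
  have inj: "inj_on mset_set ?P" using fin by (intro inj_onI) (metis finite_set_mset_mset_set)
  have "(\<Sum>A\<in>msets m k. elem_sym k A * (\<Prod>i\<in>#A. t i)) = (\<Sum>A\<in>mset_set ` ?P. elem_sym k A * (\<Prod>i\<in>#A. t i))"
  proof (rule sum.mono_neutral_right)
    show "mset_set ` ?P \<subseteq> msets m k"
    proof
      fix A assume "A \<in> mset_set ` ?P"
      then obtain S where S: "S \<in> ?P" "A = mset_set S" by blast
      then show "A \<in> msets m k" using fin[OF S(1)] by (simp add: msets_def)
    qed
    show "\<forall>A\<in>msets m k - mset_set ` ?P. elem_sym k A * (\<Prod>i\<in>#A. t i) = 0"
    proof
      fix A assume A: "A \<in> msets m k - mset_set ` ?P"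
      have "elem_sym k A = (0 :: 'k)"
      proof (rule ccontr)
        assume "elem_sym k A \<noteq> (0 :: 'k)"
        from elem_sym_nonzero[OF this] obtain S where S: "finite S" "card S = k" "A = mset_set S" by blast
        then have "S \<in> ?P" using A by (simp add: msets_def)
        then show False using A S(3) by blast
      qed
      then show "elem_sym k A * (\<Prod>i\<in>#A. t i) = 0" by simp
    qed
  qed simp
  also have "\<dots> = (\<Sum>S\<in>?P. elem_sym k (mset_set S) * (\<Prod>i\<in>#mset_set S. t i))"
    unfolding sum.reindex[OF inj] comp_def ..
  also have "\<dots> = (\<Sum>S\<in>?P. \<Prod>i\<in>S. t i)"
  proof (intro sum.cong refl)
    fix S assume S: "S \<in> ?P"
    have "elem_sym k (mset_set S) = (1 :: 'k)" using S fin[OF S] by (intro elem_sym_mset_set) auto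
    then show "elem_sym k (mset_set S) * (\<Prod>i\<in>#mset_set S. t i) = (\<Prod>i\<in>S. t i)"
      by (simp add: prod_unfold_prod_mset)
  qed
  finally show ?thesis by (simp add: esym_def)
qed

lemma elem_sym_part_eval:
  fixes t :: "nat \<Rightarrow> 'k::field"
  shows "(\<Sum>M\<in>msets m (sum_list lam). elem_sym_part lam M * (\<Prod>i\<in>#M. t i)) = (\<Prod>x\<leftarrow>lam. esym t m x)"
proof (induction lam)
  case Nil
  have "msets m 0 = {{#}}" by (auto simp: msets_def)
  then show ?case by (simp add: elem_sym_part_Nil mseries_one_def)
next
  case (Cons k lam)
  let ?s = "sum_list lam"
  let ?S = "Sigma (msets m (k + ?s)) (\<lambda>M. {A. A \<subseteq># M})"
    and ?R = "{(M, A). M \<in> msets m (k + ?s) \<and> A \<subseteq># M \<and> size A = k}"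
  define g where "g A B = (elem_sym k A * (\<Prod>i\<in>#A. t i)) * (elem_sym_part lam B * (\<Prod>i\<in>#B. t i))" for A B :: "nat multiset"
  have "(\<Sum>M\<in>msets m (k + ?s). elem_sym_part (k # lam) M * (\<Prod>i\<in>#M. t i))
     = (\<Sum>M\<in>msets m (k + ?s). \<Sum>A | A \<subseteq># M. g A (M - A))"
  proof (intro sum.cong refl)
    fix M
    show "elem_sym_part (k # lam) M * (\<Prod>i\<in>#M. t i) = (\<Sum>A | A \<subseteq># M. g A (M - A))"
      unfolding elem_sym_part_Cons sum_distrib_right
    proof (intro sum.cong refl)
      fix A assume "A \<in> {A. A \<subseteq># M}"
      then have "(\<Prod>i\<in>#M. t i) = (\<Prod>i\<in>#A. t i) * (\<Prod>i\<in>#M - A. t i)"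
        by (metis image_mset_union mem_Collect_eq prod_mset.union subset_mset.add_diff_inverse)
      then show "elem_sym k A * elem_sym_part lam (M - A) * (\<Prod>i\<in>#M. t i) = g A (M - A)"
        by (simp add: g_def)
    qed
  qed
  also have "\<dots> = (\<Sum>(M, A)\<in>?S. g A (M - A))"
    by (rule sum.Sigma) auto
  \<comment> \<open>Once the size of \<open>A\<close> is fixed, \<open>A\<close> and
    \<open>M - A\<close> range independently over the multisets of the two sizes; the discarded
    terms contain a vanishing \<open>elem_sym\<close>.\<close>
  also have "\<dots> = (\<Sum>(M, A)\<in>?R. g A (M - A))"
  proof (rule sum.mono_neutral_right)
    show "finite ?S" by auto
    show "\<forall>x\<in>?S - ?R.
        (case x of (M, A) \<Rightarrow> g A (M - A)) = 0"
    proof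
      fix x assume x: "x \<in> ?S - ?R"
      obtain M A where MA: "x = (M, A)" by (cases x)
      have *: "size A \<noteq> k" using x by (simp add: MA)
      have "elem_sym k A = (0 :: 'k)"
      proof (rule ccontr)
        assume "elem_sym k A \<noteq> (0 :: 'k)"
        from elem_sym_nonzero[OF this] show False using * by auto
      qed
      then show "(case x of (M, A) \<Rightarrow> g A (M - A)) = 0" by (simp add: MA g_def)
    qed
  qed auto
  also have "\<dots> = (\<Sum>(A, B)\<in>msets m k \<times> msets m ?s. g A B)"
  proof (rule sum.reindex_bij_witness[of _ "\<lambda>(A, B). (A + B, A)" "\<lambda>(M, A). (A, M - A)"])
    fix x assume "x \<in> ?R"
    then obtain M A where x: "x = (M, A)" "M \<in> msets m (k + ?s)" "A \<subseteq># M" "size A = k" by auto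
    have "set_mset A \<subseteq> set_mset M" "set_mset (M - A) \<subseteq> set_mset M" using x(3) by (auto dest: mset_subset_eqD in_diffD)
    then show "(case x of (M, A) \<Rightarrow> (A, M - A)) \<in> msets m k \<times> msets m ?s"
      using x by (auto simp: msets_def size_Diff_submset)
    show "(case case x of (M, A) \<Rightarrow> (A, M - A) of (A, B) \<Rightarrow> (A + B, A)) = x"
      using x by (simp add: subset_mset.add_diff_inverse)
  qed (auto simp: msets_def simp del: atLeastAtMost_iff)
  also have "\<dots> = (\<Sum>A\<in>msets m k. elem_sym k A * (\<Prod>i\<in>#A. t i)) * (\<Sum>B\<in>msets m ?s. elem_sym_part lam B * (\<Prod>i\<in>#B. t i))"
    by (simp add: g_def sum_product sum.cartesian_product)
  finally show ?case by (simp add: Cons.IH elem_sym_eval)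
qed

lemma base_digits_inj:
  "(\<And>i. i < m \<Longrightarrow> f i < b) \<Longrightarrow> (\<And>i. i < m \<Longrightarrow> g i < b) \<Longrightarrow>
   (\<Sum>i<m. f i * b ^ i) = (\<Sum>i<m. g i * b ^ i) \<Longrightarrow> i < m \<Longrightarrow> f i = (g i :: nat)"
proof (induction m arbitrary: f g i)
  case (Suc m)
  have S: "(\<Sum>i<Suc m. h i * b ^ i) = h 0 + b * (\<Sum>i<m. h (Suc i) * b ^ i)" for h
    unfolding sum.lessThan_Suc_shift by (simp add: sum_distrib_left mult_ac)
  have b: "f 0 < b" "g 0 < b" using Suc.prems by auto
  have eq: "f 0 + b * (\<Sum>i<m. f (Suc i) * b ^ i) = g 0 + b * (\<Sum>i<m. g (Suc i) * b ^ i)"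
    using Suc.prems(3) unfolding S .
  then have "(f 0 + b * (\<Sum>i<m. f (Suc i) * b ^ i)) mod b = (g 0 + b * (\<Sum>i<m. g (Suc i) * b ^ i)) mod b" by simp
  then have 0: "f 0 = g 0" using b by simp
  then have "(\<Sum>i<m. f (Suc i) * b ^ i) = (\<Sum>i<m. g (Suc i) * b ^ i)" using eq b by simp
  then have "f (Suc i) = g (Suc i)" if "i < m" for i
    using Suc.IH[of "f \<circ> Suc" "g \<circ> Suc" i] Suc.prems that by simp
  then show ?case using 0 Suc.prems(4) by (cases i) auto
qed simp

subsection \<open>Separating monomials and assembling the proof\<close>

definition code :: "nat \<Rightarrow> nat multiset \<Rightarrow> nat" where
  "code b M = (\<Sum>i\<in>#M. b ^ i)"

lemma code_sum: "set_mset M \<subseteq> {..<m} \<Longrightarrow> code b M = (\<Sum>i<m. count M i * b ^ i)"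
proof (induction M)
  case (add x M)
  have "(\<Sum>i<m. count (add_mset x M) i * b ^ i) = (\<Sum>i<m. count M i * b ^ i + (if i = x then b ^ i else 0))"
    by (intro sum.cong refl) auto
  also have "\<dots> = (\<Sum>i<m. count M i * b ^ i) + b ^ x"
    using add.prems by (simp add: sum.distrib)
  finally show ?case using add by (simp add: code_def)
qed (simp add: code_def)

lemma inj_code: "inj_on (code (Suc n)) (msets m n)"
proof
  fix M N assume M: "M \<in> msets m n" and N: "N \<in> msets m n" and eq: "code (Suc n) M = code (Suc n) N"
  have sub: "set_mset M \<subseteq> {..<Suc m}" "set_mset N \<subseteq> {..<Suc m}" using M N by (auto simp: msets_def)
  have lt: "count M i < Suc n" "count N i < Suc n" for i
    using M N count_le_size[of M i] count_le_size[of N i] by (auto simp: msets_def)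
  show "M = N"
  proof (rule multiset_eqI)
    fix i
    show "count M i = count N i"
    proof (cases "i < Suc m")
      case True
      then show ?thesis
        using base_digits_inj[of "Suc m" "count M" "Suc n" "count N" i] lt eq sub by (simp add: code_sum del: sum.lessThan_Suc)
    next
      case False
      then have "i \<notin># M" "i \<notin># N" using sub by auto
      then show ?thesis by (simp add: not_in_iff)
    qed
  qed
qed

lemma kronecker_eqI:
  fixes F G :: "nat multiset \<Rightarrow> 'k::field_char_0"
  assumes eq: "\<And>z. 0 < z \<Longrightarrow>
      (\<Sum>M\<in>msets m n. F M * (\<Prod>i\<in>#M. of_nat z ^ (Suc n ^ i))) = (\<Sum>M\<in>msets m n. G M * (\<Prod>i\<in>#M. of_nat z ^ (Suc n ^ i)))"
    and M: "M \<in> msets m n"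
  shows "F M = G M"
proof -
  \<comment> \<open>A polynomial in the evaluation point \<open>z\<close>. It vanishes at every
    positive integer, and in characteristic 0 these are infinitely many points.\<close>
  define P where "P = (\<Sum>M\<in>msets m n. monom (F M - G M) (code (Suc n) M))"
  have pr: "(\<Prod>i\<in>#M. x ^ (Suc n ^ i)) = x ^ code (Suc n) M" for x :: 'k and M
    by (induction M) (simp_all add: code_def power_add)
  have "poly P (of_nat (Suc z)) = 0" for z
    using eq[of "Suc z"] unfolding pr P_def poly_sum poly_monom left_diff_distrib sum_subtractf by simp
  then have sub: "range (\<lambda>z. of_nat (Suc z)) \<subseteq> {x. poly P x = 0}" by blast
  have "infinite (range (\<lambda>z. of_nat (Suc z) :: 'k))"
    by (rule range_inj_infinite) (simp add: inj_def del: of_nat_Suc)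
  then have "P = 0" using sub poly_roots_finite[of P] finite_subset by blast
  then have "0 = coeff P (code (Suc n) M)" by simp
  also have "\<dots> = (\<Sum>N\<in>msets m n. if N = M then F M - G M else 0)"
    unfolding P_def coeff_sum coeff_monom
  proof (intro sum.cong refl)
    fix N assume "N \<in> msets m n"
    then have "code (Suc n) N = code (Suc n) M \<longleftrightarrow> N = M"
      using inj_onD[OF inj_code[of n m]] M by blast
    then show "(if code (Suc n) N = code (Suc n) M then F N - G N else 0) = (if N = M then F M - G M else 0)" by simp
  qed
  also have "\<dots> = F M - G M" using M by simp
  finally show ?thesis by simp
qed

lemma qvar_nonzero: "qvar \<noteq> 0"
  by (simp add: qvar_def)

lemma qvar_pow_inj: "qvar ^ x = qvar ^ y \<longleftrightarrow> x = y"
proof -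
  have "degree (monom (1 :: int) k) = k" for k by (simp add: degree_monom_eq)
  then have "monom (1 :: int) x = monom 1 y \<longleftrightarrow> x = y" by metis
  then show ?thesis by (simp flip: qvar_power)
qed

text \<open>\<open>int poly fract\<close> is an ordered field, so a nonempty sum of products of
  positive elements is nonzero. This makes powers of positive integers admissible as values of the
  variables.\<close>

lemma generic_positive:
  assumes "\<And>i. (0 :: int poly fract) < t i"
  shows "generic_systems qvar t m"
proof
  show "qvar \<noteq> 0" by (rule qvar_nonzero)
  show "qvar ^ i \<noteq> 1" if "0 < i" for i using qvar_pow_inj[of i 0] that by simp
  show "esym t m c \<noteq> 0" if "c \<le> m" for c
  proof -
    have "0 < esym t m c"
      unfolding esym_def
    proof (rule sum_pos)
      have "{1..c} \<in> {S. S \<subseteq> {1..m} \<and> card S = c}" using that by auto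
      then show "{S. S \<subseteq> {1..m} \<and> card S = c} \<noteq> {}" by blast
    qed (auto intro: prod_pos assms)
    then show ?thesis by simp
  qed
qed

context generic_systems
begin

lemma prod_row_wt: "L \<le> m \<Longrightarrow> (\<Prod>i=1..L. row_wt q t m i) = qfact q L * esym t m L / q ^ \<Sum>{..<L}"
proof (induction L)
  case (Suc L)
  then have "esym t m L \<noteq> 0" using esym_nz by simp
  then show ?case using Suc q0 by (simp add: row_wt_def qfact_def power_add mult_ac)
qed (simp add: qfact_def)

lemma word_wt_column:
  assumes "cs \<in> words {1..m} n"
  shows "word_wt True e cs = col_wt q e cs * (\<Prod>k<length cs. row_wt q t m (cs ! k))"
proof -
  have "sys_wt q t m True A (cs ! k) = cphi q A (cs ! k) * row_wt q t m (cs ! k)" if "k < length cs" for A k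
  proof -
    have "cs ! k \<in> {1..m}" using assms that nth_mem by (fastforce simp: words_def)
    then show ?thesis by (simp add: sys_wt_def cphi_def)
  qed
  then show ?thesis
    unfolding word_wt_def col_wt_def prod.distrib[symmetric] by (intro prod.cong refl) auto
qed

abbreviation "shape_wt lam \<equiv> \<Prod>j<length lam. qfact q (lam ! j) * esym t m (lam ! j) / q ^ \<Sum>{..<lam ! j}"

text \<open>A lattice word of length \<open>n\<close> has letters at most \<open>n\<close>, so for
  \<open>n \<le> m\<close> the alphabet holds all of them; the other words have weight 0.\<close>

lemma column_sum:
  assumes nm: "n \<le> m"
  shows "(\<Sum>cs\<in>words {1..m} n. word_wt True e cs) =
    (\<Sum>lam\<in>partitions n. (\<Sum>T\<in>SYT lam. pT q e T)
       * shape_wt lam)"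
proof -
  let ?X = "{cs \<in> words {1..m} n. lattice cs}"
  have fin: "finite (words {1..m} n)" by (rule finite_words) simp
  have U: "?X = (\<Union>lam\<in>partitions n. lattice_words n lam)"
  proof (intro equalityI subsetI)
    fix cs assume "cs \<in> ?X"
    then have cs: "length cs = n" "lattice cs" by (auto simp: words_def)
    obtain lam where "lam \<in> partitions (length cs)" "dom (tabw cs) = diagram lam"
      using lattice_shape[OF cs(2)] .
    then show "cs \<in> (\<Union>lam\<in>partitions n. lattice_words n lam)" using cs by (auto simp: lattice_words_def)
  next
    fix cs assume "cs \<in> (\<Union>lam\<in>partitions n. lattice_words n lam)"
    then have cs: "length cs = n" "lattice cs" by (auto simp: lattice_words_def)
    have "set cs \<subseteq> {1..m}"
    proof
      fix x assume x: "x \<in> set cs"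
      have "x \<noteq> 0" using cs(2) x unfolding lattice_def by metis
      then show "x \<in> {1..m}" using lattice_le_length[OF cs(2) x] cs(1) nm by simp
    qed
    then show "cs \<in> ?X" using cs by (simp add: words_def)
  qed
  have "(\<Sum>cs\<in>words {1..m} n. word_wt True e cs) = (\<Sum>cs\<in>?X. word_wt True e cs)"
  proof (rule sum.mono_neutral_right[OF fin])
    show "\<forall>cs\<in>words {1..m} n - ?X. word_wt True e cs = 0"
    proof
      fix cs assume cs: "cs \<in> words {1..m} n - ?X"
      then have "0 \<notin> set cs" by (auto simp: words_def)
      then have "col_wt q e cs = 0" using col_wt_lattice[of cs q e] cs by blast
      then show "word_wt True e cs = 0" using word_wt_column[of cs n e] cs by simp
    qed
  qed auto
  also have "\<dots> = (\<Sum>lam\<in>partitions n. \<Sum>cs\<in>lattice_words n lam. word_wt True e cs)"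
    unfolding U
  proof (rule sum.UNION_disjoint)
    show "\<forall>lam\<in>partitions n. finite (lattice_words n lam)"
      using U finite_subset[OF _ fin] by blast
    show "\<forall>lam\<in>partitions n. \<forall>mu\<in>partitions n. lam \<noteq> mu \<longrightarrow> lattice_words n lam \<inter> lattice_words n mu = {}"
      using partitions_diagram_inj by (fastforce simp: lattice_words_def)
  qed simp
  also have "\<dots> = (\<Sum>lam\<in>partitions n. (\<Sum>T\<in>SYT lam. pT q e T)
       * shape_wt lam)"
  proof (intro sum.cong refl)
    fix lam assume lam: "lam \<in> partitions n"
    have row: "lam ! j \<le> m" if "j < length lam" for j
      using member_le_sum_list[of "lam ! j" lam] that lam nm by (auto simp: partitions_def)
    have "word_wt True e cs = pT q e (tabw cs) * shape_wt lam"
      if cs: "cs \<in> lattice_words n lam" for cs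
    proof -
      have "cs \<in> words {1..m} n" using U cs lam by blast
      moreover have "pT q e (tabw cs) = col_wt q e cs"
        using cs by (intro pT_tabw q0 q_pow_eq_iff) (simp add: lattice_words_def)
      moreover have "(\<Prod>k<length cs. row_wt q t m (cs ! k)) = (\<Prod>j<length lam. \<Prod>i=1..lam ! j. row_wt q t m i)"
        using cs by (intro prod_over_word) (simp add: lattice_words_def)
      moreover have "\<dots> = shape_wt lam"
        by (intro prod.cong refl prod_row_wt row) simp
      ultimately show ?thesis using word_wt_column[of cs n e] by simp
    qed
    then have "(\<Sum>cs\<in>lattice_words n lam. word_wt True e cs) = (\<Sum>cs\<in>lattice_words n lam. pT q e (tabw cs))
        * shape_wt lam"
      unfolding sum_distrib_right by (intro sum.cong refl) auto
    also have "(\<Sum>cs\<in>lattice_words n lam. pT q e (tabw cs)) = (\<Sum>T\<in>SYT lam. pT q e T)"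
      by (rule sum.reindex_bij_betw[OF bij_tabw[OF lam]])
    finally show "(\<Sum>cs\<in>lattice_words n lam. word_wt True e cs) = (\<Sum>T\<in>SYT lam. pT q e T)
       * shape_wt lam" .
  qed
  finally show ?thesis .
qed

end

section \<open>Exponents of \<open>q\<close> and the resulting expansion\<close>

lemma sum_lessThan_add: "\<Sum>{..<a + b} = \<Sum>{..<a} + \<Sum>{..<b} + a * (b :: nat)"
  by (induction b) (simp_all add: algebra_simps)

lemma part_pairs_snoc: "part_pairs (lam @ [x]) = part_pairs lam + sum_list lam * x"
proof -
  let ?P = "\<lambda>n. {(i, j). i < j \<and> j < (n :: nat)}" and ?n = "length lam"
  have fin: "finite (?P n)" for n by (rule finite_subset[of _ "{..<n} \<times> {..<n}"]) auto
  have split: "?P (Suc ?n) = ?P ?n \<union> (\<lambda>i. (i, ?n)) ` {..<?n}" by (auto simp: less_Suc_eq)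
  have "part_pairs (lam @ [x]) = (\<Sum>(i, j)\<in>?P ?n. (lam @ [x]) ! i * (lam @ [x]) ! j)
     + (\<Sum>(i, j)\<in>(\<lambda>i. (i, ?n)) ` {..<?n}. (lam @ [x]) ! i * (lam @ [x]) ! j)"
    unfolding part_pairs_def length_append_singleton split using fin by (intro sum.union_disjoint) auto
  also have "(\<Sum>(i, j)\<in>?P ?n. (lam @ [x]) ! i * (lam @ [x]) ! j) = part_pairs lam"
    unfolding part_pairs_def by (intro sum.cong refl) (auto simp: nth_append)
  also have "(\<Sum>(i, j)\<in>(\<lambda>i. (i, ?n)) ` {..<?n}. (lam @ [x]) ! i * (lam @ [x]) ! j) = sum_list lam * x"
    by (subst sum.reindex) (auto simp: inj_on_def sum_list_sum_nth atLeast0LessThan sum_distrib_right nth_append)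
  finally show ?thesis .
qed

text \<open>\<open>\<Sum>{..<n}\<close> counts the pairs in a set of size \<open>n\<close>; for a
  set cut into blocks of sizes \<open>lam\<close>, a pair lies across two blocks or within one. This
  turns the exponents of the row weights into \<open>part_pairs\<close>.\<close>

lemma sum_lessThan_sum_list: "\<Sum>{..<sum_list lam} = part_pairs lam + (\<Sum>j<length lam. \<Sum>{..<lam ! j})"
proof (induction lam rule: rev_induct)
  case (snoc x lam)
  then show ?case by (simp add: sum_lessThan_add part_pairs_snoc nth_append)
qed (simp add: part_pairs_def)

text \<open>The predicted coefficient, with the powers of \<open>q\<close> as the two sums produce
  them: \<open>card (edges n e)\<close> from the colorings, the exponents
  \<open>\<Sum>{..<lam ! j}\<close> from the row weights.\<close>

definition hikita_coeff :: "nat \<Rightarrow> (nat \<Rightarrow> nat) \<Rightarrow> nat list \<Rightarrow> int poly fract" where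
  "hikita_coeff n e lam = qvar ^ card (edges n e) * (\<Sum>T\<in>SYT lam. pT qvar e T)
     * (\<Prod>j<length lam. qfact qvar (lam ! j) / qvar ^ \<Sum>{..<lam ! j})"

lemma chrom_expansion:
  assumes e: "e \<in> ESeq n"
  shows "to_fract (chrom_qsym n e M) = (\<Sum>lam\<in>partitions n. hikita_coeff n e lam * elem_sym_part lam M)"
proof (cases "size M = n \<and> 0 \<notin># M")
  case False
  have "{\<kappa>. \<kappa> \<in> proper_colorings n e \<and> image_mset \<kappa> (mset_set {1..n}) = M} = {}"
  proof (rule ccontr)
    assume "{\<kappa>. \<kappa> \<in> proper_colorings n e \<and> image_mset \<kappa> (mset_set {1..n}) = M} \<noteq> {}"
    then obtain \<kappa> where \<kappa>: "\<kappa> \<in> {1..n} \<rightarrow>\<^sub>E {1..}" "M = image_mset \<kappa> (mset_set {1..n})"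
      by (auto simp: proper_colorings_def)
    then have "size M = n" by simp
    moreover have "0 \<notin># M"
    proof
      assume "0 \<in># M"
      then obtain v where "v \<in> {1..n}" "\<kappa> v = 0" using \<kappa>(2) by auto
      then show False using PiE_mem[OF \<kappa>(1), of v] by simp
    qed
    ultimately show False using False by simp
  qed
  then have c: "chrom_qsym n e M = 0" unfolding chrom_qsym_def by (simp only: sum.empty)
  have h: "hikita_coeff n e lam * elem_sym_part lam M = 0" if "lam \<in> partitions n" for lam
    using elem_sym_part_nonzero[of lam M] that False by (auto simp: partitions_def)
  show ?thesis unfolding c to_fract_0 by (rule sum.neutral[symmetric]) (blast intro: h)
next
  case True
  let ?E = "\<lambda>M. \<Sum>lam\<in>partitions n. hikita_coeff n e lam * elem_sym_part lam M"
  \<comment> \<open>The variables must include those of \<open>M\<close>, and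
    \<open>column_sum\<close> requires at least \<open>n\<close> of them.\<close>
  define m where "m = max n (Max (set_mset M \<union> {0}))"
  have nm: "n \<le> m" by (simp add: m_def)
  have "set_mset M \<subseteq> {1..m}"
  proof
    fix x assume x: "x \<in># M"
    then have "x \<le> Max (set_mset M \<union> {0})" by (intro Max_ge) auto
    moreover have "x \<noteq> 0" using x True by metis
    ultimately show "x \<in> {1..m}" by (simp add: m_def)
  qed
  then have M: "M \<in> msets m n" using True by (simp add: msets_def)
  show ?thesis
  proof (rule kronecker_eqI[OF _ M, of "\<lambda>M. to_fract (chrom_qsym n e M)"
        ?E])
    fix z :: nat assume z: "0 < z"
    define t :: "nat \<Rightarrow> int poly fract" where "t i = of_nat z ^ (Suc n ^ i)" for i
    have gen: "generic_systems qvar t m"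
      by (rule generic_positive) (simp add: t_def z)
    interpret generic_systems qvar t m by (rule gen)
    have "(\<Sum>M\<in>msets m n. to_fract (chrom_qsym n e M) * (\<Prod>i\<in>#M. t i))
      = qvar ^ card (edges n e) * (\<Sum>cs\<in>words {1..m} n. word_wt True e cs)"
      using color_sum[OF gen e] column_sum_eq_color_sum[OF e] by (simp only: mult.commute)
    also have "\<dots> = (\<Sum>lam\<in>partitions n. hikita_coeff n e lam * (\<Prod>j<length lam. esym t m (lam ! j)))"
      unfolding column_sum[OF nm] sum_distrib_left
    proof (intro sum.cong refl)
      fix lam
      have "(\<Prod>j<length lam. qfact qvar (lam ! j) * esym t m (lam ! j) / qvar ^ \<Sum>{..<lam ! j})
        = (\<Prod>j<length lam. qfact qvar (lam ! j) / qvar ^ \<Sum>{..<lam ! j}) * (\<Prod>j<length lam. esym t m (lam ! j))"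
        by (simp add: prod.distrib[symmetric])
      then show "qvar ^ card (edges n e) * ((\<Sum>T\<in>SYT lam. pT qvar e T)
           * (\<Prod>j<length lam. qfact qvar (lam ! j) * esym t m (lam ! j) / qvar ^ \<Sum>{..<lam ! j}))
        = hikita_coeff n e lam * (\<Prod>j<length lam. esym t m (lam ! j))"
        by (simp only: hikita_coeff_def mult.assoc)
    qed
    also have "\<dots> = (\<Sum>lam\<in>partitions n. \<Sum>M\<in>msets m n. hikita_coeff n e lam * elem_sym_part lam M * (\<Prod>i\<in>#M. t i))"
    proof (intro sum.cong refl)
      fix lam assume "lam \<in> partitions n"
      then have n: "sum_list lam = n" by (simp add: partitions_def)
      have "(\<Prod>j<length lam. esym t m (lam ! j)) = (\<Prod>x\<leftarrow>lam. esym t m x)"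
        by (simp add: prod.list_conv_set_nth atLeast0LessThan)
      also have "\<dots> = (\<Sum>M\<in>msets m n. elem_sym_part lam M * (\<Prod>i\<in>#M. t i))"
        using elem_sym_part_eval[of lam t m] by (simp only: n)
      finally show "hikita_coeff n e lam * (\<Prod>j<length lam. esym t m (lam ! j))
         = (\<Sum>M\<in>msets m n. hikita_coeff n e lam * elem_sym_part lam M * (\<Prod>i\<in>#M. t i))"
        by (simp only: sum_distrib_left mult.assoc)
    qed
    also have "\<dots> = (\<Sum>M\<in>msets m n. ?E M * (\<Prod>i\<in>#M. t i))"
      unfolding sum_distrib_right by (rule sum.swap)
    finally show "(\<Sum>M\<in>msets m n. to_fract (chrom_qsym n e M) * (\<Prod>i\<in>#M. of_nat z ^ (Suc n ^ i)))
      = (\<Sum>M\<in>msets m n. ?E M * (\<Prod>i\<in>#M. of_nat z ^ (Suc n ^ i)))"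
      by (simp only: t_def)
  qed
qed

text \<open>
  Evaluation at \<open>q = 1\<close> is not defined on all of \<open>int poly fract\<close>; \<open>P\<close> and \<open>Q\<close> need not be in lowest terms.
\<close>

definition nonneg_at_1 :: "int poly fract \<Rightarrow> bool" where
  "nonneg_at_1 r \<longleftrightarrow> (\<exists>P Q. r = to_fract P / to_fract Q \<and> 0 \<le> poly P 1 \<and> 0 < poly Q 1)"

lemma nonneg_at_1_to_fract: "0 \<le> poly P 1 \<Longrightarrow> nonneg_at_1 (to_fract P)"
  unfolding nonneg_at_1_def by (intro exI[of _ P] exI[of _ 1]) simp

text \<open>Cross-multiplication gives an identity of polynomials, which can be evaluated at 1; as
  the denominator is positive there, the sign does not depend on the representation.\<close>

lemma nonneg_at_1_to_fractD: "nonneg_at_1 (to_fract P) \<Longrightarrow> 0 \<le> poly P 1"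
proof -
  assume "nonneg_at_1 (to_fract P)"
  then obtain A B where AB: "to_fract P = to_fract A / to_fract B" "0 \<le> poly A 1" "0 < poly B 1"
    by (auto simp: nonneg_at_1_def)
  then have "B \<noteq> 0" by auto
  then have "to_fract (P * B) = to_fract A" using AB(1) by (simp add: field_simps)
  then have "P * B = A" unfolding to_fract_eq_iff .
  then have "poly P 1 * poly B 1 = poly A 1" by (metis poly_mult)
  then show ?thesis using AB by (metis zero_le_mult_iff not_le less_imp_le order.strict_iff_not)
qed

lemma nonneg_at_1_add: "nonneg_at_1 r \<Longrightarrow> nonneg_at_1 s \<Longrightarrow> nonneg_at_1 (r + s)"
proof -
  assume "nonneg_at_1 r" "nonneg_at_1 s"
  then obtain A B C D where *: "r = to_fract A / to_fract B" "0 \<le> poly A 1" "0 < poly B 1"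
    "s = to_fract C / to_fract D" "0 \<le> poly C 1" "0 < poly D 1" unfolding nonneg_at_1_def by blast
  then have "B \<noteq> 0" "D \<noteq> 0" by auto
  then have "r + s = to_fract (A * D + C * B) / to_fract (B * D)" using * by (simp add: field_simps)
  moreover have "0 \<le> poly (A * D + C * B) 1" "0 < poly (B * D) 1" using * by simp_all
  ultimately show ?thesis unfolding nonneg_at_1_def by blast
qed

lemma nonneg_at_1_mult: "nonneg_at_1 r \<Longrightarrow> nonneg_at_1 s \<Longrightarrow> nonneg_at_1 (r * s)"
proof -
  assume "nonneg_at_1 r" "nonneg_at_1 s"
  then obtain A B C D where *: "r = to_fract A / to_fract B" "0 \<le> poly A 1" "0 < poly B 1"
    "s = to_fract C / to_fract D" "0 \<le> poly C 1" "0 < poly D 1" unfolding nonneg_at_1_def by blast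
  then have "r * s = to_fract (A * C) / to_fract (B * D)" by simp
  moreover have "0 \<le> poly (A * C) 1" "0 < poly (B * D) 1" using * by simp_all
  ultimately show ?thesis unfolding nonneg_at_1_def by blast
qed

lemma nonneg_at_1_0: "nonneg_at_1 0" and nonneg_at_1_1: "nonneg_at_1 1"
  using nonneg_at_1_to_fract[of 0] nonneg_at_1_to_fract[of 1] by simp_all

lemma nonneg_at_1_sum: "(\<And>x. x \<in> A \<Longrightarrow> nonneg_at_1 (f x)) \<Longrightarrow> nonneg_at_1 (sum f A)"
  by (induction A rule: infinite_finite_induct) (auto simp: nonneg_at_1_0 intro: nonneg_at_1_add)

lemma nonneg_at_1_prod: "(\<And>x. x \<in> A \<Longrightarrow> nonneg_at_1 (f x)) \<Longrightarrow> nonneg_at_1 (prod f A)"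
  by (induction A rule: infinite_finite_induct) (auto simp: nonneg_at_1_1 intro: nonneg_at_1_mult)

lemma nonneg_at_1_qvar_power: "nonneg_at_1 (qvar ^ k)" "nonneg_at_1 (inverse (qvar ^ k))"
proof -
  show "nonneg_at_1 (qvar ^ k)" unfolding qvar_power[symmetric] by (rule nonneg_at_1_to_fract) (simp add: poly_monom)
  have "inverse (qvar ^ k) = to_fract 1 / to_fract (monom 1 k)" by (simp add: qvar_power inverse_eq_divide)
  then show "nonneg_at_1 (inverse (qvar ^ k))"
    unfolding nonneg_at_1_def by (intro exI[of _ 1] exI[of _ "monom 1 k"]) (simp add: poly_monom)
qed

lemma qint_to_fract: "qint qvar n = to_fract (\<Sum>i<n. monom 1 i)"
proof -
  have "1 - qvar \<noteq> 0" using qvar_pow_inj[of 1 0] by simp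
  then show ?thesis
    using one_diff_power_eq[of qvar n] by (simp add: qint_def qvar_power)
qed

lemma nonneg_at_1_qint: "nonneg_at_1 (qint qvar n)" "nonneg_at_1 (inverse (qint qvar n))"
proof -
  have v: "poly (\<Sum>i<n. monom (1 :: int) i) 1 = of_nat n" by (simp add: poly_sum poly_monom)
  then show "nonneg_at_1 (qint qvar n)" unfolding qint_to_fract by (intro nonneg_at_1_to_fract) simp
  show "nonneg_at_1 (inverse (qint qvar n))"
  proof (cases "n = 0")
    case True
    \<comment> \<open>\<open>qint qvar 0\<close> is 0, and so is its \<open>inverse\<close> by
      convention.\<close>
    then show ?thesis by (simp add: qint_def nonneg_at_1_0)
  next
    case False
    have "inverse (qint qvar n) = to_fract 1 / to_fract (\<Sum>i<n. monom 1 i)"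
      by (simp only: qint_to_fract inverse_eq_divide to_fract_1)
    moreover have "0 < poly (\<Sum>i<n. monom (1 :: int) i) 1" using v False by simp
    ultimately show ?thesis unfolding nonneg_at_1_def by (intro exI[of _ 1] exI[of _ "\<Sum>i<n. monom 1 i"]) simp
  qed
qed

lemma nonneg_at_1_phi: "nonneg_at_1 (phi qvar r k T)"
  unfolding phi_def Let_def divide_inverse
  by (intro nonneg_at_1_mult nonneg_at_1_prod nonneg_at_1_qvar_power nonneg_at_1_qint)

lemma nonneg_at_1_pT: "nonneg_at_1 (pT qvar e T)"
  unfolding pT_def by (auto intro: nonneg_at_1_prod nonneg_at_1_phi nonneg_at_1_0)

lemma nonneg_at_1_hikita_coeff: "nonneg_at_1 (hikita_coeff n e lam)"
  unfolding hikita_coeff_def divide_inverse qfact_def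
  by (intro nonneg_at_1_mult nonneg_at_1_sum nonneg_at_1_prod nonneg_at_1_qvar_power nonneg_at_1_qint nonneg_at_1_pT)

lemma qfact_nonzero: "qfact qvar k \<noteq> 0"
proof -
  have "qint qvar i \<noteq> 0" if "i \<in> {1..k}" for i
    using qvar_pow_inj[of i 0] qvar_pow_inj[of 1 0] that by (simp add: qint_def)
  then show ?thesis by (simp add: qfact_def)
qed

theorem theorem1p3:
  fixes n :: nat and lam :: "nat list" and e :: "nat \<Rightarrow> nat"
  assumes "lam \<in> partitions n" and "e \<in> ESeq n"
  shows "qvar powi (int (eseq_sum n e) - int (part_pairs lam))
           * (to_fract (e_coeff n e lam) / (\<Prod>i<length lam. qfact qvar (lam ! i)))
         = (\<Sum>T\<in>SYT lam. pT qvar e T)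
       \<and> 0 \<le> poly (e_coeff n e lam) 1"
proof
  have c: "to_fract (e_coeff n e lam) = hikita_coeff n e lam"
    by (rule e_coeff_unique[OF chrom_expansion[OF assms(2)] assms(1)])
  show "0 \<le> poly (e_coeff n e lam) 1"
    using nonneg_at_1_hikita_coeff[of n e lam] unfolding c[symmetric] by (rule nonneg_at_1_to_fractD)
  let ?D = "\<Sum>j<length lam. \<Sum>{..<lam ! j}" and ?F = "\<Prod>i<length lam. qfact qvar (lam ! i)"
  have "card (edges n e) + eseq_sum n e = part_pairs lam + ?D"
    using card_edges_eseq_sum[OF assms(2)] sum_lessThan_sum_list[of lam] assms(1) by (simp add: partitions_def)
  \<comment> \<open>Edges together with \<open>eseq_sum\<close>, and \<open>part_pairs\<close>
    together with \<open>?D\<close>, both count all pairs of vertices.\<close>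
  then have ex: "int (eseq_sum n e) - int (part_pairs lam) = int ?D - int (card (edges n e))" by linarith
  have "(\<Prod>j<length lam. qfact qvar (lam ! j) / qvar ^ \<Sum>{..<lam ! j}) = ?F / qvar ^ ?D"
    by (simp add: prod_dividef power_sum)
  moreover have "?F \<noteq> 0" by (simp add: qfact_nonzero)
  ultimately show "qvar powi (int (eseq_sum n e) - int (part_pairs lam)) * (to_fract (e_coeff n e lam) / ?F)
      = (\<Sum>T\<in>SYT lam. pT qvar e T)"
    unfolding ex c hikita_coeff_def using qvar_nonzero by (simp add: power_int_diff del: of_nat_sum)
qed

end
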